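(* Let $\alpha,\beta\in\mathbb{R}$ and let $m$ be a Fourier multiplier on $\mathbb{R}^d$ for which there exists $\sigma>d/2$ such that for every $0\le\theta\le\sigma$, $$\sup_{B,\Psi_B}\ \operatorname{dist}(B,0)^{\beta+(1-\alpha)\theta}\,|B|^{-1/2}\,\|m\Psi_B\|_{\dot H^\theta}<\infty,$$ where the supremum is over all $\alpha$-subdyadic balls $B$ and all normalised bump functions $\Psi_B$ adapted to $B$. Then, with $\lambda=2\sigma/d>1$, $$g_{\alpha,\beta}(T_mf)(x)\lesssim g^*_{\alpha,0,\lambda}(f)(x),$$ with implicit constant independent of $f$ and $x\in\mathbb{R}^d$.
   Context: $T_m$ denotes the operator with $\widehat{T_mf}=m\widehat f$; $\dot H^\theta$ is the homogeneous Sobolev space of order $\theta$. A euclidean ball $B\subset\mathbb{R}^d$ with radius $r(B)$ is $\alpha$-subdyadic if $\operatorname{dist}(B,0)^\alpha\ge1$ and $r(B)\sim\operatorname{dist}(B,0)^{1-\alpha}$, with fixed implicit constants chosen so that $\operatorname{dist}(\widetilde B,0)\sim\operatorname{dist}(B,0)$, where $\widetilde B$ is the concentric double of $B$. A normalised bump function is a smooth $\Psi$ supported in the unit ball with $\|D^\gamma\Psi\|_\infty\le1$ for all multi-indices $|\gamma|\le N$ ($N$ a fixed number exceeding $d$); a normalised bump function adapted to $B$ is $\Psi\circ A_B^{-1}$, where $\Psi$ is a normalised bump function and $A_B$ is the affine map taking the unit ball onto $\widetilde B$. Fix a Schwartz function $\phi$ with $\widehat\phi$ supported in $\{1\le|\xi|\le2\}$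 if $\alpha\ge0$ and in $\{1/2\le|\xi|\le1\}$ if $\alpha<0$, with $\int_0^\infty\widehat\phi(t\xi)\,dt/t=1$ for $\xi\neq0$; $\phi_t(x)=t^{-d}\phi(x/t)$. Let $\Gamma_\alpha(x)=\{(y,t)\in\mathbb{R}^d\times\mathbb{R}_+: t^\alpha\le1,\ |y-x|\le t^{1-\alpha}\}$ and define $$g_{\alpha,\beta}(f)(x)=\Big(\int_{\Gamma_\alpha(x)}|f*\phi_t(y)|^2\frac{dy}{t^{(1-\alpha)d+2\beta}}\frac{dt}{t}\Big)^{1/2},$$ $$g^*_{\alpha,\beta,\lambda}(f)(x)=\Big(\int_{t^\alpha\le1}\int_{\mathbb{R}^d}|f*\phi_t(y)|^2\Big(1+\frac{|x-y|}{t^{1-\alpha}}\Big)^{-d\lambda}\frac{dy}{t^{(1-\alpha)d+2\beta}}\frac{dt}{t}\Big)^{1/2}.$$ *)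

theory Defs
  imports "HOL-Analysis.Analysis"
begin

text \<open>Iterated directional (Frechet) derivatives along a list of directions.
  Restricted to lists of standard basis vectors, these are exactly the
  partial derivatives D^gamma (with |gamma| = length of the list).\<close>
fun iderv :: "'a::real_normed_vector list \<Rightarrow> ('a \<Rightarrow> 'b::real_normed_vector) \<Rightarrow> 'a \<Rightarrow> 'b" where
  "iderv [] f = f"
| "iderv (v # vs) f = (\<lambda>x. frechet_derivative (iderv vs f) (at x) v)"

definition smooth_fun :: "('a::euclidean_space \<Rightarrow> 'b::real_normed_vector) \<Rightarrow> bool" where
  "smooth_fun f \<longleftrightarrow> (\<forall>vs. set vs \<subseteq> Basis \<longrightarrow> (\<forall>x. iderv vs f differentiable (at x)))"

definition schwartz :: "('a::euclidean_space \<Rightarrow> complex) \<Rightarrow> bool" where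
  "schwartz f \<longleftrightarrow> smooth_fun f \<and>
     (\<forall>vs (k::nat). set vs \<subseteq> Basis \<longrightarrow>
        (\<exists>C. \<forall>x. (1 + norm x) ^ k * norm (iderv vs f x) \<le> C))"

definition fourier :: "('a::euclidean_space \<Rightarrow> complex) \<Rightarrow> 'a \<Rightarrow> complex" where
  "fourier g \<xi> = (LINT x|lborel. g x * exp (- (2 * pi * \<i>) * complex_of_real (x \<bullet> \<xi>)))"

definition hsob_finite :: "real \<Rightarrow> ('a::euclidean_space \<Rightarrow> complex) \<Rightarrow> bool" where
  "hsob_finite \<theta> g \<longleftrightarrow> integrable lborel g \<and>
     integrable lborel (\<lambda>\<xi>. norm \<xi> powr (2 * \<theta>) * (cmod (fourier g \<xi>))\<^sup>2)"

definition hsob_norm :: "real \<Rightarrow> ('a::euclidean_space \<Rightarrow> complex) \<Rightarrow> real" where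
  "hsob_norm \<theta> g = sqrt (LINT \<xi>|lborel. norm \<xi> powr (2 * \<theta>) * (cmod (fourier g \<xi>))\<^sup>2)"

definition subdyadic :: "real \<Rightarrow> real \<Rightarrow> real \<Rightarrow> 'a::euclidean_space \<Rightarrow> real \<Rightarrow> bool" where
  "subdyadic c1 c2 \<alpha> c r \<longleftrightarrow> r > 0 \<and>
     infdist 0 (ball c r) powr \<alpha> \<ge> 1 \<and>
     c1 * infdist 0 (ball c r) powr (1 - \<alpha>) \<le> r \<and>
     r \<le> c2 * infdist 0 (ball c r) powr (1 - \<alpha>)"

definition normalised_bump :: "nat \<Rightarrow> ('a::euclidean_space \<Rightarrow> real) \<Rightarrow> bool" where
  "normalised_bump N \<Psi> \<longleftrightarrow> smooth_fun \<Psi> \<and> {x. \<Psi> x \<noteq> 0} \<subseteq> cball 0 1 \<and>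
     (\<forall>vs. set vs \<subseteq> Basis \<and> length vs \<le> N \<longrightarrow> (\<forall>x. \<bar>iderv vs \<Psi> x\<bar> \<le> 1))"

text \<open>Normalised bump adapted to B = ball c r: Psi o A_B^{-1}, where A_B x = c + 2 r x maps the
  unit ball onto the concentric double of B.\<close>
definition adapted_bump :: "('a::euclidean_space \<Rightarrow> real) \<Rightarrow> 'a \<Rightarrow> real \<Rightarrow> 'a \<Rightarrow> real" where
  "adapted_bump \<Psi> c r \<xi> = \<Psi> ((1 / (2 * r)) *\<^sub>R (\<xi> - c))"

definition dil :: "('a::euclidean_space \<Rightarrow> complex) \<Rightarrow> real \<Rightarrow> 'a \<Rightarrow> complex" where
  "dil \<phi> t x = complex_of_real (t powr (- real DIM('a))) * \<phi> ((1 / t) *\<^sub>R x)"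

definition conv_dil :: "('a::euclidean_space \<Rightarrow> complex) \<Rightarrow> ('a \<Rightarrow> complex) \<Rightarrow> real \<Rightarrow> 'a \<Rightarrow> complex" where
  "conv_dil f \<phi> t y = (LINT z|lborel. f z * dil \<phi> t (y - z))"

text \<open>(T_m f) * phi_t (y), computed on the Fourier side:
  int m(xi) hat f(xi) hat phi(t xi) e^{2 pi i y.xi} dxi.\<close>
definition multiplier_conv_dil :: "('a::euclidean_space \<Rightarrow> complex) \<Rightarrow> ('a \<Rightarrow> complex) \<Rightarrow> ('a \<Rightarrow> complex)
    \<Rightarrow> real \<Rightarrow> 'a \<Rightarrow> complex" where
  "multiplier_conv_dil m f \<phi> t y =
     (LINT \<xi>|lborel. m \<xi> * fourier f \<xi> * fourier \<phi> (t *\<^sub>R \<xi>) * exp ((2 * pi * \<i>) * complex_of_real (y \<bullet> \<xi>)))"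

text \<open>Squares of the square functions, for a given family F t y (playing the role of f * phi_t(y)).\<close>
definition g_sq :: "real \<Rightarrow> real \<Rightarrow> (real \<Rightarrow> 'a::euclidean_space \<Rightarrow> complex) \<Rightarrow> 'a \<Rightarrow> ennreal" where
  "g_sq \<alpha> \<beta> F x = (\<integral>\<^sup>+ p. (case p of (y, t) \<Rightarrow>
      indicator {(y, t). t > 0 \<and> t powr \<alpha> \<le> 1 \<and> norm (y - x) \<le> t powr (1 - \<alpha>)} (y, t) *
      ennreal ((cmod (F t y))\<^sup>2 * t powr (- ((1 - \<alpha>) * real DIM('a) + 2 * \<beta>)) / t)) \<partial>lborel)"

definition g_star_sq :: "real \<Rightarrow> real \<Rightarrow> real \<Rightarrow> (real \<Rightarrow> 'a::euclidean_space \<Rightarrow> complex) \<Rightarrow> 'a \<Rightarrow> ennreal" where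
  "g_star_sq \<alpha> \<beta> lam F x = (\<integral>\<^sup>+ p. (case p of (y, t) \<Rightarrow>
      indicator {(y, t). t > 0 \<and> t powr \<alpha> \<le> 1} (y, t) *
      ennreal ((cmod (F t y))\<^sup>2 * (1 + norm (x - y) / t powr (1 - \<alpha>)) powr (- real DIM('a) * lam)
               * t powr (- ((1 - \<alpha>) * real DIM('a) + 2 * \<beta>)) / t)) \<partial>lborel)"

end

theory Submission
  imports Defs "HOL-Probability.Probability"
begin

text \<open>
  The estimate already holds at each scale \<open>t\<close> with \<open>t\<^sup>\<alpha> \<le> 1\<close>. Put \<open>R = t\<^bsup>1 - \<alpha>\<^esup>\<close>, \<open>F = f * \<phi>\<^sub>t\<close>,
  \<open>G = T\<^sub>m F\<close>, and let \<open>b\<close> be a smooth bump of radius \<open>\<delta> / R\<close>. Multiplying \<open>G\<close> by the transform of \<open>b\<^sup>2\<close>,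
  which is bounded below on the ball of radius \<open>R\<close>, convolves its transform with \<open>b\<^sup>2\<close>; by Plancherel
  it remains to bound \<open>\<integral> m \<cdot> b(\<sqdot> + \<zeta>) \<cdot> b(\<sqdot> + \<zeta>) \<F>F\<close> in mean square over \<open>\<zeta>\<close>. The function \<open>b(\<sqdot> + \<zeta>) \<F>F\<close> is
  the transform of some \<open>V\<^sub>\<zeta>\<close>, so the integral equals \<open>\<integral> \<F>(m b(\<sqdot> + \<zeta>)) V\<^sub>\<zeta>\<close>, to which Cauchy--Schwarz with weight
  \<open>(1 + |z| / R)\<^bsup>2\<sigma>\<^esup>\<close> applies. The first factor is controlled by the hypothesis with \<open>\<theta> = 0\<close> and \<open>\<theta> = \<sigma>\<close>,
  since \<open>b(\<sqdot> + \<zeta>)\<close> is a multiple of a bump adapted to a subdyadic ball whenever it meets the support of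
  \<open>\<F>F\<close>. In the second factor \<open>\<zeta> \<mapsto> V\<^sub>\<zeta>(z)\<close> is itself a Fourier transform, so Plancherel in \<open>\<zeta>\<close> recovers
  the weighted norm of \<open>F\<close>.
\<close>

section \<open>Characters and the Fourier transform\<close>

text \<open>The sizes fit together as follows. At scale \<open>t\<close> the spectrum of
  \<open>F\<close> has frequencies of size about \<open>1 / t\<close>, where subdyadic balls have
  radius about \<open>1 / R\<close>, dual to the section of radius \<open>R\<close> of the cone at
  height \<open>t\<close>. As \<open>t powr \<alpha> \<le> 1\<close> gives \<open>t \<le> R\<close>,
  the annulus may contain many such balls, while the regularity of \<open>m\<close> is known only
  inside each one. Summing over a cover by the triangle inequality would lose the number of balls,
  which is why the window moves continuously and both averages over its centre are done by
  Plancherel. The powers of \<open>R\<close> must then cancel: a ball contributes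
  \<open>t powr (2 * \<beta>) / R ^ DIM('a)\<close>, the transform of the window another
  \<open>1 / R ^ DIM('a)\<close>, and dividing by the squared lower bound restores
  \<open>R ^ (2 * DIM('a))\<close>. What remains, \<open>t powr (2 * \<beta>)\<close>, is the
  difference between the weights of the two square functions. Weighted norms may a priori be
  infinite, so the estimates live in \<open>ennreal\<close>, and of Plancherel only the inequality
  for integrable functions enters.\<close>

definition echar :: "real \<Rightarrow> complex" where
  "echar r = exp ((2 * pi * \<i>) * complex_of_real r)"

lemma norm_echar [simp]: "cmod (echar r) = 1"
  by (simp add: echar_def norm_exp_eq_Re)

lemma echar_add: "echar (r + s) = echar r * echar s"
  by (simp add: echar_def distrib_left exp_add)

lemma echar_minus_add: "echar (- (r + s)) = echar (- r) * echar (- s)"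
  using echar_add[of "- r" "- s"] by simp

lemma echar_0 [simp]: "echar 0 = 1"
  by (simp add: echar_def)

lemma cnj_echar: "cnj (echar r) = echar (- r)"
  by (simp add: echar_def exp_cnj)

lemma continuous_on_echar [continuous_intros]:
  "continuous_on A f \<Longrightarrow> continuous_on A (\<lambda>x. echar (f x))"
  unfolding echar_def by (intro continuous_intros)

lemma borel_measurable_echar [measurable]: "echar \<in> borel_measurable borel"
  by (intro borel_measurable_continuous_onI continuous_intros)

lemma fourier_echar: "fourier g \<xi> = (LINT x|lborel. g x * echar (- (x \<bullet> \<xi>)))"
  unfolding fourier_def echar_def by (simp add: mult.assoc)

lemma integrable_mult_echar [simp]:
  fixes g :: "'a::euclidean_space \<Rightarrow> complex"
  assumes "integrable lborel g" and [measurable]: "h \<in> borel_measurable borel"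
  shows "integrable lborel (\<lambda>x. g x * echar (h x))"
proof (rule Bochner_Integration.integrable_bound[OF assms(1)])
  have [measurable]: "g \<in> borel_measurable borel"
    using borel_measurable_integrable[OF assms(1)] by simp
  show "(\<lambda>x. g x * echar (h x)) \<in> borel_measurable lborel" by measurable
qed (simp add: norm_mult)

text \<open>A function that is not integrable has Bochner integral 0, so the bound survives without
  integrability.\<close>

lemma norm_integral_le_nn_integral:
  fixes f :: "'b \<Rightarrow> 'c::{banach, second_countable_topology}"
  shows "ennreal (norm (integral\<^sup>L M f)) \<le> (\<integral>\<^sup>+x. ennreal (norm (f x)) \<partial>M)"
  using integral_norm_bound_ennreal[of M f] by (cases "integrable M f") (auto simp: not_integrable_integral_eq)

lemma norm_fourier_le: "cmod (fourier g \<xi>) \<le> (LINT x|lborel. cmod (g x))"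
  unfolding fourier_echar using integral_norm_bound[of lborel "\<lambda>x. g x * echar (- (x \<bullet> \<xi>))"]
  by (simp add: norm_mult)

text \<open>Lets the \<open>measurable\<close> method treat Fourier integrals whose integrand and
  frequency depend on a parameter. Where the integrand is not integrable the value is 0, which does
  not disturb measurability.\<close>

lemma measurable_fourier_param [measurable (raw)]:
  fixes g :: "'b \<Rightarrow> 'a::euclidean_space \<Rightarrow> complex"
  assumes [measurable]: "(\<lambda>(p, x). g p x) \<in> borel_measurable (N \<Otimes>\<^sub>M borel)"
    and [measurable]: "k \<in> N \<rightarrow>\<^sub>M borel"
  shows "(\<lambda>p. fourier (g p) (k p)) \<in> borel_measurable N"
proof -
  have 1: "(\<lambda>(p, x). g p x * echar (- (x \<bullet> k p))) \<in> borel_measurable (N \<Otimes>\<^sub>M borel)"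
    by measurable
  also have "borel_measurable (N \<Otimes>\<^sub>M borel) = borel_measurable (N \<Otimes>\<^sub>M lborel)"
    by (intro measurable_cong_sets sets_pair_measure_cong) auto
  finally have "(\<lambda>p. LINT x|lborel. g p x * echar (- (x \<bullet> k p))) \<in> borel_measurable N"
    by (rule lborel.borel_measurable_lebesgue_integral)
  then show ?thesis by (simp add: fourier_echar)
qed

section \<open>Affine changes of variables\<close>

lemma nn_integral_lborel_affine:
  fixes f :: "'a::euclidean_space \<Rightarrow> ennreal"
  assumes [measurable]: "f \<in> borel_measurable borel" and c: "c \<noteq> 0"
  shows "(\<integral>\<^sup>+x. f x \<partial>lborel) = ennreal (\<bar>c\<bar> ^ DIM('a)) * (\<integral>\<^sup>+x. f (t + c *\<^sub>R x) \<partial>lborel)"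
  by (subst lborel_affine[OF c, of t])
     (simp add: nn_integral_density nn_integral_distr nn_integral_cmult)

lemma integral_lborel_affine:
  fixes f :: "'a::euclidean_space \<Rightarrow> 'b::{banach, second_countable_topology}"
  assumes [measurable]: "f \<in> borel_measurable borel" and c: "c \<noteq> 0"
  shows "(LINT x|lborel. f x) = \<bar>c\<bar> ^ DIM('a) *\<^sub>R (LINT x|lborel. f (t + c *\<^sub>R x))"
  by (subst lborel_affine[OF c, of t])
     (simp add: integral_density integral_distr)

lemma integrable_lborel_affine_iff:
  fixes f :: "'a::euclidean_space \<Rightarrow> 'b::{banach, second_countable_topology}"
  assumes [measurable]: "f \<in> borel_measurable borel" and c: "c \<noteq> 0"
  shows "integrable lborel (\<lambda>x. f (t + c *\<^sub>R x)) \<longleftrightarrow> integrable lborel f"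
proof -
  have "integrable lborel f \<longleftrightarrow> integrable lborel (\<lambda>x. \<bar>c\<bar> ^ DIM('a) *\<^sub>R f (t + c *\<^sub>R x))"
    by (subst lborel_affine[OF c, of t]) (simp add: integrable_density integrable_distr_eq)
  also have "\<dots> \<longleftrightarrow> integrable lborel (\<lambda>x. f (t + c *\<^sub>R x))"
    using c integrable_scaleR_right[of "inverse (\<bar>c\<bar> ^ DIM('a))" lborel "\<lambda>x. \<bar>c\<bar> ^ DIM('a) *\<^sub>R f (t + c *\<^sub>R x)"]
    by auto
  finally show ?thesis ..
qed

lemma nn_integral_lborel_shift:
  fixes f :: "'a::euclidean_space \<Rightarrow> ennreal"
  assumes [measurable]: "f \<in> borel_measurable borel"
  shows "(\<integral>\<^sup>+x. f (t + x) \<partial>lborel) = (\<integral>\<^sup>+x. f x \<partial>lborel)"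
    and "(\<integral>\<^sup>+x. f (t - x) \<partial>lborel) = (\<integral>\<^sup>+x. f x \<partial>lborel)"
  using nn_integral_lborel_affine[of f 1 t] nn_integral_lborel_affine[of f "-1" t] by auto

lemma integral_lborel_shift:
  fixes f :: "'a::euclidean_space \<Rightarrow> 'b::{banach, second_countable_topology}"
  assumes [measurable]: "f \<in> borel_measurable borel"
  shows "(LINT x|lborel. f (t + x)) = (LINT x|lborel. f x)"
    and "(LINT x|lborel. f (t - x)) = (LINT x|lborel. f x)"
  using integral_lborel_affine[of f 1 t] integral_lborel_affine[of f "-1" t] by auto

lemma integrable_lborel_shift:
  fixes f :: "'a::euclidean_space \<Rightarrow> 'b::{banach, second_countable_topology}"
  assumes "integrable lborel f"
  shows "integrable lborel (\<lambda>x. f (t + x))" and "integrable lborel (\<lambda>x. f (t - x))"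
  using integrable_lborel_affine_iff[of f 1 t] integrable_lborel_affine_iff[of f "-1" t] assms
    borel_measurable_integrable[OF assms] by auto

lemma fourier_shift:
  fixes g :: "'a::euclidean_space \<Rightarrow> complex"
  assumes [measurable]: "g \<in> borel_measurable borel"
  shows "fourier (\<lambda>x. g (t + x)) \<xi> = echar (t \<bullet> \<xi>) * fourier g \<xi>"
proof -
  have "fourier g \<xi> = (LINT x|lborel. g (t + x) * echar (- ((t + x) \<bullet> \<xi>)))"
    unfolding fourier_echar by (rule integral_lborel_shift(1)[symmetric]) measurable
  also have "\<dots> = (LINT x|lborel. echar (- (t \<bullet> \<xi>)) * (g (t + x) * echar (- (x \<bullet> \<xi>))))"
    by (intro Bochner_Integration.integral_cong) (auto simp: inner_add_left simp flip: echar_add)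
  also have "\<dots> = echar (- (t \<bullet> \<xi>)) * fourier (\<lambda>x. g (t + x)) \<xi>"
    unfolding fourier_echar by simp
  finally show ?thesis
    by (simp add: echar_add[symmetric] flip: mult.assoc)
qed

lemma fourier_scale:
  fixes g :: "'a::euclidean_space \<Rightarrow> complex"
  assumes [measurable]: "g \<in> borel_measurable borel" and s: "s \<noteq> 0"
  shows "fourier (\<lambda>x. g (s *\<^sub>R x)) \<xi> = complex_of_real (1 / \<bar>s\<bar> ^ DIM('a)) * fourier g ((1 / s) *\<^sub>R \<xi>)"
proof -
  have "fourier g ((1 / s) *\<^sub>R \<xi>) = (LINT x|lborel. g x * echar (- (x \<bullet> ((1 / s) *\<^sub>R \<xi>))))"
    unfolding fourier_echar ..
  also have "\<dots> = \<bar>s\<bar> ^ DIM('a) *\<^sub>R (LINT x|lborel. g (0 + s *\<^sub>R x) * echar (- ((0 + s *\<^sub>R x) \<bullet> ((1 / s) *\<^sub>R \<xi>))))"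
    by (rule integral_lborel_affine) (use s in auto)
  also have "\<dots> = \<bar>s\<bar> ^ DIM('a) *\<^sub>R fourier (\<lambda>x. g (s *\<^sub>R x)) \<xi>"
    using s by (simp add: fourier_echar)
  finally show ?thesis using s by (simp add: scaleR_conv_of_real)
qed

lemma fourier_minus:
  fixes g :: "'a::euclidean_space \<Rightarrow> complex"
  assumes "g \<in> borel_measurable borel"
  shows "fourier (\<lambda>x. g (- x)) \<xi> = fourier g (- \<xi>)"
  using fourier_scale[OF assms, of "-1" \<xi>] by simp

lemma fourier_mult_echar:
  "fourier (\<lambda>x. g x * echar (- (x \<bullet> \<eta>))) \<xi> = fourier g (\<xi> + \<eta>)"
  unfolding fourier_echar by (simp add: inner_add_right mult.assoc add.commute flip: echar_add)

section \<open>Fubini, the multiplication formula and convolution\<close>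

lemma integrable_pair_mult:
  fixes h g :: "'a::euclidean_space \<Rightarrow> complex"
  assumes h: "integrable lborel h" and g: "integrable lborel g"
    and [measurable]: "(\<lambda>p. k (fst p) (snd p)) \<in> borel_measurable (borel \<Otimes>\<^sub>M borel)"
    and k: "\<And>x y. cmod (k x y) \<le> C"
  shows "integrable (lborel \<Otimes>\<^sub>M lborel) (\<lambda>(x, y). h x * g y * k x y)"
proof -
  have [measurable]: "h \<in> borel_measurable borel" "g \<in> borel_measurable borel"
    using borel_measurable_integrable[OF h] borel_measurable_integrable[OF g] by auto
  have "integrable (lborel \<Otimes>\<^sub>M lborel) (\<lambda>(x, y). h x * g y)"
  proof (rule lborel_pair.Fubini_integrable)
    show "(\<lambda>(x, y). h x * g y) \<in> borel_measurable (lborel \<Otimes>\<^sub>M lborel)"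
      by measurable
    show "integrable lborel (\<lambda>x. LINT y|lborel. norm (case (x, y) of (x, y) \<Rightarrow> h x * g y))"
      using h by (simp add: norm_mult)
    show "AE x in lborel. integrable lborel (\<lambda>y. case (x, y) of (x, y) \<Rightarrow> h x * g y)"
      using g by simp
  qed
  then have "integrable (lborel \<Otimes>\<^sub>M lborel) (\<lambda>p. h (fst p) * g (snd p))"
    by (simp add: case_prod_beta')
  then have 1: "integrable (lborel \<Otimes>\<^sub>M lborel) (\<lambda>p. complex_of_real C * (h (fst p) * g (snd p)))"
    by (rule integrable_mult_right)
  have C: "0 \<le> C" using k[of 0 0] norm_ge_zero order_trans by blast
  have "(\<lambda>(x, y). h x * g y * k x y) \<in> borel_measurable (lborel \<Otimes>\<^sub>M lborel)"
  proof -
    have "(\<lambda>p. h (fst p) * g (snd p) * k (fst p) (snd p)) \<in> borel_measurable (borel \<Otimes>\<^sub>M borel)"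
      by measurable
    also have "borel_measurable (borel \<Otimes>\<^sub>M borel) = borel_measurable (lborel \<Otimes>\<^sub>M lborel)"
      by (intro measurable_cong_sets sets_pair_measure_cong) auto
    finally show ?thesis by (simp add: case_prod_beta)
  qed
  with 1 show ?thesis
  proof (rule Bochner_Integration.integrable_bound)
    show "AE p in lborel \<Otimes>\<^sub>M lborel. norm (case p of (x, y) \<Rightarrow> h x * g y * k x y)
        \<le> norm (complex_of_real C * (h (fst p) * g (snd p)))"
      using k C by (auto simp: norm_mult case_prod_beta mult.commute[of C] intro!: mult_left_mono)
  qed
qed

lemma Fubini_integral_mult:
  fixes h g :: "'a::euclidean_space \<Rightarrow> complex"
  assumes h: "integrable lborel h" and g: "integrable lborel g"
    and k: "(\<lambda>p. k (fst p) (snd p)) \<in> borel_measurable (borel \<Otimes>\<^sub>M borel)"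
      "\<And>x y. cmod (k x y) \<le> C"
  shows "(LINT x|lborel. h x * (LINT y|lborel. g y * k x y))
    = (LINT y|lborel. g y * (LINT x|lborel. h x * k x y))"
proof -
  have "(LINT x|lborel. h x * (LINT y|lborel. g y * k x y)) = (LINT x|lborel. LINT y|lborel. h x * g y * k x y)"
    by (simp add: mult.assoc)
  also have "\<dots> = (LINT y|lborel. LINT x|lborel. h x * g y * k x y)"
    by (rule lborel_pair.Fubini_integral[OF integrable_pair_mult[OF assms], symmetric])
  also have "\<dots> = (LINT y|lborel. LINT x|lborel. g y * (h x * k x y))"
    by (simp add: mult_ac)
  finally show ?thesis by simp
qed

text \<open>Fubini, since the kernel is symmetric in \<open>x\<close> and \<open>y\<close>. It moves
  the transform off \<open>f\<close> onto a Gaussian in the inversion theorem, off \<open>h\<close>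
  onto \<open>q\<close> in Plancherel's inequality, and off \<open>V \<zeta>\<close> onto the
  localised multiplier.\<close>

lemma fourier_multiplication_formula:
  fixes h g :: "'a::euclidean_space \<Rightarrow> complex"
  assumes h: "integrable lborel h" and g: "integrable lborel g"
  shows "(LINT x|lborel. h x * fourier g x) = (LINT y|lborel. fourier h y * g y)"
proof -
  have "(LINT x|lborel. h x * (LINT y|lborel. g y * echar (- (y \<bullet> x))))
      = (LINT y|lborel. g y * (LINT x|lborel. h x * echar (- (y \<bullet> x))))"
    by (rule Fubini_integral_mult[OF h g, where C = 1]) simp_all
  then show ?thesis by (simp add: fourier_echar mult.commute inner_commute)
qed

text \<open>In the order \<open>(y, x)\<close> translation invariance makes the inner integral of
  the modulus equal to \<open>cmod (h y)\<close> times the constant L1 norm of \<open>g\<close>, so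
  Fubini's criterion is immediate; the variables are swapped afterwards.\<close>

lemma integrable_convolution:
  fixes h g :: "'a::euclidean_space \<Rightarrow> complex"
  assumes h: "integrable lborel h" and g: "integrable lborel g"
  shows "integrable (lborel \<Otimes>\<^sub>M lborel) (\<lambda>(x, y). h y * g (x - y))"
    and "integrable lborel (\<lambda>x. LINT y|lborel. h y * g (x - y))"
proof -
  have [measurable]: "h \<in> borel_measurable borel" "g \<in> borel_measurable borel"
    using borel_measurable_integrable[OF h] borel_measurable_integrable[OF g] by auto
  have int: "integrable lborel (\<lambda>x. g (x - y))" for y
    using integrable_lborel_shift(1)[OF g, of "-y"] by simp
  have "integrable (lborel \<Otimes>\<^sub>M lborel) (\<lambda>(y, x). h y * g (x - y))"
  proof (rule lborel_pair.Fubini_integrable)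
    show "(\<lambda>(y, x). h y * g (x - y)) \<in> borel_measurable (lborel \<Otimes>\<^sub>M lborel)" by measurable
    have "(LINT x|lborel. cmod (g (x - y))) = (LINT x|lborel. cmod (g x))" for y
      using integral_lborel_shift(1)[of "\<lambda>x. cmod (g x)" "-y"] by simp
    then show "integrable lborel (\<lambda>y. LINT x|lborel. norm (case (y, x) of (y, x) \<Rightarrow> h y * g (x - y)))"
      using h by (simp add: norm_mult)
    show "AE y in lborel. integrable lborel (\<lambda>x. case (y, x) of (y, x) \<Rightarrow> h y * g (x - y))"
      using int by simp
  qed
  then show *: "integrable (lborel \<Otimes>\<^sub>M lborel) (\<lambda>(x, y). h y * g (x - y))"
    using lborel_pair.integrable_product_swap_iff[of "\<lambda>(y, x). h y * g (x - y)"] by simp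
  show "integrable lborel (\<lambda>x. LINT y|lborel. h y * g (x - y))"
    using lborel_pair.integrable_fst'[OF *] by simp
qed

lemma fourier_convolution:
  fixes h g :: "'a::euclidean_space \<Rightarrow> complex"
  assumes h: "integrable lborel h" and g: "integrable lborel g"
  shows "fourier (\<lambda>x. LINT y|lborel. h y * g (x - y)) \<xi> = fourier h \<xi> * fourier g \<xi>"
proof -
  have [measurable]: "h \<in> borel_measurable borel" "g \<in> borel_measurable borel"
    using borel_measurable_integrable[OF h] borel_measurable_integrable[OF g] by auto
  have int: "integrable (lborel \<Otimes>\<^sub>M lborel) (\<lambda>(x, y). h y * g (x - y) * echar (- (x \<bullet> \<xi>)))"
    by (rule Bochner_Integration.integrable_bound[OF integrable_convolution(1)[OF h g]])
       (auto simp: norm_mult)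
  have "fourier (\<lambda>x. LINT y|lborel. h y * g (x - y)) \<xi>
     = (LINT x|lborel. LINT y|lborel. h y * g (x - y) * echar (- (x \<bullet> \<xi>)))"
    unfolding fourier_echar by simp
  also have "\<dots> = (LINT y|lborel. LINT x|lborel. h y * g (x - y) * echar (- (x \<bullet> \<xi>)))"
    using lborel_pair.Fubini_integral[OF int] by simp
  also have "\<dots> = (LINT y|lborel. h y * fourier (\<lambda>x. g (x - y)) \<xi>)"
    unfolding fourier_echar by (simp add: mult.assoc)
  also have "\<dots> = (LINT y|lborel. h y * echar (- (y \<bullet> \<xi>)) * fourier g \<xi>)"
    using fourier_shift[of g "- y" for y] by (simp add: mult.assoc)
  also have "\<dots> = fourier h \<xi> * fourier g \<xi>"
    unfolding fourier_echar[of h] by simp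
  finally show ?thesis .
qed

section \<open>The Gaussian, Fourier inversion and Plancherel's inequality\<close>

text \<open>The factor \<open>pi\<close> makes this Gaussian its own transform in the
  \<open>2 * pi\<close> normalisation of \<open>fourier\<close>, and gives it total mass 1.\<close>

definition gauss :: "'a::euclidean_space \<Rightarrow> real" where
  "gauss x = exp (- pi * (norm x)\<^sup>2)"

lemma gauss_nonneg [simp]: "0 \<le> gauss x"
  by (simp add: gauss_def)

lemma gauss_le_1 [simp]: "gauss x \<le> 1"
  by (simp add: gauss_def)

lemma gauss_0 [simp]: "gauss 0 = 1"
  by (simp add: gauss_def)

lemma continuous_on_gauss [continuous_intros]:
  "continuous_on A f \<Longrightarrow> continuous_on A (\<lambda>x. gauss (f x))"
  unfolding gauss_def by (intro continuous_intros)

lemma borel_measurable_gauss [measurable]: "gauss \<in> borel_measurable borel"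
  by (intro borel_measurable_continuous_onI continuous_intros)

text \<open>This is the characteristic function of the standard normal law after a dilation by
  \<open>c = sqrt (2 * pi)\<close>: it turns the density into \<open>exp (- pi * x\<^sup>2)\<close>
  and the argument \<open>- c * \<tau>\<close> into the frequency
  \<open>- (c * c) * \<tau> = - 2 * pi * \<tau>\<close>.\<close>

lemma fourier_gauss_real:
  fixes \<tau> :: real
  shows "integrable lborel (\<lambda>x::real. complex_of_real (exp (- pi * x\<^sup>2)))"
    and "(LINT x|lborel. complex_of_real (exp (- pi * x\<^sup>2)) * echar (- (x * \<tau>))) = complex_of_real (exp (- pi * \<tau>\<^sup>2))"
proof -
  define c :: real where "c = sqrt (2 * pi)"
  have c: "c > 0" by (simp add: c_def)
  have c2: "c * c = 2 * pi" by (simp add: c_def)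
  have dens: "c * std_normal_density (c * x) = exp (- pi * x\<^sup>2)" for x
  proof -
    have "(c * x)\<^sup>2 / 2 = pi * x\<^sup>2" using c2 by (simp add: power2_eq_square)
    then show ?thesis using c by (simp add: std_normal_density_def c_def)
  qed
  have "integrable lborel (\<lambda>x. std_normal_density (0 + c * x))"
    using c by (intro lborel_integrable_real_affine) (auto simp: integrable_normal_density)
  then have "integrable lborel (\<lambda>x. c * std_normal_density (0 + c * x))"
    by (rule integrable_mult_right)
  then have "integrable lborel (\<lambda>x::real. exp (- pi * x\<^sup>2))" by (simp add: dens)
  then show "integrable lborel (\<lambda>x::real. complex_of_real (exp (- pi * x\<^sup>2)))"
    by (rule integrable_of_real)
  have "char std_normal_distribution (- c * \<tau>) = complex_of_real (exp (- (c * \<tau>)\<^sup>2 / 2))"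
    by (simp add: char_std_normal_distribution)
  also have "- (c * \<tau>)\<^sup>2 / 2 = - pi * \<tau>\<^sup>2"
    using c2 by (simp add: power2_eq_square algebra_simps)
  finally have "complex_of_real (exp (- pi * \<tau>\<^sup>2)) = char std_normal_distribution (- c * \<tau>)" ..
  also have "\<dots> = (LINT x|lborel. complex_of_real (std_normal_density x) * iexp (- c * \<tau> * x))"
    unfolding char_def by (subst integral_density) (auto simp: scaleR_conv_of_real)
  also have "\<dots> = \<bar>c\<bar> *\<^sub>R (LINT x|lborel. complex_of_real (std_normal_density (0 + c * x)) * iexp (- c * \<tau> * (0 + c * x)))"
    using c by (intro lborel_integral_real_affine) auto
  also have "\<dots> = (LINT x|lborel. complex_of_real (c * std_normal_density (c * x)) * iexp (- (c * c) * \<tau> * x))"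
    using c by (simp add: scaleR_conv_of_real mult_ac)
  also have "\<dots> = (LINT x|lborel. complex_of_real (exp (- pi * x\<^sup>2)) * echar (- (x * \<tau>)))"
    unfolding dens c2 echar_def by (intro Bochner_Integration.integral_cong refl arg_cong2[where f = "(*)"]) (auto simp: mult_ac)
  finally show "(LINT x|lborel. complex_of_real (exp (- pi * x\<^sup>2)) * echar (- (x * \<tau>))) = complex_of_real (exp (- pi * \<tau>\<^sup>2))" ..
qed

text \<open>Lebesgue measure is the image of the product measure over \<open>Basis\<close>. Used for
  the Gaussian and for the majorant of \<open>1 / (1 + norm x) ^ k\<close>.\<close>

lemma lborel_integral_prod:
  fixes f :: "'a::euclidean_space \<Rightarrow> real \<Rightarrow> complex"
  assumes f: "\<And>b. b \<in> Basis \<Longrightarrow> integrable lborel (f b)"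
  shows "integrable lborel (\<lambda>x. \<Prod>b\<in>Basis. f b (x \<bullet> b))"
    and "(LINT x|lborel. (\<Prod>b\<in>Basis. f b (x \<bullet> b))) = (\<Prod>b\<in>Basis. (LINT x|lborel. f b x))"
proof -
  interpret product_sigma_finite "\<lambda>_::'a. lborel :: real measure" ..
  have [measurable]: "f b \<in> borel_measurable borel" if "b \<in> Basis" for b
    using borel_measurable_integrable[OF f[OF that]] by simp
  have [simp]: "(\<Sum>b'\<in>Basis. x b' *\<^sub>R b') \<bullet> b = x b" if "b \<in> Basis" for x :: "'a \<Rightarrow> real" and b
    using that by simp
  show "integrable lborel (\<lambda>x. \<Prod>b\<in>Basis. f b (x \<bullet> b))"
    using product_integrable_prod[OF finite_Basis f]
    by (subst lborel_eq, subst integrable_distr_eq) (auto cong: Bochner_Integration.integrable_cong)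
  show "(LINT x|lborel. (\<Prod>b\<in>Basis. f b (x \<bullet> b))) = (\<Prod>b\<in>Basis. (LINT x|lborel. f b x))"
    using product_integral_prod[OF finite_Basis f]
    by (subst lborel_eq, subst integral_distr) (auto cong: Bochner_Integration.integral_cong)
qed

lemma gauss_prod: "gauss x = (\<Prod>b\<in>Basis. exp (- pi * (x \<bullet> b)\<^sup>2))"
  unfolding gauss_def power2_norm_eq_inner euclidean_inner[of x x]
  by (simp add: exp_sum[symmetric] sum_distrib_left sum_negf power2_eq_square)

lemma echar_inner: "echar (- (x \<bullet> \<xi>)) = (\<Prod>b\<in>Basis. echar (- ((x \<bullet> b) * (\<xi> \<bullet> b))))"
proof -
  have "echar (- (\<Sum>b\<in>A. (x \<bullet> b) * (\<xi> \<bullet> b))) = (\<Prod>b\<in>A. echar (- ((x \<bullet> b) * (\<xi> \<bullet> b))))" if "finite A" for A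
    using that by induction (simp_all add: echar_minus_add del: minus_add_distrib)
  then show ?thesis by (simp add: euclidean_inner[of x \<xi>])
qed

lemma integrable_gauss: "integrable lborel (gauss :: 'a::euclidean_space \<Rightarrow> real)"
proof -
  have "integrable lborel (\<lambda>x::'a. \<Prod>b\<in>Basis. complex_of_real (exp (- pi * (x \<bullet> b)\<^sup>2)))"
    by (rule lborel_integral_prod(1)[where f = "\<lambda>_ x. complex_of_real (exp (- pi * x\<^sup>2))"])
       (rule fourier_gauss_real)
  then have "integrable lborel (\<lambda>x::'a. complex_of_real (gauss x))"
    by (simp add: gauss_prod)
  then show ?thesis using integrable_Re by fastforce
qed

lemma fourier_gauss: "fourier (\<lambda>x. complex_of_real (gauss x)) \<xi> = complex_of_real (gauss \<xi>)"
proof -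
  have "fourier (\<lambda>x. complex_of_real (gauss x)) \<xi>
    = (LINT x|lborel. (\<Prod>b\<in>Basis. complex_of_real (exp (- pi * (x \<bullet> b)\<^sup>2)) * echar (- ((x \<bullet> b) * (\<xi> \<bullet> b)))))"
    unfolding fourier_echar by (simp add: gauss_prod echar_inner prod.distrib)
  also have "\<dots> = (\<Prod>b\<in>Basis. (LINT x|lborel. complex_of_real (exp (- pi * x\<^sup>2)) * echar (- (x * (\<xi> \<bullet> b)))))"
    by (rule lborel_integral_prod(2)[where f = "\<lambda>b x. complex_of_real (exp (- pi * x\<^sup>2)) * echar (- (x * (\<xi> \<bullet> b)))"])
       (rule integrable_mult_echar[OF fourier_gauss_real(1)], simp)
  also have "\<dots> = complex_of_real (gauss \<xi>)"
    unfolding fourier_gauss_real(2) by (simp add: gauss_prod)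
  finally show ?thesis .
qed

lemma nn_integral_gauss: "(\<integral>\<^sup>+x. ennreal (gauss (x :: 'a::euclidean_space)) \<partial>lborel) = 1"
proof -
  have "complex_of_real (LINT x|lborel. gauss (x :: 'a)) = fourier (\<lambda>x. complex_of_real (gauss x)) (0::'a)"
    unfolding fourier_echar by simp
  then have "(LINT x|lborel. gauss (x :: 'a)) = 1"
    unfolding fourier_gauss by simp
  then show ?thesis by (subst nn_integral_eq_integral[OF integrable_gauss]) auto
qed

lemma nn_integral_gauss_scaled:
  assumes s: "s > 0"
  shows "(\<integral>\<^sup>+x. ennreal (1 / s ^ DIM('a) * gauss ((1 / s) *\<^sub>R (x :: 'a::euclidean_space))) \<partial>lborel) = 1"
proof -
  have "(\<integral>\<^sup>+x. ennreal (gauss ((1 / s) *\<^sub>R (x :: 'a))) \<partial>lborel)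
     = \<bar>s\<bar> ^ DIM('a) * (\<integral>\<^sup>+x. ennreal (gauss ((1 / s) *\<^sub>R (0 + s *\<^sub>R (x :: 'a)))) \<partial>lborel)"
    using s by (intro nn_integral_lborel_affine[where f = "\<lambda>x. ennreal (gauss ((1 / s) *\<^sub>R x))"]) auto
  also have "\<dots> = ennreal (s ^ DIM('a))"
    using s by (simp add: nn_integral_gauss)
  finally have *: "(\<integral>\<^sup>+x. ennreal (gauss ((1 / s) *\<^sub>R (x :: 'a))) \<partial>lborel) = ennreal (s ^ DIM('a))" .
  have "(\<integral>\<^sup>+x. ennreal (1 / s ^ DIM('a) * gauss ((1 / s) *\<^sub>R (x :: 'a))) \<partial>lborel)
    = (\<integral>\<^sup>+x. ennreal (1 / s ^ DIM('a)) * ennreal (gauss ((1 / s) *\<^sub>R (x :: 'a))) \<partial>lborel)"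
    using s by (intro nn_integral_cong ennreal_mult) auto
  also have "\<dots> = ennreal (1 / s ^ DIM('a)) * ennreal (s ^ DIM('a))"
    by (subst nn_integral_cmult) (auto simp: *)
  also have "\<dots> = ennreal 1"
    using s by (subst ennreal_mult[symmetric]) auto
  finally show ?thesis by simp
qed

lemma integrable_gauss_scaled:
  assumes s: "s > 0"
  shows "integrable lborel (\<lambda>x :: 'a::euclidean_space. gauss (s *\<^sub>R x))"
  using integrable_lborel_affine_iff[of "gauss :: 'a \<Rightarrow> real" s 0] s integrable_gauss by simp

lemma fourier_gauss_scaled:
  assumes s: "s > 0"
  shows "fourier (\<lambda>x :: 'a::euclidean_space. complex_of_real (gauss (s *\<^sub>R x))) \<xi>
    = complex_of_real (1 / s ^ DIM('a) * gauss ((1 / s) *\<^sub>R \<xi>))"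
  using s fourier_scale[of "\<lambda>x :: 'a. complex_of_real (gauss x)" s \<xi>] by (simp add: fourier_gauss)

lemma gauss_scaled_tendsto:
  fixes x :: "'a::euclidean_space"
  shows "(\<lambda>n. gauss ((1 / real (Suc n)) *\<^sub>R x)) \<longlonglongrightarrow> 1"
proof -
  have "(\<lambda>n. (1 / real (Suc n)) *\<^sub>R x) \<longlonglongrightarrow> 0 *\<^sub>R x"
    by (intro tendsto_intros LIMSEQ_Suc[OF lim_1_over_n])
  moreover have "continuous_on UNIV (gauss :: 'a \<Rightarrow> real)"
    by (intro continuous_intros)
  then have "isCont gauss (0 :: 'a)"
    by (simp add: continuous_on_eq_continuous_at)
  ultimately show ?thesis
    using isCont_tendsto_compose[of 0 gauss "\<lambda>n. (1 / real (Suc n)) *\<^sub>R x"] by simp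
qed

text \<open>Damping the inversion integral by \<open>gauss (s n *\<^sub>R \<xi>)\<close> gives
  \<open>D n\<close>. On the frequency side dominated convergence removes the damping; the
  multiplication formula rewrites the same number as an average of \<open>f\<close> around
  \<open>x\<close> against a Gaussian of width \<open>s n\<close>, which tends to \<open>f x\<close>
  by continuity.\<close>

lemma fourier_inversion:
  fixes f :: "'a::euclidean_space \<Rightarrow> complex"
  assumes f: "integrable lborel f" and cont: "continuous_on UNIV f" and bdd: "\<And>x. cmod (f x) \<le> C"
    and hat: "integrable lborel (fourier f)"
  shows "fourier (fourier f) (- x) = f x"
proof -
  define s where "s n = 1 / real (Suc n)" for n
  have s: "s n > 0" for n by (simp add: s_def)
  have [measurable]: "f \<in> borel_measurable borel"
    using borel_measurable_integrable[OF f] by simp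
  have [measurable]: "fourier f \<in> borel_measurable borel"
    using borel_measurable_integrable[OF hat] by simp
  define D where "D n = (LINT \<xi>|lborel. fourier f \<xi> * (complex_of_real (gauss (s n *\<^sub>R \<xi>)) * echar (- (\<xi> \<bullet> (- x)))))" for n
  have "D \<longlonglongrightarrow> (LINT \<xi>|lborel. fourier f \<xi> * (complex_of_real 1 * echar (- (\<xi> \<bullet> (- x)))))"
    unfolding D_def
  proof (rule integral_dominated_convergence[where w = "\<lambda>\<xi>. cmod (fourier f \<xi>)"])
    show "AE y in lborel. (\<lambda>n. fourier f y * (complex_of_real (gauss (s n *\<^sub>R y)) * echar (- (y \<bullet> - x))))
        \<longlonglongrightarrow> fourier f y * (complex_of_real 1 * echar (- (y \<bullet> - x)))"
      unfolding s_def by (intro always_eventually allI tendsto_intros gauss_scaled_tendsto)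
  qed (use hat in \<open>auto simp: norm_mult mult_left_le\<close>)
  then have lim1: "D \<longlonglongrightarrow> fourier (fourier f) (- x)"
    by (simp add: fourier_echar[of "fourier f"])
  have D: "D n = (LINT z|lborel. f (x + s n *\<^sub>R z) * complex_of_real (gauss z))" for n
  proof -
    have gi: "integrable lborel (\<lambda>\<xi> :: 'a. complex_of_real (gauss (s n *\<^sub>R \<xi>)))"
      by (intro integrable_of_real integrable_gauss_scaled s)
    have hat_g: "fourier (\<lambda>\<xi>. complex_of_real (gauss (s n *\<^sub>R \<xi>)) * echar (- (\<xi> \<bullet> (- x)))) y
       = complex_of_real (1 / s n ^ DIM('a) * gauss ((1 / s n) *\<^sub>R (y - x)))" for y
      unfolding fourier_mult_echar fourier_gauss_scaled[OF s] by simp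
    have "D n = (LINT y|lborel. f y * complex_of_real (1 / s n ^ DIM('a) * gauss ((1 / s n) *\<^sub>R (y - x))))"
      unfolding D_def hat_g[symmetric]
      by (rule fourier_multiplication_formula[symmetric]) (use f gi in auto)
    also have "\<dots> = \<bar>s n\<bar> ^ DIM('a) *\<^sub>R (LINT z|lborel. f (x + s n *\<^sub>R z) * complex_of_real (1 / s n ^ DIM('a) * gauss ((1 / s n) *\<^sub>R (x + s n *\<^sub>R z - x))))"
      using s[of n] by (intro integral_lborel_affine) auto
    also have "\<dots> = (LINT z|lborel. \<bar>s n\<bar> ^ DIM('a) *\<^sub>R (f (x + s n *\<^sub>R z) * complex_of_real (1 / s n ^ DIM('a) * gauss ((1 / s n) *\<^sub>R (x + s n *\<^sub>R z - x)))))"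
      by simp
    also have "\<dots> = (LINT z|lborel. f (x + s n *\<^sub>R z) * complex_of_real (gauss z))"
      using s[of n] by (intro Bochner_Integration.integral_cong) (auto simp: scaleR_conv_of_real)
    finally show ?thesis .
  qed
  have "D \<longlonglongrightarrow> (LINT z|lborel. f x * complex_of_real (gauss (z::'a)))"
    unfolding D
  proof (rule integral_dominated_convergence[where w = "\<lambda>z. C * gauss z"])
    show "AE z in lborel. (\<lambda>n. f (x + s n *\<^sub>R z) * complex_of_real (gauss z)) \<longlonglongrightarrow> f x * complex_of_real (gauss z)"
    proof (intro always_eventually allI tendsto_intros)
      fix z
      have "(\<lambda>n. x + s n *\<^sub>R z) \<longlonglongrightarrow> x + 0 *\<^sub>R z"
        unfolding s_def by (intro tendsto_intros LIMSEQ_Suc[OF lim_1_over_n])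
      moreover have "isCont f x" using cont by (simp add: continuous_on_eq_continuous_at)
      ultimately show "(\<lambda>n. f (x + s n *\<^sub>R z)) \<longlonglongrightarrow> f x"
        using isCont_tendsto_compose[of x f] by simp
    qed
    show "AE z in lborel. norm (f (x + s n *\<^sub>R z) * complex_of_real (gauss z)) \<le> C * gauss z" for n
      using bdd by (auto simp: norm_mult intro!: mult_right_mono)
  qed (use integrable_gauss in auto)
  moreover have "(LINT z|lborel. f x * complex_of_real (gauss (z::'a))) = f x"
  proof -
    have "(LINT z|lborel. complex_of_real (gauss (z::'a))) = 1"
      using fourier_gauss[of "0::'a"] unfolding fourier_echar by simp
    then show ?thesis by simp
  qed
  ultimately have "D \<longlonglongrightarrow> f x" by (simp only:)
  from LIMSEQ_unique[OF lim1 this] show ?thesis .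
qed

lemma borel_measurable_cnj [measurable]: "cnj \<in> borel_measurable borel"
  by (intro borel_measurable_continuous_onI continuous_intros)

text \<open>Damping by the Gaussian \<open>gauss (s \<xi>)\<close> turns the left-hand side into a convolution form with a
  probability kernel, which the inequality \<open>2 a b \<le> a\<^sup>2 + b\<^sup>2\<close> controls; then let \<open>s\<close> tend to zero.\<close>

lemma plancherel_le_gauss:
  fixes h :: "'a::euclidean_space \<Rightarrow> complex"
  assumes h: "integrable lborel h" and s: "s > 0"
  shows "(\<integral>\<^sup>+\<xi>. ennreal ((cmod (fourier h \<xi>))\<^sup>2 * gauss (s *\<^sub>R \<xi>)) \<partial>lborel) \<le> (\<integral>\<^sup>+x. ennreal ((cmod (h x))\<^sup>2) \<partial>lborel)"
proof -
  have [measurable]: "h \<in> borel_measurable borel"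
    using borel_measurable_integrable[OF h] by simp
  define g where "g \<xi> = complex_of_real (gauss (s *\<^sub>R \<xi>))" for \<xi> :: 'a
  define k where "k w = 1 / s ^ DIM('a) * gauss ((1 / s) *\<^sub>R w)" for w :: 'a
  have k0: "0 \<le> k w" for w using s by (simp add: k_def)
  have [measurable]: "k \<in> borel_measurable borel" "g \<in> borel_measurable borel"
    unfolding k_def g_def by measurable
  have ksym: "k (x - y) = k (y - x)" for x y
    by (simp add: k_def gauss_def norm_minus_commute)
  have k1: "(\<integral>\<^sup>+w. ennreal (k (t - w)) \<partial>lborel) = 1" for t
    using nn_integral_lborel_shift(2)[of "\<lambda>w. ennreal (k w)" t] nn_integral_gauss_scaled[OF s, where 'a='a]
    by (simp add: k_def)
  have gi: "integrable lborel g"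
    unfolding g_def by (intro integrable_of_real integrable_gauss_scaled s)
  \<comment> \<open>Pairing \<open>fourier h\<close> with \<open>q\<close> gives the damped square
    norm, while the multiplication formula turns the pairing into an integral of \<open>h\<close>
    against \<open>fourier q\<close>.\<close>
  define q where "q \<xi> = g \<xi> * cnj (fourier h \<xi>)" for \<xi>
  have cnjh: "cnj (fourier h \<xi>) = fourier (\<lambda>x. cnj (h x)) (- \<xi>)" for \<xi>
    unfolding fourier_echar by (simp add: cnj_echar flip: Bochner_Integration.integral_cnj)
  have qi: "integrable lborel q"
    unfolding q_def
  proof (rule Bochner_Integration.integrable_bound[OF integrable_mult_left[OF gi, of "complex_of_real (LINT x|lborel. cmod (h x))"]])
    show "AE \<xi> in lborel. norm (g \<xi> * cnj (fourier h \<xi>)) \<le> norm (g \<xi> * complex_of_real (LINT x|lborel. cmod (h x)))"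
      using norm_fourier_le[of h] by (auto simp: norm_mult intro!: mult_left_mono order_trans[OF _ abs_ge_self])
  qed measurable
  have "(LINT \<xi>|lborel. fourier h \<xi> * q \<xi>) = (LINT x|lborel. h x * fourier q x)"
    by (rule fourier_multiplication_formula[OF h qi, symmetric])
  \<comment> \<open>The conjugate of \<open>fourier h\<close> is a transform at the reflected
    frequency, so transforming \<open>q\<close> leaves the convolution kernel \<open>k\<close>, the
    transform of the damping Gaussian.\<close>
  moreover have "fourier q x = (LINT y|lborel. cnj (h y) * complex_of_real (k (x - y)))" for x
  proof -
    have "fourier q x = (LINT \<xi>|lborel. (g \<xi> * echar (- (\<xi> \<bullet> x))) * (LINT y|lborel. cnj (h y) * echar (y \<bullet> \<xi>)))"
      unfolding fourier_echar[of q] q_def cnjh by (simp add: fourier_echar mult_ac)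
    also have "\<dots> = (LINT y|lborel. cnj (h y) * (LINT \<xi>|lborel. (g \<xi> * echar (- (\<xi> \<bullet> x))) * echar (y \<bullet> \<xi>)))"
      by (rule Fubini_integral_mult[where C = 1]) (use h gi in simp_all)
    also have "\<dots> = (LINT y|lborel. cnj (h y) * fourier g (x - y))"
      unfolding fourier_echar[of g]
      by (simp add: mult.assoc inner_diff_right inner_commute flip: echar_add)
    also have "\<dots> = (LINT y|lborel. cnj (h y) * complex_of_real (k (x - y)))"
      unfolding g_def fourier_gauss_scaled[OF s] k_def ..
    finally show ?thesis .
  qed
  ultimately have eq: "(LINT \<xi>|lborel. fourier h \<xi> * q \<xi>)
     = (LINT x|lborel. h x * (LINT y|lborel. cnj (h y) * complex_of_real (k (x - y))))" by simp
  have real_q: "fourier h \<xi> * q \<xi> = complex_of_real ((cmod (fourier h \<xi>))\<^sup>2 * gauss (s *\<^sub>R \<xi>))" for \<xi>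
    unfolding q_def g_def by (simp add: complex_norm_square[symmetric] mult_ac)
  have int: "integrable lborel (\<lambda>\<xi>. fourier h \<xi> * q \<xi>)"
  proof (rule Bochner_Integration.integrable_bound[OF integrable_mult_left[OF qi, of "complex_of_real (LINT x|lborel. cmod (h x))"]])
    show "AE \<xi> in lborel. norm (fourier h \<xi> * q \<xi>) \<le> norm (q \<xi> * complex_of_real (LINT x|lborel. cmod (h x)))"
      using norm_fourier_le[of h] by (auto simp: norm_mult mult.commute[of "cmod (q _)"] intro!: mult_right_mono order_trans[OF _ abs_ge_self])
  qed (simp add: q_def)
  have "(\<integral>\<^sup>+\<xi>. ennreal ((cmod (fourier h \<xi>))\<^sup>2 * gauss (s *\<^sub>R \<xi>)) \<partial>lborel)
      = ennreal (LINT \<xi>|lborel. (cmod (fourier h \<xi>))\<^sup>2 * gauss (s *\<^sub>R \<xi>))"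
    using integrable_Re[OF int] unfolding real_q Re_complex_of_real
    by (intro nn_integral_eq_integral) auto
  also have "\<dots> = ennreal (cmod (LINT \<xi>|lborel. fourier h \<xi> * q \<xi>))"
    unfolding real_q integral_complex_of_real norm_of_real by (simp add: integral_nonneg_AE)
  also have "\<dots> \<le> (\<integral>\<^sup>+x. ennreal (cmod (h x)) * (\<integral>\<^sup>+y. ennreal (cmod (h y)) * ennreal (k (x - y)) \<partial>lborel) \<partial>lborel)"
  proof -
    have "ennreal (cmod (LINT y|lborel. cnj (h y) * complex_of_real (k (x - y))))
       \<le> (\<integral>\<^sup>+y. ennreal (cmod (h y)) * ennreal (k (x - y)) \<partial>lborel)" for x
      by (rule order_trans[OF norm_integral_le_nn_integral])
         (auto simp: norm_mult ennreal_mult k0)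
    then show ?thesis unfolding eq
      by (intro order_trans[OF norm_integral_le_nn_integral])
         (auto simp: norm_mult ennreal_mult intro!: nn_integral_mono mult_left_mono)
  qed
  also have "\<dots> = (\<integral>\<^sup>+x. \<integral>\<^sup>+y. ennreal (cmod (h x) * cmod (h y) * k (x - y)) \<partial>lborel \<partial>lborel)"
    by (subst nn_integral_cmult[symmetric]) (auto simp: ennreal_mult k0 mult.assoc)
  also have "\<dots> \<le> (\<integral>\<^sup>+x. \<integral>\<^sup>+y. ennreal ((cmod (h x))\<^sup>2 / 2 * k (x - y)) + ennreal ((cmod (h y))\<^sup>2 / 2 * k (x - y)) \<partial>lborel \<partial>lborel)"
  proof (intro nn_integral_mono)
    fix x y
    have "cmod (h x) * cmod (h y) \<le> (cmod (h x))\<^sup>2 / 2 + (cmod (h y))\<^sup>2 / 2"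
      using sum_squares_bound[of "cmod (h x)" "cmod (h y)"] by simp
    from mult_right_mono[OF this k0[of "x - y"]]
    have "ennreal (cmod (h x) * cmod (h y) * k (x - y))
       \<le> ennreal ((cmod (h x))\<^sup>2 / 2 * k (x - y) + (cmod (h y))\<^sup>2 / 2 * k (x - y))"
      unfolding distrib_right by (rule ennreal_leI)
    also have "\<dots> = ennreal ((cmod (h x))\<^sup>2 / 2 * k (x - y)) + ennreal ((cmod (h y))\<^sup>2 / 2 * k (x - y))"
      by (intro ennreal_plus mult_nonneg_nonneg k0) auto
    finally show "ennreal (cmod (h x) * cmod (h y) * k (x - y))
       \<le> ennreal ((cmod (h x))\<^sup>2 / 2 * k (x - y)) + ennreal ((cmod (h y))\<^sup>2 / 2 * k (x - y))" .
  qed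
  also have "\<dots> = (\<integral>\<^sup>+x. \<integral>\<^sup>+y. ennreal ((cmod (h x))\<^sup>2 / 2 * k (x - y)) \<partial>lborel \<partial>lborel)
      + (\<integral>\<^sup>+x. \<integral>\<^sup>+y. ennreal ((cmod (h y))\<^sup>2 / 2 * k (x - y)) \<partial>lborel \<partial>lborel)"
    by (simp add: nn_integral_add)
  \<comment> \<open>The kernel is even, so exchanging the order of integration turns the second half
    into the first; since \<open>k\<close> has mass 1, each is half of the square norm.\<close>
  also have "(\<integral>\<^sup>+x. \<integral>\<^sup>+y. ennreal ((cmod (h y))\<^sup>2 / 2 * k (x - y)) \<partial>lborel \<partial>lborel)
     = (\<integral>\<^sup>+y. \<integral>\<^sup>+x. ennreal ((cmod (h y))\<^sup>2 / 2 * k (y - x)) \<partial>lborel \<partial>lborel)"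
    by (subst lborel_pair.Fubini') (auto simp: ksym)
  also have "(\<integral>\<^sup>+x. \<integral>\<^sup>+y. ennreal ((cmod (h x))\<^sup>2 / 2 * k (x - y)) \<partial>lborel \<partial>lborel)
     = (\<integral>\<^sup>+x. ennreal ((cmod (h x))\<^sup>2 / 2) \<partial>lborel)"
    by (simp add: ennreal_mult k0 nn_integral_cmult k1 del: times_divide_eq_left)
  also have "(\<integral>\<^sup>+x. ennreal ((cmod (h x))\<^sup>2 / 2) \<partial>lborel) + (\<integral>\<^sup>+x. ennreal ((cmod (h x))\<^sup>2 / 2) \<partial>lborel)
     = (\<integral>\<^sup>+x. ennreal ((cmod (h x))\<^sup>2 / 2) + ennreal ((cmod (h x))\<^sup>2 / 2) \<partial>lborel)"
    by (subst nn_integral_add) auto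
  also have "\<dots> = (\<integral>\<^sup>+x. ennreal ((cmod (h x))\<^sup>2) \<partial>lborel)"
    by (intro nn_integral_cong) (simp flip: ennreal_plus)
  finally show ?thesis .
qed

text \<open>Fatou's lemma passes to the limit without finiteness of either side: an integrable
  \<open>h\<close> need not be square integrable, and then the right-hand side is infinite.\<close>

lemma plancherel_le:
  fixes h :: "'a::euclidean_space \<Rightarrow> complex"
  assumes h: "integrable lborel h"
  shows "(\<integral>\<^sup>+\<xi>. ennreal ((cmod (fourier h \<xi>))\<^sup>2) \<partial>lborel) \<le> (\<integral>\<^sup>+x. ennreal ((cmod (h x))\<^sup>2) \<partial>lborel)"
proof -
  have [measurable]: "h \<in> borel_measurable borel"
    using borel_measurable_integrable[OF h] by simp
  define s where "s n = 1 / real (Suc n)" for n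
  have s: "s n > 0" for n by (simp add: s_def)
  have "(\<integral>\<^sup>+\<xi>. ennreal ((cmod (fourier h \<xi>))\<^sup>2) \<partial>lborel)
    = (\<integral>\<^sup>+\<xi>. liminf (\<lambda>n. ennreal ((cmod (fourier h \<xi>))\<^sup>2 * gauss (s n *\<^sub>R \<xi>))) \<partial>lborel)"
  proof (intro nn_integral_cong lim_imp_Liminf[symmetric])
    fix \<xi>
    have "(\<lambda>n. ennreal ((cmod (fourier h \<xi>))\<^sup>2 * gauss (s n *\<^sub>R \<xi>))) \<longlonglongrightarrow> ennreal ((cmod (fourier h \<xi>))\<^sup>2 * 1)"
      unfolding s_def by (intro tendsto_intros gauss_scaled_tendsto)
    then show "(\<lambda>n. ennreal ((cmod (fourier h \<xi>))\<^sup>2 * gauss (s n *\<^sub>R \<xi>))) \<longlonglongrightarrow> ennreal ((cmod (fourier h \<xi>))\<^sup>2)"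
      by simp
  qed simp
  also have "\<dots> \<le> liminf (\<lambda>n. \<integral>\<^sup>+\<xi>. ennreal ((cmod (fourier h \<xi>))\<^sup>2 * gauss (s n *\<^sub>R \<xi>)) \<partial>lborel)"
    by (intro nn_integral_liminf) measurable
  also have "\<dots> \<le> (\<integral>\<^sup>+x. ennreal ((cmod (h x))\<^sup>2) \<partial>lborel)"
    by (intro Liminf_le always_eventually allI plancherel_le_gauss[OF h s]) simp
  finally show ?thesis .
qed

section \<open>Smooth bumps and the decay of their Fourier transforms\<close>

text \<open>For \<open>p = 1\<close> this is the classical smooth function that vanishes to infinite
  order at the origin. The polynomial factor makes the family stable under differentiation.\<close>

definition flat :: "real poly \<Rightarrow> real \<Rightarrow> real" where
  "flat p x = (if x > 0 then poly p (1 / x) * exp (- (1 / x)) else 0)"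

lemma flat_nonpos [simp]: "x \<le> 0 \<Longrightarrow> flat p x = 0"
  by (simp add: flat_def)

lemma tendsto_poly_mult_exp: "((\<lambda>s. poly p s * exp (- s)) \<longlongrightarrow> (0::real)) at_top"
proof -
  have "((\<lambda>s. \<Sum>i\<le>degree p. coeff p i * (s ^ i / exp s)) \<longlongrightarrow> (\<Sum>i\<le>degree p. coeff p i * 0)) at_top"
    by (intro tendsto_intros tendsto_power_div_exp_0)
  then show ?thesis
    by (simp add: poly_altdef sum_distrib_right exp_minus divide_inverse mult.assoc)
qed

text \<open>For positive \<open>x\<close> the chain rule in \<open>1 / x\<close> produces the factor
  \<open>(1 / x)\<^sup>2\<close>, encoded by the polynomial \<open>[:0, 0, 1:]\<close>, times
  \<open>p - pderiv p\<close>.\<close>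

lemma flat_derivative:
  "(flat p has_field_derivative flat ([:0, 0, 1:] * (p - pderiv p)) x) (at x)"
proof -
  consider "x > 0" | "x < 0" | "x = 0" by linarith
  then show ?thesis
  proof cases
    case 1
    have "((\<lambda>x. poly p (1 / x) * exp (- (1 / x))) has_field_derivative
        flat ([:0, 0, 1:] * (p - pderiv p)) x) (at x)"
      using 1 by (auto intro!: derivative_eq_intros simp: flat_def field_simps power2_eq_square)
    then show ?thesis
    proof (rule has_field_derivative_transform_within_open)
      show "open {0::real<..}" "x \<in> {0<..}" using 1 by auto
    qed (simp add: flat_def)
  next
    case 2
    have "((\<lambda>x. 0) has_field_derivative flat ([:0, 0, 1:] * (p - pderiv p)) x) (at x)"
      using 2 by simp
    then show ?thesis
    proof (rule has_field_derivative_transform_within_open)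
      show "open {..<0::real}" "x \<in> {..<0}" using 2 by auto
    qed (simp add: flat_def)
  next
    case 3
    \<comment> \<open>With \<open>s = inverse h\<close> the one-sided difference quotient at 0 is
      \<open>s * poly p s * exp (- s)\<close>, and \<open>pCons 0 p\<close> is the polynomial with
      the extra factor \<open>s\<close>.\<close>
    have "((\<lambda>h. flat p h / h) \<longlongrightarrow> 0) (at_right 0)"
    proof (subst filterlim_at_right_to_top)
      have "((\<lambda>s. poly (pCons 0 p) s * exp (- s)) \<longlongrightarrow> (0::real)) at_top"
        by (rule tendsto_poly_mult_exp)
      then show "((\<lambda>s. flat p (inverse s) / inverse s) \<longlongrightarrow> 0) at_top"
      proof (rule Lim_transform_eventually)
        show "\<forall>\<^sub>F s in at_top. poly (pCons 0 p) s * exp (- s) = flat p (inverse s) / inverse s"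
          using eventually_gt_at_top[of "0::real"] by eventually_elim (simp add: flat_def field_simps)
      qed
    qed
    moreover have "((\<lambda>h. flat p h / h) \<longlongrightarrow> 0) (at_left 0)"
      by (rule tendsto_eventually) (auto simp: eventually_at_filter)
    ultimately have "((\<lambda>h. flat p h / h) \<longlongrightarrow> 0) (at 0)"
      by (simp add: filterlim_at_split)
    then show ?thesis using 3 by (simp add: has_field_derivative_iff)
  qed
qed

text \<open>This class is closed under directional derivatives, which gives smoothness of its members at once.\<close>

inductive bumplike :: "('a::euclidean_space \<Rightarrow> real) \<Rightarrow> bool" where
  bumplike_flat: "bumplike (\<lambda>x. flat p (1 - x \<bullet> x))"
| bumplike_add: "bumplike f \<Longrightarrow> bumplike g \<Longrightarrow> bumplike (\<lambda>x. f x + g x)"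
| bumplike_inner: "bumplike f \<Longrightarrow> bumplike (\<lambda>x. (x \<bullet> w) * f x)"
| bumplike_scale: "bumplike f \<Longrightarrow> bumplike (\<lambda>x. c * f x)"

lemma bumplike_derivative:
  assumes "bumplike f"
  obtains D where "\<And>x. (f has_derivative (\<lambda>v. D v x)) (at x)" and "\<And>v. bumplike (D v)"
proof -
  have "\<exists>D. (\<forall>x. (f has_derivative (\<lambda>v. D v x)) (at x)) \<and> (\<forall>v. bumplike (D v))"
    using assms
  proof induction
    case (bumplike_flat p)
    define q where "q = [:0, 0, 1:] * (p - pderiv p)"
    have "((\<lambda>x. flat p (1 - x \<bullet> x)) has_derivative (\<lambda>v. (x \<bullet> v) * (- 2 * flat q (1 - x \<bullet> x)))) (at x)" for x :: 'a
    proof -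
      have "(flat p has_derivative (\<lambda>h. flat q (1 - x \<bullet> x) * h)) (at (1 - x \<bullet> x))"
        using flat_derivative[of p "1 - x \<bullet> x"] by (simp add: has_field_derivative_def q_def)
      moreover have "((\<lambda>x. 1 - x \<bullet> x) has_derivative (\<lambda>v. - 2 * (x \<bullet> v))) (at x)"
        by (auto intro!: derivative_eq_intros simp: inner_commute)
      ultimately show ?thesis
        by (rule has_derivative_eq_rhs[OF has_derivative_compose[rotated]]) (simp add: fun_eq_iff)
    qed
    then show ?case
      by (intro exI[of _ "\<lambda>v x. (x \<bullet> v) * (- 2 * flat q (1 - x \<bullet> x))"] conjI allI
          bumplike.intros) auto
  next
    case (bumplike_add f g)
    then obtain D E where "\<forall>x. (f has_derivative (\<lambda>v. D v x)) (at x)" "\<forall>v. bumplike (D v)"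
      "\<forall>x. (g has_derivative (\<lambda>v. E v x)) (at x)" "\<forall>v. bumplike (E v)" by blast
    then show ?case
      by (intro exI[of _ "\<lambda>v x. D v x + E v x"] conjI allI bumplike.intros has_derivative_add) auto
  next
    case (bumplike_inner f w)
    then obtain D where D: "\<forall>x. (f has_derivative (\<lambda>v. D v x)) (at x)" "\<forall>v. bumplike (D v)" by blast
    have "((\<lambda>x. (x \<bullet> w) * f x) has_derivative (\<lambda>v. (x \<bullet> w) * D v x + (v \<bullet> w) * f x)) (at x)" for x
      using D(1) by (auto intro!: derivative_eq_intros)
    with D bumplike_inner.hyps show ?case
      by (intro exI[of _ "\<lambda>v x. (x \<bullet> w) * D v x + (v \<bullet> w) * f x"] conjI allI bumplike.intros) auto
  next
    case (bumplike_scale f c)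
    then obtain D where D: "\<forall>x. (f has_derivative (\<lambda>v. D v x)) (at x)" "\<forall>v. bumplike (D v)" by blast
    have "((\<lambda>x. c * f x) has_derivative (\<lambda>v. c * D v x)) (at x)" for x
      using D(1) by (auto intro!: derivative_eq_intros)
    with D show ?case
      by (intro exI[of _ "\<lambda>v x. c * D v x"] conjI allI bumplike.intros) auto
  qed
  then show ?thesis using that by blast
qed

lemma bumplike_iderv: "bumplike f \<Longrightarrow> bumplike (iderv vs f)"
proof (induction vs)
  case (Cons v vs)
  then obtain D where D: "\<And>x. (iderv vs f has_derivative (\<lambda>v. D v x)) (at x)" "\<And>v. bumplike (D v)"
    using bumplike_derivative by blast
  have "iderv (v # vs) f = D v"
    using frechet_derivative_at[OF D(1)] by (simp add: fun_eq_iff)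
  then show ?case using D(2) by simp
qed simp

lemma bumplike_differentiable: "bumplike f \<Longrightarrow> f differentiable (at x)"
  by (metis bumplike_derivative differentiable_def)

lemma smooth_fun_bumplike: "bumplike f \<Longrightarrow> smooth_fun f"
  by (simp add: smooth_fun_def bumplike_differentiable bumplike_iderv)

lemma bumplike_outside: "bumplike f \<Longrightarrow> 1 \<le> norm x \<Longrightarrow> f x = 0"
proof (induction rule: bumplike.induct)
  case (bumplike_flat p)
  then have "1 \<le> x \<bullet> x" by (simp add: norm_eq_sqrt_inner)
  then show ?case by simp
qed simp_all

lemma continuous_on_bumplike: "bumplike f \<Longrightarrow> continuous_on A f"
  by (simp add: bumplike_differentiable continuous_at_imp_continuous_on differentiable_imp_continuous_within)

lemma bumplike_bounded:
  assumes "bumplike f"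
  obtains B where "B > 0" "\<And>x. \<bar>f x\<bar> \<le> B"
proof -
  have "bounded (f ` cball 0 1)"
    by (intro compact_imp_bounded compact_continuous_image continuous_on_bumplike assms compact_cball)
  then obtain B where B: "B > 0" "\<And>x. x \<in> cball 0 1 \<Longrightarrow> \<bar>f x\<bar> \<le> B"
    unfolding bounded_pos by auto
  have "\<bar>f x\<bar> \<le> B" for x
    using B bumplike_outside[OF assms, of x] by (cases "norm x \<le> 1") auto
  with B(1) show ?thesis using that by blast
qed

lemma borel_measurable_bumplike: "bumplike f \<Longrightarrow> f \<in> borel_measurable borel"
  by (intro borel_measurable_continuous_onI continuous_on_bumplike)

lemma integrable_bounded_support:
  fixes f :: "'a::euclidean_space \<Rightarrow> 'b::{banach, second_countable_topology}"
  assumes "f \<in> borel_measurable borel" "\<And>x. norm (f x) \<le> B" "\<And>x. norm x > r \<Longrightarrow> f x = 0"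
  shows "integrable lborel f"
proof (rule Bochner_Integration.integrable_bound)
  have "emeasure lborel (cball (0::'a) r) < \<infinity>"
    by (rule emeasure_bounded_finite) simp
  then show "integrable lborel (\<lambda>x. B * indicator (cball (0::'a) r) x)"
    by (intro integrable_mult_right integrable_real_indicator) auto
  show "AE x in lborel. norm (f x) \<le> norm (B * indicator (cball (0::'a) r) x)"
  proof (intro always_eventually allI)
    fix x :: 'a
    show "norm (f x) \<le> norm (B * indicator (cball (0::'a) r) x)"
      using assms(2)[of x] assms(3)[of x] by (cases "norm x \<le> r") (auto intro: order_trans[OF _ abs_ge_self])
  qed
qed (use assms in simp)

lemma integrable_bumplike: "bumplike f \<Longrightarrow> integrable lborel f"
  by (rule bumplike_bounded, assumption, rule integrable_bounded_support[where r = 1])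
     (auto intro: borel_measurable_bumplike bumplike_outside)


section \<open>Transforms of derivatives and rapid decay\<close>

lemma echar_quotient_tendsto:
  "(\<lambda>n. (echar (1 / real (Suc n) * w) - 1) / complex_of_real (1 / real (Suc n))) \<longlonglongrightarrow> 2 * pi * \<i> * complex_of_real w"
proof -
  have "((\<lambda>z. exp (2 * pi * \<i> * (z * complex_of_real w))) has_field_derivative 2 * pi * \<i> * complex_of_real w) (at 0)"
    by (auto intro!: derivative_eq_intros)
  then have "((\<lambda>z. (exp (2 * pi * \<i> * (z * complex_of_real w)) - 1) / z) \<longlongrightarrow> 2 * pi * \<i> * complex_of_real w) (at 0)"
    by (simp add: has_field_derivative_iff)
  moreover have "filterlim (\<lambda>n. complex_of_real (1 / real (Suc n))) (at 0) sequentially"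
  proof (rule filterlim_atI)
    have "(\<lambda>n. complex_of_real (1 / real (Suc n))) \<longlonglongrightarrow> complex_of_real 0"
      by (intro tendsto_intros LIMSEQ_Suc[OF lim_1_over_n])
    then show "(\<lambda>n. complex_of_real (1 / real (Suc n))) \<longlonglongrightarrow> 0" by simp
  qed (auto simp: field_simps simp del: of_nat_Suc)
  ultimately have "(\<lambda>n. (exp (2 * pi * \<i> * (complex_of_real (1 / real (Suc n)) * complex_of_real w)) - 1) / complex_of_real (1 / real (Suc n)))
      \<longlonglongrightarrow> 2 * pi * \<i> * complex_of_real w"
    by (rule filterlim_compose)
  then show ?thesis by (simp only: echar_def of_real_mult)
qed

text \<open>Difference quotients replace integration by parts. Translation by
  \<open>h *\<^sub>R v\<close> multiplies the transform by a character, so the transform of the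
  quotient carries the factor \<open>(echar (h * (v \<bullet> z)) - 1) / h\<close>, which tends to
  \<open>2 * pi * \<i> * (v \<bullet> z)\<close>; on the other side the limit is taken under the
  integral.\<close>

lemma fourier_derivative:
  fixes f :: "'a::euclidean_space \<Rightarrow> real"
  assumes f: "bumplike f" and D: "\<And>x. (f has_derivative (\<lambda>v. D v x)) (at x)" "\<And>v. bumplike (D v)"
  shows "fourier (\<lambda>x. complex_of_real (D v x)) z = 2 * pi * \<i> * complex_of_real (v \<bullet> z) * fourier (\<lambda>x. complex_of_real (f x)) z"
proof -
  define s where "s n = 1 / real (Suc n)" for n
  have s: "0 < s n" "s n \<le> 1" for n by (auto simp: s_def)
  have [measurable]: "f \<in> borel_measurable borel" "D v \<in> borel_measurable borel"
    using f D(2) by (auto intro: borel_measurable_bumplike)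
  obtain B where B: "B > 0" "\<And>x. \<bar>D v x\<bar> \<le> B" using bumplike_bounded[OF D(2)] by blast
  define Q where "Q n x = (f (s n *\<^sub>R v + x) - f x) / s n" for n x
  have line: "((\<lambda>h. f (h *\<^sub>R v + x)) has_field_derivative D v (h *\<^sub>R v + x)) (at h)" for h x
  proof -
    have lin: "D (c *\<^sub>R v) y = D v y * c" for c y
      using linear_cmul[OF has_derivative_linear[OF D(1)], of c v y] by simp
    have "((\<lambda>h. h *\<^sub>R v + x) has_derivative (\<lambda>c. c *\<^sub>R v)) (at h)"
      by (auto intro!: derivative_eq_intros)
    from has_derivative_compose[OF this D(1)]
    show ?thesis by (simp add: has_field_derivative_def lin)
  qed
  \<comment> \<open>By the mean value theorem the quotients never exceed the bound \<open>B\<close>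
    of the derivative. The steps are at most 1, so all quotients vanish outside the ball of radius
    \<open>1 + norm v\<close>, and one integrable majorant serves every \<open>n\<close>.\<close>
  have Q_bound: "\<bar>Q n x\<bar> \<le> B * indicator (cball 0 (1 + norm v)) x" for n x
  proof (cases "norm x \<le> 1 + norm v")
    case True
    obtain h where "f (s n *\<^sub>R v + x) - f (0 *\<^sub>R v + x) = (s n - 0) * D v (h *\<^sub>R v + x)"
      using MVT2[of 0 "s n" "\<lambda>h. f (h *\<^sub>R v + x)" "\<lambda>h. D v (h *\<^sub>R v + x)"] s line by auto
    then have "Q n x = D v (h *\<^sub>R v + x)" using s(1)[of n] by (simp add: Q_def)
    then show ?thesis using True B by simp
  next
    case False
    have "norm (s n *\<^sub>R v) \<le> norm v" using s[of n] by (simp add: mult_left_le_one_le)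
    then have "1 \<le> norm (s n *\<^sub>R v + x)"
      using False norm_diff_ineq[of x "s n *\<^sub>R v"] by (simp add: add.commute)
    moreover have "1 \<le> norm x" using False norm_ge_zero[of v] by linarith
    ultimately have "Q n x = 0" by (simp add: Q_def bumplike_outside[OF f])
    then show ?thesis using B by simp
  qed
  have Q_lim: "(\<lambda>n. Q n x) \<longlonglongrightarrow> D v x" for x
  proof -
    have "((\<lambda>h. (f (h *\<^sub>R v + x) - f x) / h) \<longlongrightarrow> D v x) (at 0)"
      using line[of x 0] by (simp add: has_field_derivative_iff)
    moreover have "filterlim s (at 0) sequentially"
      unfolding s_def
      by (rule filterlim_atI[OF LIMSEQ_Suc[OF lim_1_over_n]]) (auto simp del: of_nat_Suc)
    ultimately show ?thesis unfolding Q_def by (rule filterlim_compose)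
  qed
  have "(\<lambda>n. fourier (\<lambda>x. complex_of_real (Q n x)) z) \<longlonglongrightarrow> fourier (\<lambda>x. complex_of_real (D v x)) z"
    unfolding fourier_echar
  proof (rule integral_dominated_convergence[where w = "\<lambda>x. B * indicator (cball 0 (1 + norm v)) x"])
    show "AE x in lborel. (\<lambda>n. complex_of_real (Q n x) * echar (- (x \<bullet> z))) \<longlonglongrightarrow> complex_of_real (D v x) * echar (- (x \<bullet> z))"
      by (intro always_eventually allI tendsto_intros Q_lim)
    show "integrable lborel (\<lambda>x::'a. B * indicator (cball 0 (1 + norm v)) x)"
      by (intro integrable_mult_right integrable_real_indicator emeasure_bounded_finite) auto
    show "AE x in lborel. norm (complex_of_real (Q n x) * echar (- (x \<bullet> z))) \<le> B * indicator (cball 0 (1 + norm v)) x" for n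
      using Q_bound by (intro always_eventually allI) (simp add: norm_mult)
  qed (auto simp: Q_def)
  moreover have "fourier (\<lambda>x. complex_of_real (Q n x)) z
    = (echar (1 / real (Suc n) * (v \<bullet> z)) - 1) / complex_of_real (1 / real (Suc n)) * fourier (\<lambda>x. complex_of_real (f x)) z" for n
  proof -
    have fi: "integrable lborel (\<lambda>x. complex_of_real (f x))"
      using integrable_bumplike[OF f] by (rule integrable_of_real)
    have "fourier (\<lambda>x. complex_of_real (Q n x)) z
       = (LINT x|lborel. (1 / complex_of_real (s n)) * (complex_of_real (f (s n *\<^sub>R v + x)) * echar (- (x \<bullet> z)) - complex_of_real (f x) * echar (- (x \<bullet> z))))"
      unfolding fourier_echar Q_def
      by (intro Bochner_Integration.integral_cong) (auto simp: field_simps)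
    also have "\<dots> = (1 / complex_of_real (s n)) * (fourier (\<lambda>x. complex_of_real (f (s n *\<^sub>R v + x))) z - fourier (\<lambda>x. complex_of_real (f x)) z)"
      unfolding fourier_echar integral_mult_right_zero
      by (subst Bochner_Integration.integral_diff) (use integrable_lborel_shift(1)[OF fi] fi in auto)
    also have "fourier (\<lambda>x. complex_of_real (f (s n *\<^sub>R v + x))) z = echar (s n * (v \<bullet> z)) * fourier (\<lambda>x. complex_of_real (f x)) z"
      using fourier_shift[of "\<lambda>x. complex_of_real (f x)" "s n *\<^sub>R v" z] by simp
    finally show ?thesis by (simp add: s_def field_simps)
  qed
  ultimately have "(\<lambda>n. (echar (1 / real (Suc n) * (v \<bullet> z)) - 1) / complex_of_real (1 / real (Suc n)) * fourier (\<lambda>x. complex_of_real (f x)) z)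
     \<longlonglongrightarrow> fourier (\<lambda>x. complex_of_real (D v x)) z" by simp
  moreover have "(\<lambda>n. (echar (1 / real (Suc n) * (v \<bullet> z)) - 1) / complex_of_real (1 / real (Suc n)) * fourier (\<lambda>x. complex_of_real (f x)) z)
     \<longlonglongrightarrow> 2 * pi * \<i> * complex_of_real (v \<bullet> z) * fourier (\<lambda>x. complex_of_real (f x)) z"
    by (intro tendsto_mult echar_quotient_tendsto tendsto_const)
  ultimately show ?thesis by (rule LIMSEQ_unique)
qed

text \<open>Each factor \<open>norm z\<close> is paid for by one derivative: up to
  \<open>2 * pi\<close>, multiplying the transform by \<open>\<bar>z \<bullet> b\<bar>\<close> means
  differentiating \<open>f\<close> along \<open>b\<close>, and the coordinates dominate the norm.
  The function is arbitrary in the induction because the hypothesis is applied to derivatives of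
  \<open>f\<close>.\<close>

lemma fourier_bumplike_decay:
  assumes "bumplike f"
  shows "\<exists>C. \<forall>z. (1 + norm z) ^ k * cmod (fourier (\<lambda>x. complex_of_real (f x)) z) \<le> C"
  using assms
proof (induction k arbitrary: f)
  case 0
  then show ?case using norm_fourier_le by force
next
  case (Suc k)
  let ?F = "\<lambda>f z. cmod (fourier (\<lambda>x. complex_of_real (f x)) z)"
  obtain D where D: "\<And>x. (f has_derivative (\<lambda>v. D v x)) (at x)" "\<And>v. bumplike (D v)"
    using bumplike_derivative[OF Suc.prems] by blast
  obtain C where C: "\<And>z. (1 + norm z) ^ k * ?F f z \<le> C" using Suc.IH[OF Suc.prems] by blast
  have "\<forall>v. \<exists>C. \<forall>z. (1 + norm z) ^ k * ?F (D v) z \<le> C" using Suc.IH D(2) by blast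
  then obtain E where E: "\<And>v z. (1 + norm z) ^ k * ?F (D v) z \<le> E v" by metis
  have "(1 + norm z) ^ Suc k * ?F f z \<le> C + (\<Sum>b\<in>Basis. E b)" for z
  proof -
    have 1: "\<bar>z \<bullet> b\<bar> * ?F f z \<le> ?F (D b) z" for b
    proof -
      have "?F (D b) z = 2 * pi * (\<bar>z \<bullet> b\<bar> * ?F f z)"
        unfolding fourier_derivative[OF Suc.prems D] by (simp add: norm_mult inner_commute)
      moreover have "1 * (\<bar>z \<bullet> b\<bar> * ?F f z) \<le> 2 * pi * (\<bar>z \<bullet> b\<bar> * ?F f z)"
        using pi_gt3 by (intro mult_right_mono) auto
      ultimately show ?thesis by simp
    qed
    have "norm z * ?F f z \<le> (\<Sum>b\<in>Basis. \<bar>z \<bullet> b\<bar>) * ?F f z"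
      by (intro mult_right_mono norm_le_l1) simp
    also have "\<dots> \<le> (\<Sum>b\<in>Basis. ?F (D b) z)"
      unfolding sum_distrib_right by (intro sum_mono 1)
    finally have "(1 + norm z) ^ k * (norm z * ?F f z) \<le> (1 + norm z) ^ k * (\<Sum>b\<in>Basis. ?F (D b) z)"
      by (intro mult_left_mono) auto
    also have "\<dots> \<le> (\<Sum>b\<in>Basis. E b)"
      unfolding sum_distrib_left by (intro sum_mono E)
    finally show ?thesis using C[of z] by (simp add: algebra_simps)
  qed
  then show ?case by blast
qed

section \<open>Integrability from polynomial decay\<close>

lemma integrable_inverse_one_plus_norm:
  assumes "k \<ge> 2 * DIM('a)"
  shows "integrable lborel (\<lambda>x::'a::euclidean_space. 1 / (1 + norm x) ^ k)"
proof (rule Bochner_Integration.integrable_bound)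
  have 0: "integrable lborel (\<lambda>x::real. complex_of_real (1 / (1 + x\<^sup>2)))"
    using integrable_inverse_1_plus_square
    by (intro integrable_of_real) (simp add: set_integrable_def inverse_eq_divide)
  have "integrable lborel (\<lambda>x::'a. (\<Prod>b\<in>Basis. complex_of_real (1 / (1 + (x \<bullet> b)\<^sup>2))))"
    by (rule lborel_integral_prod(1)[where f = "\<lambda>_ x. complex_of_real (1 / (1 + x\<^sup>2))"]) (rule 0)
  from integrable_Re[OF this] show "integrable lborel (\<lambda>x::'a. (\<Prod>b\<in>Basis. 1 / (1 + (x \<bullet> b)\<^sup>2)))"
    unfolding of_real_prod[symmetric] Re_complex_of_real .
  show "AE x::'a in lborel. norm (1 / (1 + norm x) ^ k) \<le> norm (\<Prod>b\<in>Basis. 1 / (1 + (x \<bullet> b)\<^sup>2))"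
  proof (intro always_eventually allI)
    fix x :: 'a
    \<comment> \<open>Every coordinate satisfies
      \<open>1 + (x \<bullet> b)\<^sup>2 \<le> (1 + norm x)\<^sup>2\<close>; multiplying these
      \<open>DIM('a)\<close> inequalities is the source of the exponent
      \<open>2 * DIM('a)\<close>.\<close>
    have "(\<Prod>b\<in>(Basis::'a set). 1 / (1 + norm x)\<^sup>2) \<le> (\<Prod>b\<in>Basis. 1 / (1 + (x \<bullet> b)\<^sup>2))"
    proof (intro prod_mono conjI)
      fix b :: 'a assume b: "b \<in> Basis"
      have "\<bar>x \<bullet> b\<bar>\<^sup>2 \<le> (norm x)\<^sup>2" using Basis_le_norm[OF b] by (intro power_mono) auto
      then have "1 + (x \<bullet> b)\<^sup>2 \<le> (1 + norm x)\<^sup>2"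
        using norm_ge_zero[of x] unfolding power2_abs power2_sum one_power2 by linarith
      then show "1 / (1 + norm x)\<^sup>2 \<le> 1 / (1 + (x \<bullet> b)\<^sup>2)"
        by (intro divide_left_mono mult_pos_pos zero_less_power add_pos_nonneg) auto
    qed simp
    also have "(\<Prod>b\<in>(Basis::'a set). 1 / (1 + norm x)\<^sup>2) = 1 / (1 + norm x) ^ (2 * DIM('a))"
      by (simp add: power_mult power_one_over)
    finally have "1 / (1 + norm x) ^ (2 * DIM('a)) \<le> (\<Prod>b\<in>Basis. 1 / (1 + (x \<bullet> b)\<^sup>2))" .
    moreover have "1 / (1 + norm x) ^ k \<le> 1 / (1 + norm x) ^ (2 * DIM('a))"
      using assms by (intro divide_left_mono power_increasing mult_pos_pos zero_less_power add_pos_nonneg) auto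
    ultimately have "1 / (1 + norm x) ^ k \<le> (\<Prod>b\<in>Basis. 1 / (1 + (x \<bullet> b)\<^sup>2))" by (rule order_trans[rotated])
    moreover have "0 \<le> 1 / (1 + norm x) ^ k" by simp
    ultimately show "norm (1 / (1 + norm x) ^ k) \<le> norm (\<Prod>b\<in>Basis. 1 / (1 + (x \<bullet> b)\<^sup>2))"
      unfolding real_norm_def by linarith
  qed
qed simp

lemma integrable_rapid_decay:
  fixes f :: "'a::euclidean_space \<Rightarrow> complex"
  assumes "f \<in> borel_measurable borel" "\<And>x. (1 + norm x) ^ (2 * DIM('a)) * cmod (f x) \<le> C"
  shows "integrable lborel f"
proof (rule Bochner_Integration.integrable_bound)
  show "integrable lborel (\<lambda>x::'a. C * (1 / (1 + norm x) ^ (2 * DIM('a))))"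
    by (intro integrable_mult_right integrable_inverse_one_plus_norm) simp
  have "cmod (f x) \<le> C * (1 / (1 + norm x) ^ (2 * DIM('a)))" for x
    using assms(2)[of x] by (simp add: field_simps add_pos_nonneg)
  then show "AE x in lborel. norm (f x) \<le> norm (C * (1 / (1 + norm x) ^ (2 * DIM('a))))"
    by (intro always_eventually allI) (metis abs_ge_self order_trans real_norm_def)
qed (use assms in simp)

lemma integrable_fourier_bumplike:
  assumes "bumplike (f :: 'a::euclidean_space \<Rightarrow> real)"
  shows "integrable lborel (fourier (\<lambda>x. complex_of_real (f x)))"
proof -
  have [measurable]: "f \<in> borel_measurable borel" by (rule borel_measurable_bumplike[OF assms])
  obtain C where "\<And>z. (1 + norm z) ^ (2 * DIM('a)) * cmod (fourier (\<lambda>x. complex_of_real (f x)) z) \<le> C"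
    using fourier_bumplike_decay[OF assms] by blast
  then show ?thesis by (intro integrable_rapid_decay) auto
qed

lemma nn_integral_fourier_bumplike_weighted:
  assumes f: "bumplike (f :: 'a::euclidean_space \<Rightarrow> real)" and "\<tau> \<ge> 0"
  shows "(\<integral>\<^sup>+z. ennreal ((cmod (fourier (\<lambda>x. complex_of_real (f x)) z))\<^sup>2 * (1 + norm z) powr \<tau>) \<partial>lborel) < \<infinity>"
proof -
  define n where "n = nat \<lceil>\<tau>\<rceil>"
  \<comment> \<open>The decay of order \<open>k\<close> gets squared: \<open>DIM('a)\<close> of its
    powers give the integrable majorant, and \<open>n\<close>, an integer at least
    \<open>\<tau>\<close>, absorbs the weight.\<close>
  define k where "k = DIM('a) + n"
  obtain C where C: "\<And>z. (1 + norm z) ^ k * cmod (fourier (\<lambda>x. complex_of_real (f x)) z) \<le> C"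
    using fourier_bumplike_decay[OF f] by blast
  have "(cmod (fourier (\<lambda>x. complex_of_real (f x)) z))\<^sup>2 * (1 + norm z) powr \<tau> \<le> C\<^sup>2 * (1 / (1 + norm z) ^ (2 * DIM('a)))" for z
  proof -
    have "(1 + norm z) powr \<tau> \<le> (1 + norm z) powr real n"
      using assms(2) by (intro powr_mono) (auto simp: n_def)
    also have "\<dots> = (1 + norm z) ^ n" by (simp add: powr_realpow add_pos_nonneg)
    also have "\<dots> \<le> (1 + norm z) ^ (2 * n)" by (intro power_increasing) auto
    finally have "(1 + norm z) ^ (2 * DIM('a)) * ((cmod (fourier (\<lambda>x. complex_of_real (f x)) z))\<^sup>2 * (1 + norm z) powr \<tau>)
      \<le> (1 + norm z) ^ (2 * DIM('a)) * ((cmod (fourier (\<lambda>x. complex_of_real (f x)) z))\<^sup>2 * (1 + norm z) ^ (2 * n))"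
      by (intro mult_left_mono) auto
    also have "\<dots> = ((1 + norm z) ^ k * cmod (fourier (\<lambda>x. complex_of_real (f x)) z))\<^sup>2"
      unfolding power_mult_distrib power_mult[symmetric] k_def by (simp add: distrib_right power_add mult_ac)
    also have "\<dots> \<le> C\<^sup>2" by (intro power_mono C) auto
    finally show ?thesis by (simp add: field_simps add_pos_nonneg)
  qed
  then have "(\<integral>\<^sup>+z. ennreal ((cmod (fourier (\<lambda>x. complex_of_real (f x)) z))\<^sup>2 * (1 + norm z) powr \<tau>) \<partial>lborel)
     \<le> (\<integral>\<^sup>+z. ennreal (C\<^sup>2 * (1 / (1 + norm z) ^ (2 * DIM('a)))) \<partial>(lborel :: 'a measure))"
    by (intro nn_integral_mono ennreal_leI)
  also have "\<dots> < \<infinity>"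
    by (subst nn_integral_eq_integral)
       (auto intro!: integrable_mult_right integrable_inverse_one_plus_norm simp del: times_divide_eq_right)
  finally show ?thesis .
qed

lemma integrable_schwartz:
  fixes f :: "'a::euclidean_space \<Rightarrow> complex"
  assumes "schwartz f"
  shows "integrable lborel f"
proof -
  have "f differentiable (at x)" for x
    using assms unfolding schwartz_def smooth_fun_def by (metis empty_set empty_subsetI iderv.simps(1))
  then have "continuous_on UNIV f"
    by (simp add: continuous_at_imp_continuous_on differentiable_imp_continuous_within)
  then have "f \<in> borel_measurable borel" by (rule borel_measurable_continuous_onI)
  moreover obtain C where "\<And>x. (1 + norm x) ^ (2 * DIM('a)) * cmod (f x) \<le> C"
    using assms unfolding schwartz_def by (metis empty_set empty_subsetI iderv.simps(1))
  ultimately show ?thesis by (rule integrable_rapid_decay)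
qed

section \<open>Multipliers tested against a frequency window\<close>

lemma nn_integral_Cauchy_Schwarz_weighted:
  fixes A V :: "'b \<Rightarrow> complex" and W :: "'b \<Rightarrow> real"
  assumes [measurable]: "A \<in> borel_measurable M" "V \<in> borel_measurable M" "W \<in> borel_measurable M"
    and W: "\<And>z. 0 < W z"
  shows "(\<integral>\<^sup>+z. ennreal (cmod (A z * V z)) \<partial>M)\<^sup>2
    \<le> (\<integral>\<^sup>+z. ennreal ((cmod (A z))\<^sup>2 * W z) \<partial>M) * (\<integral>\<^sup>+z. ennreal ((cmod (V z))\<^sup>2 / W z) \<partial>M)"
proof -
  have "(\<integral>\<^sup>+z. ennreal (cmod (A z * V z)) \<partial>M)
    = (\<integral>\<^sup>+z. ennreal (cmod (A z) * sqrt (W z)) * ennreal (cmod (V z) / sqrt (W z)) \<partial>M)"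
  proof (intro nn_integral_cong)
    fix z
    have "cmod (A z * V z) = (cmod (A z) * sqrt (W z)) * (cmod (V z) / sqrt (W z))"
      using W[of z] by (simp add: norm_mult)
    then show "ennreal (cmod (A z * V z)) = ennreal (cmod (A z) * sqrt (W z)) * ennreal (cmod (V z) / sqrt (W z))"
      using W[of z] by (simp only: ennreal_mult'[symmetric] mult_nonneg_nonneg norm_ge_zero real_sqrt_ge_zero less_imp_le)
  qed
  also have "(\<dots>)\<^sup>2 \<le> (\<integral>\<^sup>+z. (ennreal (cmod (A z) * sqrt (W z)))\<^sup>2 \<partial>M) * (\<integral>\<^sup>+z. (ennreal (cmod (V z) / sqrt (W z)))\<^sup>2 \<partial>M)"
    by (rule Cauchy_Schwarz_nn_integral) measurable
  also have "(\<lambda>z. (ennreal (cmod (A z) * sqrt (W z)))\<^sup>2) = (\<lambda>z. ennreal ((cmod (A z))\<^sup>2 * W z))"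
    using less_imp_le[OF W] by (simp add: ennreal_power power_mult_distrib)
  also have "(\<lambda>z. (ennreal (cmod (V z) / sqrt (W z)))\<^sup>2) = (\<lambda>z. ennreal ((cmod (V z))\<^sup>2 / W z))"
    using less_imp_le[OF W] by (simp add: ennreal_power power_divide)
  finally show ?thesis .
qed

text \<open>The window \<open>b\<close> plays two roles. Its square localises \<open>G\<close> in space, because the transform of \<open>b\<^sup>2\<close>
  is bounded below on \<open>S\<close>. One factor of \<open>b\<close> localises \<open>m\<close>, the other localises \<open>F\<close> in
  frequency, and Plancherel in the centre \<open>\<zeta>\<close> of the window replaces almost orthogonality.\<close>

lemma local_multiplier_estimate:
  fixes F m b \<Phi> :: "'a::euclidean_space \<Rightarrow> complex" and W W' :: "'a \<Rightarrow> real"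
  assumes F: "integrable lborel F" and m[measurable]: "m \<in> borel_measurable borel"
    and mF: "integrable lborel (\<lambda>\<xi>. m \<xi> * fourier F \<xi>)"
    and b: "integrable lborel b" "\<And>\<xi>. cmod (b \<xi>) \<le> B"
    and \<Phi>: "integrable lborel \<Phi>" "\<And>u. cmod (\<Phi> u) \<le> B'" "\<And>\<xi>. fourier \<Phi> \<xi> = b \<xi>"
    and W: "W \<in> borel_measurable borel" "\<And>z. 0 < W z"
    and W': "W' \<in> borel_measurable borel" "\<And>z. 0 \<le> W' z" "\<And>u v. W v \<le> W (u + v) * W' u"
    and local_bound: "\<And>\<zeta>. (\<forall>\<xi>. fourier F \<xi> * b (\<xi> + \<zeta>) = 0) \<or>
       integrable lborel (\<lambda>\<xi>. m \<xi> * b (\<xi> + \<zeta>)) \<and>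
       (\<integral>\<^sup>+z. ennreal ((cmod (fourier (\<lambda>\<xi>. m \<xi> * b (\<xi> + \<zeta>)) z))\<^sup>2 * W z) \<partial>lborel) \<le> ennreal K"
    and S: "S \<in> sets borel" and \<kappa>: "0 \<le> \<kappa>" "\<And>u. u \<in> S \<Longrightarrow> \<kappa> \<le> cmod (fourier (\<lambda>\<xi>. (b \<xi>)\<^sup>2) u)"
  shows "ennreal (\<kappa>\<^sup>2) * (\<integral>\<^sup>+u. indicator S u *
       ennreal ((cmod (LINT \<xi>|lborel. m \<xi> * fourier F \<xi> * echar ((x + u) \<bullet> \<xi>)))\<^sup>2) \<partial>lborel)
    \<le> ennreal K * (\<integral>\<^sup>+u. ennreal ((cmod (\<Phi> u))\<^sup>2 * W' u) \<partial>lborel)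
        * (\<integral>\<^sup>+v. ennreal ((cmod (F (x + v)))\<^sup>2 / W v) \<partial>lborel)"
proof -
  note [measurable] = W(1) W'(1) S
  have [measurable]: "F \<in> borel_measurable borel" "b \<in> borel_measurable borel" "\<Phi> \<in> borel_measurable borel"
    using F b(1) \<Phi>(1) borel_measurable_integrable by auto
  \<comment> \<open>The modulation by \<open>echar (x \<bullet> \<xi>)\<close> moves the centre
    \<open>x\<close> to the origin, so that \<open>u\<close> and \<open>v\<close> below are
    displacements from \<open>x\<close>.\<close>
  define M where "M \<xi> = m \<xi> * fourier F \<xi> * echar (x \<bullet> \<xi>)" for \<xi>
  have M: "integrable lborel M"
    unfolding M_def by (rule integrable_mult_echar[OF mF]) simp
  have M_minus: "integrable lborel (\<lambda>\<xi>. M (- \<xi>))"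
    using integrable_lborel_shift(2)[OF M, of 0] by simp
  have b2: "integrable lborel (\<lambda>\<xi>. (b \<xi>)\<^sup>2)"
  proof (rule Bochner_Integration.integrable_bound[OF integrable_mult_left[OF b(1), of "complex_of_real B"]])
    show "AE \<xi> in lborel. norm ((b \<xi>)\<^sup>2) \<le> norm (b \<xi> * complex_of_real B)"
      using b(2) by (auto simp: norm_mult power2_eq_square intro!: mult_left_mono order_trans[OF _ abs_ge_self])
  qed simp
  \<comment> \<open>\<open>H \<zeta>\<close> tests \<open>M\<close> against the square of the window
    shifted by \<open>\<zeta>\<close>. Reflecting \<open>M\<close> makes this a convolution in
    \<open>\<zeta>\<close>, so its transform factors into the value at \<open>x + u\<close> and the
    transform of the squared window.\<close>
  define H where "H \<zeta> = (LINT \<xi>|lborel. M (- \<xi>) * (b (\<zeta> - \<xi>))\<^sup>2)" for \<zeta>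
  have H: "integrable lborel H"
    unfolding H_def by (rule integrable_convolution(2)[OF M_minus b2])
  have H_hat: "fourier H u = (LINT \<xi>|lborel. m \<xi> * fourier F \<xi> * echar ((x + u) \<bullet> \<xi>)) * fourier (\<lambda>\<xi>. (b \<xi>)\<^sup>2) u" for u
  proof -
    have [measurable]: "M \<in> borel_measurable borel" using M borel_measurable_integrable by auto
    have "fourier H u = fourier (\<lambda>\<xi>. M (- \<xi>)) u * fourier (\<lambda>\<xi>. (b \<xi>)\<^sup>2) u"
      unfolding H_def by (rule fourier_convolution[OF M_minus b2])
    also have "fourier (\<lambda>\<xi>. M (- \<xi>)) u = fourier M (- u)"
      by (rule fourier_minus) measurable
    also have "\<dots> = (LINT \<xi>|lborel. m \<xi> * fourier F \<xi> * echar ((x + u) \<bullet> \<xi>))"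
      unfolding fourier_echar[of M] M_def
      by (simp add: mult.assoc inner_add_left inner_commute[of u] flip: echar_add)
    finally show ?thesis .
  qed
  \<comment> \<open>\<open>\<Phi>\<close> modulated by \<open>\<zeta>\<close> has transform
    \<open>b (\<xi> + \<zeta>)\<close>, so convolving it with the translate of \<open>F\<close> cuts
    \<open>fourier F\<close> to the window.\<close>
  define V where "V \<zeta> z = (LINT u|lborel. \<Phi> u * echar (- (u \<bullet> \<zeta>)) * F (x + (z - u)))" for \<zeta> z
  have V_fourier: "V \<zeta> z = fourier (\<lambda>u. F (x + (z - u)) * \<Phi> u) \<zeta>" for \<zeta> z
    unfolding V_def fourier_echar by (intro Bochner_Integration.integral_cong) auto
  have V_meas[measurable]: "(\<lambda>p. V (fst p) (snd p)) \<in> borel_measurable (borel \<Otimes>\<^sub>M borel)"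
    unfolding V_fourier by measurable
  have V_meas1[measurable]: "V \<zeta> \<in> borel_measurable borel" for \<zeta>
    unfolding V_fourier by measurable
  have V_meas2[measurable]: "(\<lambda>\<zeta>. V \<zeta> z) \<in> borel_measurable borel" for z
    unfolding V_fourier by measurable
  have \<Phi>_mod: "integrable lborel (\<lambda>u. \<Phi> u * echar (- (u \<bullet> \<zeta>)))" for \<zeta>
    by (rule integrable_mult_echar[OF \<Phi>(1)]) simp
  have V: "integrable lborel (V \<zeta>)" for \<zeta>
    unfolding V_def
    by (rule integrable_convolution(2)[OF \<Phi>_mod integrable_lborel_shift(1)[OF F]])
  have V_hat: "fourier (V \<zeta>) \<xi> = b (\<xi> + \<zeta>) * (echar (x \<bullet> \<xi>) * fourier F \<xi>)" for \<zeta> \<xi>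
    unfolding V_def
    by (subst fourier_convolution[OF \<Phi>_mod integrable_lborel_shift(1)[OF F]])
       (simp add: fourier_mult_echar \<Phi>(3) fourier_shift)
  have H_eq: "H \<zeta> = (LINT \<xi>|lborel. (m \<xi> * b (\<xi> + \<zeta>)) * fourier (V \<zeta>) \<xi>)" for \<zeta>
  proof -
    have [measurable]: "M \<in> borel_measurable borel" using M borel_measurable_integrable by auto
    have "H \<zeta> = (LINT \<xi>|lborel. M \<xi> * (b (\<zeta> + \<xi>))\<^sup>2)"
      unfolding H_def using integral_lborel_shift(2)[of "\<lambda>\<xi>. M \<xi> * (b (\<zeta> + \<xi>))\<^sup>2" 0] by simp
    also have "\<dots> = (LINT \<xi>|lborel. (m \<xi> * b (\<xi> + \<zeta>)) * fourier (V \<zeta>) \<xi>)"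
      unfolding V_hat M_def by (simp add: power2_eq_square mult_ac add.commute)
    finally show ?thesis .
  qed
  have H_bound: "ennreal ((cmod (H \<zeta>))\<^sup>2) \<le> ennreal K * (\<integral>\<^sup>+z. ennreal ((cmod (V \<zeta> z))\<^sup>2 / W z) \<partial>lborel)" for \<zeta>
  proof (cases "\<forall>\<xi>. fourier F \<xi> * b (\<xi> + \<zeta>) = 0")
    \<comment> \<open>Here the window misses the spectrum of \<open>F\<close>: nothing is known
      about \<open>m\<close> on it, but \<open>H \<zeta>\<close> vanishes.\<close>
    case True
    then have "H \<zeta> = (LINT \<xi>|(lborel :: 'a measure). 0)"
      unfolding H_eq V_hat by (intro Bochner_Integration.integral_cong) auto
    then show ?thesis by simp
  next
    case False
    define A where "A = fourier (\<lambda>\<xi>. m \<xi> * b (\<xi> + \<zeta>))"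
    have [measurable]: "A \<in> borel_measurable borel" unfolding A_def by measurable
    have mb: "integrable lborel (\<lambda>\<xi>. m \<xi> * b (\<xi> + \<zeta>))"
      and K: "(\<integral>\<^sup>+z. ennreal ((cmod (A z))\<^sup>2 * W z) \<partial>lborel) \<le> ennreal K"
      using local_bound[of \<zeta>] False by (auto simp: A_def)
    have "H \<zeta> = (LINT z|lborel. A z * V \<zeta> z)"
      unfolding H_eq A_def by (rule fourier_multiplication_formula[OF mb V])
    then have "ennreal (cmod (H \<zeta>)) \<le> (\<integral>\<^sup>+z. ennreal (cmod (A z * V \<zeta> z)) \<partial>lborel)"
      using norm_integral_le_nn_integral[of lborel "\<lambda>z. A z * V \<zeta> z"] by simp
    then have "(ennreal (cmod (H \<zeta>)))\<^sup>2 \<le> (\<integral>\<^sup>+z. ennreal (cmod (A z * V \<zeta> z)) \<partial>lborel)\<^sup>2"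
      by (rule power_mono) simp
    also have "\<dots> \<le> (\<integral>\<^sup>+z. ennreal ((cmod (A z))\<^sup>2 * W z) \<partial>lborel) * (\<integral>\<^sup>+z. ennreal ((cmod (V \<zeta> z))\<^sup>2 / W z) \<partial>lborel)"
      by (rule nn_integral_Cauchy_Schwarz_weighted) (use W in auto)
    also have "\<dots> \<le> ennreal K * (\<integral>\<^sup>+z. ennreal ((cmod (V \<zeta> z))\<^sup>2 / W z) \<partial>lborel)"
      by (intro mult_right_mono K) simp
    finally show ?thesis by (simp add: ennreal_power)
  qed
  have "ennreal (\<kappa>\<^sup>2) * (\<integral>\<^sup>+u. indicator S u *
       ennreal ((cmod (LINT \<xi>|lborel. m \<xi> * fourier F \<xi> * echar ((x + u) \<bullet> \<xi>)))\<^sup>2) \<partial>lborel)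
     = (\<integral>\<^sup>+u. ennreal (\<kappa>\<^sup>2) * (indicator S u *
       ennreal ((cmod (LINT \<xi>|lborel. m \<xi> * fourier F \<xi> * echar ((x + u) \<bullet> \<xi>)))\<^sup>2)) \<partial>lborel)"
  proof (rule nn_integral_cmult[symmetric])
    have "(\<lambda>u. fourier (\<lambda>\<xi>. m \<xi> * fourier F \<xi>) (- (x + u))) \<in> borel_measurable borel" by measurable
    then have [measurable]: "(\<lambda>u. LINT \<xi>|lborel. m \<xi> * fourier F \<xi> * echar ((x + u) \<bullet> \<xi>)) \<in> borel_measurable borel"
      unfolding fourier_echar[of "\<lambda>\<xi>. m \<xi> * fourier F \<xi>"] by (simp add: inner_commute)
    show "(\<lambda>u. indicator S u * ennreal ((cmod (LINT \<xi>|lborel. m \<xi> * fourier F \<xi> * echar ((x + u) \<bullet> \<xi>)))\<^sup>2))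
        \<in> borel_measurable lborel" by measurable
  qed
  also have "\<dots> \<le> (\<integral>\<^sup>+u. ennreal ((cmod (fourier H u))\<^sup>2) \<partial>lborel)"
  proof (intro nn_integral_mono)
    fix u
    let ?G = "LINT \<xi>|lborel. m \<xi> * fourier F \<xi> * echar ((x + u) \<bullet> \<xi>)"
    show "ennreal (\<kappa>\<^sup>2) * (indicator S u * ennreal ((cmod ?G)\<^sup>2)) \<le> ennreal ((cmod (fourier H u))\<^sup>2)"
    proof (cases "u \<in> S")
      case True
      have "\<kappa>\<^sup>2 * (cmod ?G)\<^sup>2 \<le> (cmod (fourier (\<lambda>\<xi>. (b \<xi>)\<^sup>2) u))\<^sup>2 * (cmod ?G)\<^sup>2"
        using \<kappa> True by (intro mult_right_mono power_mono) auto
      then have "\<kappa>\<^sup>2 * (cmod ?G)\<^sup>2 \<le> (cmod (fourier H u))\<^sup>2"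
        by (simp add: H_hat norm_mult power_mult_distrib mult.commute)
      then show ?thesis using True by (simp add: ennreal_leI flip: ennreal_mult)
    qed simp
  qed
  \<comment> \<open>First use of Plancherel: the square mean over positions \<open>u\<close> becomes
    one over the window parameter \<open>\<zeta>\<close>.\<close>
  also have "\<dots> \<le> (\<integral>\<^sup>+\<zeta>. ennreal ((cmod (H \<zeta>))\<^sup>2) \<partial>lborel)"
    by (rule plancherel_le[OF H])
  also have "\<dots> \<le> (\<integral>\<^sup>+\<zeta>. ennreal K * (\<integral>\<^sup>+z. ennreal ((cmod (V \<zeta> z))\<^sup>2 / W z) \<partial>lborel) \<partial>lborel)"
    by (intro nn_integral_mono H_bound)
  also have "\<dots> = ennreal K * (\<integral>\<^sup>+\<zeta>. \<integral>\<^sup>+z. ennreal ((cmod (V \<zeta> z))\<^sup>2 / W z) \<partial>lborel \<partial>lborel)"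
    by (rule nn_integral_cmult) measurable
  also have "(\<integral>\<^sup>+\<zeta>. \<integral>\<^sup>+z. ennreal ((cmod (V \<zeta> z))\<^sup>2 / W z) \<partial>lborel \<partial>lborel)
     = (\<integral>\<^sup>+z. \<integral>\<^sup>+\<zeta>. ennreal ((cmod (V \<zeta> z))\<^sup>2 / W z) \<partial>lborel \<partial>lborel)"
    by (rule lborel_pair.Fubini'[symmetric]) measurable
  also have "\<dots> \<le> (\<integral>\<^sup>+z. \<integral>\<^sup>+u. ennreal ((cmod (F (x + (z - u)) * \<Phi> u))\<^sup>2 / W z) \<partial>lborel \<partial>lborel)"
  proof (rule nn_integral_mono)
    fix z
    \<comment> \<open>Boundedness of \<open>\<Phi>\<close> makes this integrable for every single
      \<open>z\<close>, as needed for the second use of Plancherel, in \<open>\<zeta>\<close> with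
      \<open>z\<close> fixed.\<close>
    have int: "integrable lborel (\<lambda>u. F (x + (z - u)) * \<Phi> u)"
    proof (rule Bochner_Integration.integrable_bound)
      show "integrable lborel (\<lambda>u. F ((x + z) - u) * complex_of_real B')"
        by (rule integrable_mult_left[OF integrable_lborel_shift(2)[OF F]])
      show "AE u in lborel. norm (F (x + (z - u)) * \<Phi> u) \<le> norm (F (x + z - u) * complex_of_real B')"
        using \<Phi>(2) by (auto simp: norm_mult add_diff_eq intro!: mult_left_mono order_trans[OF _ abs_ge_self])
    qed measurable
    have div: "ennreal (c / W z) = ennreal (1 / W z) * ennreal c" if "0 \<le> c" for c
      using W(2)[of z] that by (simp flip: ennreal_mult)
    have "(\<integral>\<^sup>+\<zeta>. ennreal ((cmod (V \<zeta> z))\<^sup>2 / W z) \<partial>lborel) = ennreal (1 / W z) * (\<integral>\<^sup>+\<zeta>. ennreal ((cmod (V \<zeta> z))\<^sup>2) \<partial>lborel)"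
      unfolding div[OF zero_le_power2] by (rule nn_integral_cmult) measurable
    also have "\<dots> \<le> ennreal (1 / W z) * (\<integral>\<^sup>+u. ennreal ((cmod (F (x + (z - u)) * \<Phi> u))\<^sup>2) \<partial>lborel)"
      unfolding V_fourier by (intro mult_left_mono plancherel_le int) simp
    also have "\<dots> = (\<integral>\<^sup>+u. ennreal ((cmod (F (x + (z - u)) * \<Phi> u))\<^sup>2 / W z) \<partial>lborel)"
      unfolding div[OF zero_le_power2] by (rule nn_integral_cmult[symmetric]) measurable
    finally show "(\<integral>\<^sup>+\<zeta>. ennreal ((cmod (V \<zeta> z))\<^sup>2 / W z) \<partial>lborel)
       \<le> (\<integral>\<^sup>+u. ennreal ((cmod (F (x + (z - u)) * \<Phi> u))\<^sup>2 / W z) \<partial>lborel)" .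
  qed
  also have "\<dots> = (\<integral>\<^sup>+u. \<integral>\<^sup>+z. ennreal ((cmod (F (x + (z - u)) * \<Phi> u))\<^sup>2 / W z) \<partial>lborel \<partial>lborel)"
    by (rule lborel_pair.Fubini') measurable
  also have "\<dots> = (\<integral>\<^sup>+u. \<integral>\<^sup>+v. ennreal ((cmod (F (x + v) * \<Phi> u))\<^sup>2 / W (u + v)) \<partial>lborel \<partial>lborel)"
  proof (rule nn_integral_cong)
    fix u
    show "(\<integral>\<^sup>+z. ennreal ((cmod (F (x + (z - u)) * \<Phi> u))\<^sup>2 / W z) \<partial>lborel)
      = (\<integral>\<^sup>+v. ennreal ((cmod (F (x + v) * \<Phi> u))\<^sup>2 / W (u + v)) \<partial>lborel)"
      using nn_integral_lborel_shift(1)[of "\<lambda>z. ennreal ((cmod (F (x + (z - u)) * \<Phi> u))\<^sup>2 / W z)" u] by simp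
  qed
  also have "\<dots> \<le> (\<integral>\<^sup>+u. \<integral>\<^sup>+v. ennreal ((cmod (\<Phi> u))\<^sup>2 * W' u) * ennreal ((cmod (F (x + v)))\<^sup>2 / W v) \<partial>lborel \<partial>lborel)"
  proof (intro nn_integral_mono)
    fix u v
    \<comment> \<open>Submultiplicativity of the weight separates the variables: after the
      substitution \<open>z = u + v\<close> the double integral splits into a factor in
      \<open>\<Phi>\<close> and one in \<open>F\<close>.\<close>
    have "1 / W (u + v) \<le> W' u / W v"
      using W'(3)[of v u] W(2)[of v] W(2)[of "u + v"] by (simp add: field_simps)
    then have "(cmod (F (x + v) * \<Phi> u))\<^sup>2 * (1 / W (u + v)) \<le> (cmod (F (x + v) * \<Phi> u))\<^sup>2 * (W' u / W v)"
      by (rule mult_left_mono) simp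
    then have "(cmod (F (x + v) * \<Phi> u))\<^sup>2 / W (u + v) \<le> ((cmod (\<Phi> u))\<^sup>2 * W' u) * ((cmod (F (x + v)))\<^sup>2 / W v)"
      by (simp add: norm_mult power_mult_distrib mult_ac)
    moreover have "ennreal (((cmod (\<Phi> u))\<^sup>2 * W' u) * ((cmod (F (x + v)))\<^sup>2 / W v))
       = ennreal ((cmod (\<Phi> u))\<^sup>2 * W' u) * ennreal ((cmod (F (x + v)))\<^sup>2 / W v)"
      using W'(2)[of u] W(2)[of v] by (intro ennreal_mult) auto
    ultimately show "ennreal ((cmod (F (x + v) * \<Phi> u))\<^sup>2 / W (u + v))
       \<le> ennreal ((cmod (\<Phi> u))\<^sup>2 * W' u) * ennreal ((cmod (F (x + v)))\<^sup>2 / W v)"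
      by (metis ennreal_leI)
  qed
  also have "\<dots> = (\<integral>\<^sup>+u. ennreal ((cmod (\<Phi> u))\<^sup>2 * W' u) \<partial>lborel) * (\<integral>\<^sup>+v. ennreal ((cmod (F (x + v)))\<^sup>2 / W v) \<partial>lborel)"
    by (simp add: nn_integral_cmult nn_integral_multc)
  finally show ?thesis by (simp add: mult.assoc mult_left_mono)
qed

section \<open>Subdyadic balls and adapted bumps\<close>

lemma iderv_affine:
  fixes f :: "'a::euclidean_space \<Rightarrow> real"
  assumes f: "smooth_fun f" and "set vs \<subseteq> Basis"
  shows "iderv vs (\<lambda>w. C * f (s *\<^sub>R w + y)) = (\<lambda>w. C * s ^ length vs * iderv vs f (s *\<^sub>R w + y))"
    and "(\<lambda>w. C * s ^ length vs * iderv vs f (s *\<^sub>R w + y)) differentiable (at x)"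
proof -
  have deriv: "((\<lambda>w. C * s ^ length us * iderv us f (s *\<^sub>R w + y)) has_derivative
      (\<lambda>v. C * s ^ length us * frechet_derivative (iderv us f) (at (s *\<^sub>R x + y)) (s *\<^sub>R v))) (at x)"
    if "set us \<subseteq> Basis" for us x
  proof -
    have "iderv us f differentiable (at (s *\<^sub>R x + y))"
      using f that by (simp add: smooth_fun_def)
    then have 1: "(iderv us f has_derivative frechet_derivative (iderv us f) (at (s *\<^sub>R x + y))) (at (s *\<^sub>R x + y))"
      by (simp add: frechet_derivative_works)
    have "((\<lambda>w. s *\<^sub>R w + y) has_derivative (\<lambda>v. s *\<^sub>R v)) (at x)"
      by (auto intro!: derivative_eq_intros)
    from has_derivative_mult_right[OF has_derivative_compose[OF this 1], of "C * s ^ length us"]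
    show ?thesis .
  qed
  then show "(\<lambda>w. C * s ^ length vs * iderv vs f (s *\<^sub>R w + y)) differentiable (at x)"
    using assms(2) differentiable_def by blast
  show "iderv vs (\<lambda>w. C * f (s *\<^sub>R w + y)) = (\<lambda>w. C * s ^ length vs * iderv vs f (s *\<^sub>R w + y))"
    using assms(2)
  proof (induction vs)
    case (Cons v vs)
    have "iderv (v # vs) (\<lambda>w. C * f (s *\<^sub>R w + y)) x = C * s ^ length (v # vs) * iderv (v # vs) f (s *\<^sub>R x + y)" for x
    proof -
      have "iderv vs f differentiable (at (s *\<^sub>R x + y))"
        using f Cons.prems by (simp add: smooth_fun_def)
      then have lin: "linear (frechet_derivative (iderv vs f) (at (s *\<^sub>R x + y)))"
        by (rule linear_frechet_derivative)
      have "iderv (v # vs) (\<lambda>w. C * f (s *\<^sub>R w + y)) x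
         = frechet_derivative (\<lambda>w. C * s ^ length vs * iderv vs f (s *\<^sub>R w + y)) (at x) v"
        using Cons by simp
      also have "\<dots> = C * s ^ length vs * frechet_derivative (iderv vs f) (at (s *\<^sub>R x + y)) (s *\<^sub>R v)"
        using frechet_derivative_at[OF deriv[of vs x]] Cons.prems by (simp add: fun_eq_iff)
      also have "\<dots> = C * s ^ length (v # vs) * iderv (v # vs) f (s *\<^sub>R x + y)"
        by (simp add: linear_cmul[OF lin])
      finally show ?thesis .
    qed
    then show ?case by blast
  qed simp
qed

text \<open>Each differentiation brings out one factor \<open>s\<close>; since
  \<open>1 \<le> Q\<close>, the single constant \<open>Q ^ N * A\<close> dominates all orders up to
  \<open>N\<close>. The condition on \<open>y\<close> keeps the rescaled support in the unit
  ball.\<close>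

lemma normalised_bump_affine:
  fixes \<Psi> :: "'a::euclidean_space \<Rightarrow> real"
  assumes \<Psi>: "smooth_fun \<Psi>" "\<And>x. 1 < norm x \<Longrightarrow> \<Psi> x = 0"
    and A: "A > 0" "\<And>vs x. set vs \<subseteq> Basis \<Longrightarrow> length vs \<le> N \<Longrightarrow> \<bar>iderv vs \<Psi> x\<bar> \<le> A"
    and s: "0 \<le> s" "s \<le> Q" "1 \<le> Q"
    and y: "\<And>w. norm (s *\<^sub>R w + y) \<le> 1 \<Longrightarrow> norm w \<le> 1"
  shows "normalised_bump N (\<lambda>w. 1 / (Q ^ N * A) * \<Psi> (s *\<^sub>R w + y))"
  unfolding normalised_bump_def
proof (intro conjI allI impI)
  show "smooth_fun (\<lambda>w. 1 / (Q ^ N * A) * \<Psi> (s *\<^sub>R w + y))"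
    unfolding smooth_fun_def using iderv_affine[OF \<Psi>(1)] by metis
  show "{x. 1 / (Q ^ N * A) * \<Psi> (s *\<^sub>R x + y) \<noteq> 0} \<subseteq> cball 0 1"
    using \<Psi>(2) y by force
  fix vs :: "'a list" and x assume vs: "set vs \<subseteq> Basis \<and> length vs \<le> N"
  have "s ^ length vs \<le> Q ^ length vs" using s by (intro power_mono) auto
  also have "\<dots> \<le> Q ^ N" using s vs by (intro power_increasing) auto
  finally have "s ^ length vs * \<bar>iderv vs \<Psi> (s *\<^sub>R x + y)\<bar> \<le> Q ^ N * A"
    using A vs s by (intro mult_mono) auto
  then have "1 / (Q ^ N * A) * (s ^ length vs * \<bar>iderv vs \<Psi> (s *\<^sub>R x + y)\<bar>) \<le> 1"
    using A s by (simp add: field_simps)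
  then show "\<bar>iderv vs (\<lambda>w. 1 / (Q ^ N * A) * \<Psi> (s *\<^sub>R w + y)) x\<bar> \<le> 1"
    using A(1) s vs by (subst iderv_affine(1)[OF \<Psi>(1)]) (auto simp: abs_mult mult_ac)
qed

lemma bumplike_derivatives_bounded:
  fixes f :: "'a::euclidean_space \<Rightarrow> real"
  assumes "bumplike f"
  obtains A where "A > 0" "\<And>vs x. set vs \<subseteq> Basis \<Longrightarrow> length vs \<le> N \<Longrightarrow> \<bar>iderv vs f x\<bar> \<le> A"
proof -
  define L where "L = {vs :: 'a list. set vs \<subseteq> Basis \<and> length vs \<le> N}"
  have L: "finite L" unfolding L_def by (rule finite_lists_length_le) simp
  have "\<exists>B. B > 0 \<and> (\<forall>x. \<bar>iderv vs f x\<bar> \<le> B)" for vs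
    using bumplike_bounded[OF bumplike_iderv[OF assms]] by metis
  then obtain B where B: "\<And>vs. B vs > 0" "\<And>vs x. \<bar>iderv vs f x\<bar> \<le> B vs" by metis
  have "\<bar>iderv vs f x\<bar> \<le> 1 + sum B L" if "vs \<in> L" for vs x
    using B(2)[of vs x] member_le_sum[OF that _ L, of B] less_imp_le[OF B(1)] by force
  moreover have "0 < 1 + sum B L" using less_imp_le[OF B(1)] by (intro add_pos_nonneg sum_nonneg) auto
  ultimately show ?thesis using that unfolding L_def by blast
qed

text \<open>The ball is open, so the infimum is not attained: the points \<open>y s\<close> towards
  the origin, at distance \<open>s < r\<close> from \<open>c\<close>, only approach it.\<close>

lemma infdist_0_ball:
  fixes c :: "'a::euclidean_space"
  assumes "0 < r" "r < norm c"
  shows "infdist 0 (ball c r) = norm c - r"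
proof (rule antisym)
  define y where "y s = (1 - s / norm c) *\<^sub>R c" for s
  have c: "0 < norm c" using assms by linarith
  have bound: "infdist 0 (ball c r) \<le> norm c - s" if "0 \<le> s" "s < r" for s
  proof -
    have "c - y s = (s / norm c) *\<^sub>R c" by (simp add: y_def algebra_simps)
    then have "dist c (y s) = s" using that c by (simp add: dist_norm)
    moreover have "norm (y s) = norm c - s"
      using that assms c by (simp add: y_def left_diff_distrib)
    ultimately show ?thesis
      using infdist_le[of "y s" "ball c r" 0] that by simp
  qed
  have "infdist 0 (ball c r) \<le> norm c - r + e" if "e > 0" for e
    using bound[of "max 0 (r - e)"] that assms(1) by linarith
  then show "infdist 0 (ball c r) \<le> norm c - r"
    by (rule field_le_epsilon)
  have "ball c r \<noteq> {}" using assms by simp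
  then show "norm c - r \<le> infdist 0 (ball c r)"
    unfolding infdist_notempty[OF \<open>ball c r \<noteq> {}\<close>]
  proof (rule cINF_greatest)
    fix y assume "y \<in> ball c r"
    then show "norm c - r \<le> dist 0 y"
      using norm_triangle_sub[of c y] by (simp add: dist_norm)
  qed
qed

text \<open>The ball touches \<open>\<xi>\<close> from the side away from the origin, so that its distance to the origin is exactly
  \<open>norm \<xi>\<close>, while its concentric double still contains a neighbourhood of \<open>\<xi>\<close>.\<close>

lemma subdyadic_ball_touching:
  fixes \<xi> :: "'a::euclidean_space"
  assumes c12: "0 < c1" "c1 \<le> c2" and \<xi>: "0 < norm \<xi>" "1 \<le> norm \<xi> powr \<alpha>"
  defines "r \<equiv> c2 * norm \<xi> powr (1 - \<alpha>)"
  defines "c \<equiv> (1 + r / norm \<xi>) *\<^sub>R \<xi>"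
  shows "subdyadic c1 c2 \<alpha> c r" "infdist 0 (ball c r) = norm \<xi>" "norm (c - \<xi>) = r" "0 < r"
proof -
  show r: "0 < r" using c12 \<xi> by (simp add: r_def)
  have "norm c = (1 + r / norm \<xi>) * norm \<xi>" using r \<xi>(1) by (simp add: c_def)
  also have "\<dots> = norm \<xi> + r" using \<xi>(1) by (simp add: field_simps)
  finally have "norm c = norm \<xi> + r" .
  then show inf: "infdist 0 (ball c r) = norm \<xi>" using infdist_0_ball[OF r, of c] \<xi>(1) by simp
  have "c - \<xi> = (r / norm \<xi>) *\<^sub>R \<xi>" by (simp add: c_def algebra_simps)
  then show "norm (c - \<xi>) = r" using r \<xi>(1) by simp
  show "subdyadic c1 c2 \<alpha> c r"
    unfolding subdyadic_def inf using r \<xi> c12 by (auto simp: r_def intro!: mult_right_mono)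
qed

text \<open>Meant for \<open>x = t * norm \<xi>\<close>: both supports allowed for
  \<open>fourier \<phi>\<close> put \<open>x\<close> in this range, where powers of \<open>t\<close>
  and of \<open>1 / norm \<xi>\<close> are interchangeable up to constants.\<close>

lemma powr_half_two_bounds:
  fixes x p :: real
  assumes "1/2 \<le> x" "x \<le> 2"
  shows "x powr p \<le> 2 powr \<bar>p\<bar>" "2 powr (- \<bar>p\<bar>) \<le> x powr p"
proof -
  have "\<bar>ln x\<bar> \<le> ln 2"
  proof -
    have "ln (1/2) \<le> ln x" "ln x \<le> ln 2" using assms by (auto intro: ln_mono)
    then show ?thesis by (simp add: ln_div)
  qed
  then have "\<bar>p * ln x\<bar> \<le> \<bar>p\<bar> * ln 2" by (simp add: abs_mult mult_left_mono)
  then show "x powr p \<le> 2 powr \<bar>p\<bar>" "2 powr (- \<bar>p\<bar>) \<le> x powr p"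
    using assms by (auto simp: powr_def abs_le_iff)
qed

text \<open>Splits the Cauchy--Schwarz weight into a constant and a pure power, matching the
  homogeneous norms of orders 0 and \<open>\<sigma>\<close>.\<close>

lemma one_plus_powr_le:
  fixes x p :: real
  assumes "0 \<le> x" "0 \<le> p"
  shows "(1 + x) powr p \<le> 2 powr p * (1 + x powr p)"
proof -
  have "(1 + x) powr p \<le> (2 * max 1 x) powr p" using assms by (intro powr_mono2) auto
  also have "\<dots> = 2 powr p * max 1 x powr p" by (rule powr_mult)
  also have "max 1 x powr p \<le> 1 + x powr p" by (simp add: max_def)
  finally show ?thesis by simp
qed

text \<open>\<open>hsob_norm\<close> is built on a Bochner integral, which would be 0 if divergent;
  \<open>hsob_finite\<close> excludes that.\<close>

lemma nn_integral_hsob: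
  assumes "hsob_finite \<theta> g"
  shows "(\<integral>\<^sup>+z. ennreal (norm z powr (2 * \<theta>) * (cmod (fourier g z))\<^sup>2) \<partial>lborel) = ennreal ((hsob_norm \<theta> g)\<^sup>2)"
  using assms unfolding hsob_finite_def hsob_norm_def
  by (subst nn_integral_eq_integral) (auto simp: integral_nonneg_AE)

lemma nn_integral_fourier_weighted_le:
  fixes g :: "'a::euclidean_space \<Rightarrow> complex"
  assumes g: "hsob_finite 0 g" "hsob_finite \<sigma> g" and "0 \<le> \<sigma>" "0 < R"
  shows "(\<integral>\<^sup>+z. ennreal ((cmod (fourier g z))\<^sup>2 * (1 + norm z / R) powr (2 * \<sigma>)) \<partial>lborel)
    \<le> ennreal (2 powr (2 * \<sigma>) * ((hsob_norm 0 g)\<^sup>2 + R powr (- 2 * \<sigma>) * (hsob_norm \<sigma> g)\<^sup>2))"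
proof -
  have [measurable]: "g \<in> borel_measurable borel"
    using g borel_measurable_integrable by (auto simp: hsob_finite_def)
  let ?E = "\<lambda>\<theta> z. norm z powr (2 * \<theta>) * (cmod (fourier g z))\<^sup>2"
  \<comment> \<open>At the origin \<open>0 powr 0 = 0\<close>, so the density of order 0 vanishes
    there instead of being the squared modulus; the exceptional point is a null set.\<close>
  have pt: "(cmod (fourier g z))\<^sup>2 * (1 + norm z / R) powr (2 * \<sigma>)
      \<le> 2 powr (2 * \<sigma>) * ?E 0 z + 2 powr (2 * \<sigma>) * R powr (- 2 * \<sigma>) * ?E \<sigma> z" if "z \<noteq> 0" for z
  proof -
    have "(1 + norm z / R) powr (2 * \<sigma>) \<le> 2 powr (2 * \<sigma>) * (1 + (norm z / R) powr (2 * \<sigma>))"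
      using assms by (intro one_plus_powr_le) auto
    also have "(norm z / R) powr (2 * \<sigma>) = R powr (- 2 * \<sigma>) * norm z powr (2 * \<sigma>)"
      using assms by (subst powr_divide) (auto simp: powr_minus divide_inverse mult.commute)
    finally have "(cmod (fourier g z))\<^sup>2 * (1 + norm z / R) powr (2 * \<sigma>)
      \<le> (cmod (fourier g z))\<^sup>2 * (2 powr (2 * \<sigma>) * (1 + R powr (- 2 * \<sigma>) * norm z powr (2 * \<sigma>)))"
      by (rule mult_left_mono) simp
    then show ?thesis using that by (simp add: algebra_simps)
  qed
  have "(\<integral>\<^sup>+z. ennreal ((cmod (fourier g z))\<^sup>2 * (1 + norm z / R) powr (2 * \<sigma>)) \<partial>lborel)
    \<le> (\<integral>\<^sup>+z. ennreal (2 powr (2 * \<sigma>)) * ennreal (?E 0 z) + ennreal (2 powr (2 * \<sigma>) * R powr (- 2 * \<sigma>)) * ennreal (?E \<sigma> z) \<partial>lborel)"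
  proof (rule nn_integral_mono_AE)
    show "AE z in lborel. ennreal ((cmod (fourier g z))\<^sup>2 * (1 + norm z / R) powr (2 * \<sigma>))
      \<le> ennreal (2 powr (2 * \<sigma>)) * ennreal (?E 0 z) + ennreal (2 powr (2 * \<sigma>) * R powr (- 2 * \<sigma>)) * ennreal (?E \<sigma> z)"
      using AE_lborel_singleton[of 0]
    proof eventually_elim
      case (elim z)
      have "ennreal (2 powr (2 * \<sigma>)) * ennreal (?E 0 z) + ennreal (2 powr (2 * \<sigma>) * R powr (- 2 * \<sigma>)) * ennreal (?E \<sigma> z)
        = ennreal (2 powr (2 * \<sigma>) * ?E 0 z + 2 powr (2 * \<sigma>) * R powr (- 2 * \<sigma>) * ?E \<sigma> z)"
        by (subst ennreal_plus) (simp_all add: ennreal_mult)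
      then show ?case using ennreal_leI[OF pt[OF elim]] by simp
    qed
  qed
  also have "\<dots> = ennreal (2 powr (2 * \<sigma>)) * ennreal ((hsob_norm 0 g)\<^sup>2) + ennreal (2 powr (2 * \<sigma>) * R powr (- 2 * \<sigma>)) * ennreal ((hsob_norm \<sigma> g)\<^sup>2)"
    unfolding nn_integral_hsob[OF g(1), symmetric] nn_integral_hsob[OF g(2), symmetric]
    by (simp add: nn_integral_add nn_integral_cmult)
  also have "\<dots> = ennreal (2 powr (2 * \<sigma>) * (hsob_norm 0 g)\<^sup>2 + 2 powr (2 * \<sigma>) * R powr (- 2 * \<sigma>) * (hsob_norm \<sigma> g)\<^sup>2)"
    by (subst ennreal_plus) (simp_all add: ennreal_mult)
  finally show ?thesis by (simp add: algebra_simps)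
qed

lemma fourier_cmult: "fourier (\<lambda>x. k * g x) \<xi> = k * fourier g \<xi>"
  unfolding fourier_echar by (simp add: mult.assoc)

text \<open>Solves the normalised bound of the multiplier hypothesis for the squared norm:
  \<open>\<rho>\<close> is the distance of the ball to the origin, \<open>v\<close> its volume,
  \<open>p\<close> the exponent of the distance.\<close>

lemma hsob_bound_imp_square:
  fixes \<rho> v p h C :: real
  assumes "\<rho> > 0" "v > 0" "\<rho> powr p * v powr (- 1 / 2) * h \<le> C" "0 \<le> h"
  shows "h\<^sup>2 \<le> C\<^sup>2 * \<rho> powr (- 2 * p) * v"
proof -
  have "h = (\<rho> powr p * v powr (- 1 / 2) * h) * (\<rho> powr (- p) * v powr (1/2))"
    using assms by (simp add: powr_minus divide_simps)
  also have "\<dots> \<le> C * (\<rho> powr (- p) * v powr (1/2))"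
    using assms(3) by (rule mult_right_mono) simp
  finally have "h\<^sup>2 \<le> (C * (\<rho> powr (- p) * v powr (1/2)))\<^sup>2"
    using assms(4) by (rule power_mono)
  also have "\<dots> = C\<^sup>2 * \<rho> powr (- 2 * p) * v"
  proof -
    have "(v powr (1/2))\<^sup>2 = v" "(\<rho> powr (- p))\<^sup>2 = \<rho> powr (- 2 * p)"
      using assms(1,2) by (simp_all add: power2_eq_square flip: powr_add)
    then show ?thesis by (simp add: power_mult_distrib)
  qed
  finally show ?thesis .
qed

text \<open>At a frequency \<open>\<xi>0\<close> of size about \<open>1 / t\<close> the touching
  subdyadic ball has radius comparable to \<open>1 / R\<close>, and a window of radius
  \<open>\<delta> / R\<close> around a point within \<open>\<delta> / R\<close> of
  \<open>\<xi>0\<close> fits into its concentric double. So \<open>b (\<xi> + \<zeta>)\<close> is a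
  fixed multiple of a bump adapted to that ball, uniformly in \<open>t\<close> and
  \<open>\<zeta>\<close>.\<close>

lemma window_local_bound:
  fixes m :: "'a::euclidean_space \<Rightarrow> complex" and \<Psi> :: "'a \<Rightarrow> real"
    and \<alpha> \<beta> \<sigma> \<delta> c1 c2 C0 C\<sigma> :: real and N :: nat
  defines "q \<equiv> 2 powr \<bar>1 - \<alpha>\<bar>"
  assumes c12: "0 < c1" "c1 \<le> c2" and \<sigma>: "0 \<le> \<sigma>" and m[measurable]: "m \<in> borel_measurable borel"
    and hyp: "\<And>\<theta>. \<theta> \<in> {0, \<sigma>} \<Longrightarrow> \<exists>C. \<forall>(c::'a) r \<Psi>. subdyadic c1 c2 \<alpha> c r \<and> normalised_bump N \<Psi> \<longrightarrow>
        hsob_finite \<theta> (\<lambda>\<xi>. m \<xi> * complex_of_real (adapted_bump \<Psi> c r \<xi>)) \<and>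
        infdist 0 (ball c r) powr (\<beta> + (1 - \<alpha>) * \<theta>) * measure lborel (ball c r) powr (- 1 / 2)
          * hsob_norm \<theta> (\<lambda>\<xi>. m \<xi> * complex_of_real (adapted_bump \<Psi> c r \<xi>)) \<le> C"
    and \<Psi>: "bumplike \<Psi>" and \<delta>: "0 < \<delta>" "\<delta> \<le> c2 / (2 * q)"
  obtains K where "K > 0" and "\<And>t R \<xi>0 \<zeta> b. 0 < t \<Longrightarrow> R = t powr (1 - \<alpha>) \<Longrightarrow> 1 / (2 * t) \<le> norm \<xi>0 \<Longrightarrow> norm \<xi>0 \<le> 2 / t \<Longrightarrow>
       1 \<le> norm \<xi>0 powr \<alpha> \<Longrightarrow> norm (\<xi>0 + \<zeta>) \<le> \<delta> / R \<Longrightarrow> b = (\<lambda>\<xi>. complex_of_real (\<Psi> ((R / \<delta>) *\<^sub>R \<xi>))) \<Longrightarrow>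
       integrable lborel (\<lambda>\<xi>. m \<xi> * b (\<xi> + \<zeta>)) \<and>
       (\<integral>\<^sup>+z. ennreal ((cmod (fourier (\<lambda>\<xi>. m \<xi> * b (\<xi> + \<zeta>)) z))\<^sup>2 * (1 + norm z / R) powr (2 * \<sigma>)) \<partial>lborel)
         \<le> ennreal (K * t powr (2 * \<beta>) / R ^ DIM('a))"
proof -
  have q: "1 \<le> q" unfolding q_def by (rule ge_one_powr_ge_zero) auto
  have c2: "0 < c2" using c12 by linarith
  \<comment> \<open>Bounds the dilation \<open>s = 2 * r * R / \<delta>\<close> between the window
    and the adapted bump, since \<open>r * R \<le> c2 * q\<close>.\<close>
  define Q where "Q = 2 * c2 * q / \<delta>"
  have "4 * q * q \<le> Q" using \<delta> q by (simp add: Q_def field_simps)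
  moreover have "1 \<le> q * q" using mult_mono[OF q q] q by simp
  ultimately have Q: "1 \<le> Q" by linarith
  obtain A where A: "A > 0" "\<And>vs x. set vs \<subseteq> Basis \<Longrightarrow> length vs \<le> N \<Longrightarrow> \<bar>iderv vs \<Psi> x\<bar> \<le> A"
    using bumplike_derivatives_bounded[OF \<Psi>] by blast
  define BB where "BB = Q ^ N * A"
  have BB: "BB > 0" using Q A by (simp add: BB_def)
  obtain C0 where C0: "\<And>(c::'a) r \<Psi>. subdyadic c1 c2 \<alpha> c r \<Longrightarrow> normalised_bump N \<Psi> \<Longrightarrow>
        hsob_finite 0 (\<lambda>\<xi>. m \<xi> * complex_of_real (adapted_bump \<Psi> c r \<xi>)) \<and>
        infdist 0 (ball c r) powr \<beta> * measure lborel (ball c r) powr (- 1 / 2)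
          * hsob_norm 0 (\<lambda>\<xi>. m \<xi> * complex_of_real (adapted_bump \<Psi> c r \<xi>)) \<le> C0"
    using hyp[of 0] by auto
  obtain C\<sigma> where C\<sigma>: "\<And>(c::'a) r \<Psi>. subdyadic c1 c2 \<alpha> c r \<Longrightarrow> normalised_bump N \<Psi> \<Longrightarrow>
        hsob_finite \<sigma> (\<lambda>\<xi>. m \<xi> * complex_of_real (adapted_bump \<Psi> c r \<xi>)) \<and>
        infdist 0 (ball c r) powr (\<beta> + (1 - \<alpha>) * \<sigma>) * measure lborel (ball c r) powr (- 1 / 2)
          * hsob_norm \<sigma> (\<lambda>\<xi>. m \<xi> * complex_of_real (adapted_bump \<Psi> c r \<xi>)) \<le> C\<sigma>"
    using hyp[of \<sigma>] by auto
  define p where "p = 2 powr \<bar>- 2 * (1 - \<alpha>) * \<sigma>\<bar>"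
  define v where "v = unit_ball_vol (real DIM('a))"
  have v: "0 < v" by (simp add: v_def)
  define D where "D = BB\<^sup>2 * (2 powr (2 * \<sigma>) * ((C0\<^sup>2 + C\<sigma>\<^sup>2 * p) * 2 powr \<bar>- 2 * \<beta>\<bar> * (v * (c2 * q) ^ DIM('a))))"
  have D: "0 \<le> D" using v c2 q by (simp add: D_def p_def)
  show ?thesis
  \<comment> \<open>\<open>D\<close> may be 0; adding 1 secures strict positivity.\<close>
  proof (rule that[of "D + 1"], use D in simp, intro conjI)
    fix t R :: real and \<xi>0 \<zeta> :: 'a and b :: "'a \<Rightarrow> complex"
    assume t: "0 < t" and R_def: "R = t powr (1 - \<alpha>)" and \<xi>0: "1 / (2 * t) \<le> norm \<xi>0" "norm \<xi>0 \<le> 2 / t" "1 \<le> norm \<xi>0 powr \<alpha>"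
      and \<zeta>: "norm (\<xi>0 + \<zeta>) \<le> \<delta> / R" and b_def: "b = (\<lambda>\<xi>. complex_of_real (\<Psi> ((R / \<delta>) *\<^sub>R \<xi>)))"
    have R: "R > 0" using t by (simp add: R_def)
    define \<rho> where "\<rho> = norm \<xi>0"
    have "0 < 1 / (2 * t)" using t by simp
    then have \<rho>: "0 < \<rho>" using \<xi>0(1) unfolding \<rho>_def by linarith
    have t\<rho>: "1/2 \<le> t * \<rho>" "t * \<rho> \<le> 2" using \<xi>0(1,2) t by (auto simp: \<rho>_def field_simps)
    define r where "r = c2 * \<rho> powr (1 - \<alpha>)"
    define c where "c = (1 + r / \<rho>) *\<^sub>R \<xi>0"
    have sub: "subdyadic c1 c2 \<alpha> c r" and dist: "infdist 0 (ball c r) = \<rho>" and c: "norm (c - \<xi>0) = r" and r: "0 < r"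
      using subdyadic_ball_touching[OF c12 \<rho>[unfolded \<rho>_def] \<xi>0(3)] unfolding c_def r_def \<rho>_def by auto
    have rR: "r * R = c2 * (t * \<rho>) powr (1 - \<alpha>)" unfolding r_def R_def using t \<rho> by (simp add: powr_mult)
    have rR_le: "r * R \<le> c2 * q"
      unfolding rR q_def using powr_half_two_bounds(1)[OF t\<rho>] c2 by (intro mult_left_mono) auto
    have rR_ge: "c2 / q \<le> r * R"
      unfolding rR q_def using powr_half_two_bounds(2)[OF t\<rho>, of "1 - \<alpha>"] c2
      by (simp add: powr_minus divide_inverse)
    have "2 * \<delta> \<le> c2 / q" using \<delta> q by (simp add: field_simps)
    then have rd: "2 * (\<delta> / R) \<le> r" using rR_ge R by (simp add: field_simps)
    \<comment> \<open>In the coordinate \<open>w\<close> of the adapted bump, given by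
      \<open>\<xi> = c + (2 * r) *\<^sub>R w\<close>, the argument of the window is
      \<open>s *\<^sub>R w + y\<close>.\<close>
    define s where "s = 2 * r * R / \<delta>"
    define y where "y = (R / \<delta>) *\<^sub>R (c + \<zeta>)"
    have s: "0 \<le> s" "s \<le> Q" using r R \<delta> rR_le by (auto simp: s_def Q_def divide_right_mono mult.assoc)
    \<comment> \<open>The window is centred at \<open>- \<zeta>\<close>, within
      \<open>r + \<delta> / R\<close> of \<open>c\<close>; adding its own radius and using
      \<open>2 * (\<delta> / R) \<le> r\<close> keeps it in the double, of radius
      \<open>2 * r\<close>.\<close>
    have inside: "norm w \<le> 1" if "norm (s *\<^sub>R w + y) \<le> 1" for w
    proof -
      have "s *\<^sub>R w + y = (R / \<delta>) *\<^sub>R ((2 * r) *\<^sub>R w + (c + \<zeta>))"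
        by (simp add: s_def y_def algebra_simps)
      then have "R / \<delta> * norm ((2 * r) *\<^sub>R w + (c + \<zeta>)) \<le> 1"
        using that R \<delta> by simp
      then have 1: "norm ((2 * r) *\<^sub>R w + (c + \<zeta>)) \<le> \<delta> / R"
        using R \<delta> by (simp add: field_simps)
      have 2: "norm (c + \<zeta>) \<le> r + \<delta> / R"
        using norm_triangle_ineq[of "c - \<xi>0" "\<xi>0 + \<zeta>"] c \<zeta> by simp
      have "norm ((2 * r) *\<^sub>R w) \<le> norm ((2 * r) *\<^sub>R w + (c + \<zeta>)) + norm (c + \<zeta>)"
        using norm_triangle_ineq4[of "(2 * r) *\<^sub>R w + (c + \<zeta>)" "c + \<zeta>"] by simp
      also have "\<dots> \<le> 2 * r" using 1 2 rd by linarith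
      finally show ?thesis using r by simp
    qed
    define \<Psi>' where "\<Psi>' w = 1 / BB * \<Psi> (s *\<^sub>R w + y)" for w
    have bump: "normalised_bump N \<Psi>'"
      unfolding \<Psi>'_def BB_def
      by (rule normalised_bump_affine[OF smooth_fun_bumplike[OF \<Psi>] _ A s Q inside])
         (use bumplike_outside[OF \<Psi>] in auto)
    define g where "g = (\<lambda>\<xi>. m \<xi> * complex_of_real (adapted_bump \<Psi>' c r \<xi>))"
    have mb: "m \<xi> * b (\<xi> + \<zeta>) = complex_of_real BB * g \<xi>" for \<xi>
    proof -
      have "s *\<^sub>R (1 / (2 * r)) *\<^sub>R (\<xi> - c) + y = (R / \<delta>) *\<^sub>R (\<xi> + \<zeta>)"
        using r by (simp add: s_def y_def algebra_simps)
      then have "\<Psi> ((R / \<delta>) *\<^sub>R (\<xi> + \<zeta>)) = BB * adapted_bump \<Psi>' c r \<xi>"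
        using BB by (simp add: adapted_bump_def \<Psi>'_def)
      then show ?thesis by (simp add: b_def g_def)
    qed
    note bounds = C0[OF sub bump, folded g_def, unfolded dist] C\<sigma>[OF sub bump, folded g_def, unfolded dist]
    have gi: "integrable lborel g" using bounds by (simp add: hsob_finite_def)
    then show "integrable lborel (\<lambda>\<xi>. m \<xi> * b (\<xi> + \<zeta>))" unfolding mb by (rule integrable_mult_right)
    define vol where "vol = measure lborel (ball c r)"
    have vol_eq: "vol = v * r ^ DIM('a)" unfolding vol_def v_def using r by (intro content_ball) auto
    have vol: "0 < vol" using v r by (simp add: vol_eq)
    have "r \<le> c2 * q / R" using rR_le R by (simp add: field_simps)
    then have "r ^ DIM('a) \<le> (c2 * q / R) ^ DIM('a)" using r by (intro power_mono) auto
    then have vol_le: "vol \<le> v * (c2 * q) ^ DIM('a) / R ^ DIM('a)"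
      unfolding vol_eq times_divide_eq_right[symmetric] power_divide[symmetric]
      using v by (intro mult_left_mono) auto
    have \<rho>\<beta>: "\<rho> powr (- 2 * \<beta>) \<le> 2 powr \<bar>- 2 * \<beta>\<bar> * t powr (2 * \<beta>)"
    proof -
      have "\<rho> powr (- 2 * \<beta>) = (t * \<rho>) powr (- 2 * \<beta>) * t powr (2 * \<beta>)"
        using t \<rho> by (simp add: powr_mult powr_minus field_simps)
      also have "\<dots> \<le> 2 powr \<bar>- 2 * \<beta>\<bar> * t powr (2 * \<beta>)"
        by (intro mult_right_mono powr_half_two_bounds(1)[OF t\<rho>]) simp
      finally show ?thesis .
    qed
    have h_nonneg: "0 \<le> hsob_norm \<theta> g" for \<theta>
      by (simp add: hsob_norm_def integral_nonneg_AE)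
    have h0: "(hsob_norm 0 g)\<^sup>2 \<le> C0\<^sup>2 * \<rho> powr (- 2 * \<beta>) * vol"
      using bounds(1) by (intro hsob_bound_imp_square[OF \<rho> vol _ h_nonneg]) (simp add: vol_def)
    \<comment> \<open>The factors \<open>R powr (- 2 * \<sigma>)\<close> and
      \<open>\<rho> powr (- 2 * (1 - \<alpha>) * \<sigma>)\<close> combine into a power of
      \<open>t * \<rho>\<close>, which is at most \<open>p\<close>.\<close>
    have h\<sigma>: "R powr (- 2 * \<sigma>) * (hsob_norm \<sigma> g)\<^sup>2 \<le> C\<sigma>\<^sup>2 * p * \<rho> powr (- 2 * \<beta>) * vol"
    proof -
      have "(hsob_norm \<sigma> g)\<^sup>2 \<le> C\<sigma>\<^sup>2 * \<rho> powr (- 2 * (\<beta> + (1 - \<alpha>) * \<sigma>)) * vol"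
        using bounds(2) by (intro hsob_bound_imp_square[OF \<rho> vol _ h_nonneg]) (simp add: vol_def)
      then have "R powr (- 2 * \<sigma>) * (hsob_norm \<sigma> g)\<^sup>2
          \<le> R powr (- 2 * \<sigma>) * (C\<sigma>\<^sup>2 * \<rho> powr (- 2 * (\<beta> + (1 - \<alpha>) * \<sigma>)) * vol)"
        by (rule mult_left_mono) simp
      also have R_powr: "R powr (- 2 * \<sigma>) = t powr (- 2 * (1 - \<alpha>) * \<sigma>)"
        unfolding R_def powr_powr by (rule arg_cong[where f = "(powr) t"]) (simp add: algebra_simps)
      also have "\<rho> powr (- 2 * (\<beta> + (1 - \<alpha>) * \<sigma>)) = \<rho> powr (- 2 * \<beta>) * \<rho> powr (- 2 * (1 - \<alpha>) * \<sigma>)"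
        unfolding powr_add[symmetric] by (rule arg_cong[where f = "(powr) \<rho>"]) (simp add: algebra_simps)
      also have "t powr (- 2 * (1 - \<alpha>) * \<sigma>) * (C\<sigma>\<^sup>2 * (\<rho> powr (- 2 * \<beta>) * \<rho> powr (- 2 * (1 - \<alpha>) * \<sigma>)) * vol)
         = C\<sigma>\<^sup>2 * (t * \<rho>) powr (- 2 * (1 - \<alpha>) * \<sigma>) * \<rho> powr (- 2 * \<beta>) * vol"
        using t \<rho> by (simp add: powr_mult mult_ac)
      also have "\<dots> \<le> C\<sigma>\<^sup>2 * p * \<rho> powr (- 2 * \<beta>) * vol"
        unfolding p_def using vol by (intro mult_right_mono mult_left_mono powr_half_two_bounds(1)[OF t\<rho>]) auto
      finally show ?thesis unfolding R_powr .
    qed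
    have sum_le: "(hsob_norm 0 g)\<^sup>2 + R powr (- 2 * \<sigma>) * (hsob_norm \<sigma> g)\<^sup>2
       \<le> (C0\<^sup>2 + C\<sigma>\<^sup>2 * p) * 2 powr \<bar>- 2 * \<beta>\<bar> * (v * (c2 * q) ^ DIM('a)) * (t powr (2 * \<beta>) / R ^ DIM('a))"
    proof -
      have "(hsob_norm 0 g)\<^sup>2 + R powr (- 2 * \<sigma>) * (hsob_norm \<sigma> g)\<^sup>2 \<le> (C0\<^sup>2 + C\<sigma>\<^sup>2 * p) * (\<rho> powr (- 2 * \<beta>) * vol)"
        using h0 h\<sigma> by (simp add: algebra_simps)
      also have "\<dots> \<le> (C0\<^sup>2 + C\<sigma>\<^sup>2 * p) * ((2 powr \<bar>- 2 * \<beta>\<bar> * t powr (2 * \<beta>)) * (v * (c2 * q) ^ DIM('a) / R ^ DIM('a)))"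
        using vol by (intro mult_left_mono mult_mono \<rho>\<beta> vol_le) (auto simp: p_def)
      finally show ?thesis by (simp add: mult_ac)
    qed
    have [measurable]: "g \<in> borel_measurable borel" using gi borel_measurable_integrable by auto
    have "(\<integral>\<^sup>+z. ennreal ((cmod (fourier (\<lambda>\<xi>. m \<xi> * b (\<xi> + \<zeta>)) z))\<^sup>2 * (1 + norm z / R) powr (2 * \<sigma>)) \<partial>lborel)
       = (\<integral>\<^sup>+z. ennreal (BB\<^sup>2) * ennreal ((cmod (fourier g z))\<^sup>2 * (1 + norm z / R) powr (2 * \<sigma>)) \<partial>lborel)"
      unfolding mb fourier_cmult using BB
      by (intro nn_integral_cong) (simp add: norm_mult power_mult_distrib mult.assoc flip: ennreal_mult)
    also have "\<dots> = ennreal (BB\<^sup>2) * (\<integral>\<^sup>+z. ennreal ((cmod (fourier g z))\<^sup>2 * (1 + norm z / R) powr (2 * \<sigma>)) \<partial>lborel)"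
      by (rule nn_integral_cmult) measurable
    also have "\<dots> \<le> ennreal (BB\<^sup>2) * ennreal (2 powr (2 * \<sigma>) * ((hsob_norm 0 g)\<^sup>2 + R powr (- 2 * \<sigma>) * (hsob_norm \<sigma> g)\<^sup>2))"
      using bounds by (intro mult_left_mono nn_integral_fourier_weighted_le \<sigma> R) auto
    also have "\<dots> = ennreal (BB\<^sup>2 * (2 powr (2 * \<sigma>) * ((hsob_norm 0 g)\<^sup>2 + R powr (- 2 * \<sigma>) * (hsob_norm \<sigma> g)\<^sup>2)))"
      by (simp add: ennreal_mult)
    also have "\<dots> \<le> ennreal (D * (t powr (2 * \<beta>) / R ^ DIM('a)))"
    proof (rule ennreal_leI)
      have "BB\<^sup>2 * (2 powr (2 * \<sigma>) * ((hsob_norm 0 g)\<^sup>2 + R powr (- 2 * \<sigma>) * (hsob_norm \<sigma> g)\<^sup>2))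
         \<le> BB\<^sup>2 * (2 powr (2 * \<sigma>) * ((C0\<^sup>2 + C\<sigma>\<^sup>2 * p) * 2 powr \<bar>- 2 * \<beta>\<bar> * (v * (c2 * q) ^ DIM('a)) * (t powr (2 * \<beta>) / R ^ DIM('a))))"
        by (intro mult_left_mono sum_le) auto
      then show "BB\<^sup>2 * (2 powr (2 * \<sigma>) * ((hsob_norm 0 g)\<^sup>2 + R powr (- 2 * \<sigma>) * (hsob_norm \<sigma> g)\<^sup>2))
         \<le> D * (t powr (2 * \<beta>) / R ^ DIM('a))"
        unfolding D_def by (simp only: mult.assoc)
    qed
    also have "\<dots> \<le> ennreal ((D + 1) * t powr (2 * \<beta>) / R ^ DIM('a))"
      using R by (intro ennreal_leI) (simp add: field_simps)
    finally show "(\<integral>\<^sup>+z. ennreal ((cmod (fourier (\<lambda>\<xi>. m \<xi> * b (\<xi> + \<zeta>)) z))\<^sup>2 * (1 + norm z / R) powr (2 * \<sigma>)) \<partial>lborel)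
         \<le> ennreal ((D + 1) * t powr (2 * \<beta>) / R ^ DIM('a))" .
  qed
qed

section \<open>The choice of the bump and the lower bound for its squared window\<close>

lemma Re_echar: "Re (echar r) = cos (2 * pi * r)"
  by (simp add: echar_def Re_exp)

lemma integrable_bumplike_square:
  assumes "bumplike f"
  shows "integrable lborel (\<lambda>x. (f x)\<^sup>2)"
proof -
  obtain B where B: "\<And>x. \<bar>f x\<bar> \<le> B" using bumplike_bounded[OF assms] by blast
  have [measurable]: "f \<in> borel_measurable borel" by (rule borel_measurable_bumplike[OF assms])
  show ?thesis
  proof (rule integrable_bounded_support)
    show "norm ((f x)\<^sup>2) \<le> B\<^sup>2" for x using power_mono[OF B abs_ge_zero, of x 2] by simp
    show "(f x)\<^sup>2 = 0" if "norm x > 1" for x using bumplike_outside[OF assms, of x] that by simp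
  qed measurable
qed

text \<open>On the support of the window \<open>norm \<xi> \<le> \<delta> / R\<close>, so
  \<open>\<bar>\<xi> \<bullet> u\<bar> \<le> 1 / 6\<close>: the phase stays within
  \<open>pi / 3\<close>, its cosine is at least 1/2, and no cancellation occurs. This is the origin
  of the bound \<open>1 / 6\<close> on \<open>\<delta>\<close>.\<close>

lemma fourier_square_window_lower:
  fixes \<Psi> :: "'a::euclidean_space \<Rightarrow> real"
  assumes \<Psi>: "bumplike \<Psi>" and \<delta>: "0 < \<delta>" "\<delta> \<le> 1 / 6" and R: "0 < R" and u: "norm u \<le> R"
  shows "(LINT x|lborel. (\<Psi> x)\<^sup>2) / 2 * (\<delta> / R) ^ DIM('a)
    \<le> cmod (fourier (\<lambda>\<xi>. (complex_of_real (\<Psi> ((R / \<delta>) *\<^sub>R \<xi>)))\<^sup>2) u)"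
proof -
  define a where "a = R / \<delta>"
  have a: "0 < a" using R \<delta> by (simp add: a_def)
  have [measurable]: "\<Psi> \<in> borel_measurable borel" by (rule borel_measurable_bumplike[OF \<Psi>])
  note sq = integrable_bumplike_square[OF \<Psi>]
  have sqa: "integrable lborel (\<lambda>\<xi>. (\<Psi> (a *\<^sub>R \<xi>))\<^sup>2)"
    using integrable_lborel_affine_iff[of "\<lambda>x. (\<Psi> x)\<^sup>2" a 0] sq a by simp
  then have "integrable lborel (\<lambda>\<xi>. complex_of_real ((\<Psi> (a *\<^sub>R \<xi>))\<^sup>2))" by (rule integrable_of_real)
  then have int: "integrable lborel (\<lambda>\<xi>. complex_of_real ((\<Psi> (a *\<^sub>R \<xi>))\<^sup>2) * echar (- (\<xi> \<bullet> u)))"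
    by (rule integrable_mult_echar) simp
  have "(LINT x|lborel. (\<Psi> x)\<^sup>2) = a ^ DIM('a) * (LINT \<xi>|lborel. (\<Psi> (a *\<^sub>R \<xi>))\<^sup>2)"
    using integral_lborel_affine[of "\<lambda>x. (\<Psi> x)\<^sup>2" a 0] a by simp
  then have "(LINT x|lborel. (\<Psi> x)\<^sup>2) / 2 * (\<delta> / R) ^ DIM('a) = (LINT \<xi>|lborel. (\<Psi> (a *\<^sub>R \<xi>))\<^sup>2 / 2)"
    using R \<delta> by (simp add: a_def power_divide)
  also have "\<dots> \<le> (LINT \<xi>|lborel. Re (complex_of_real ((\<Psi> (a *\<^sub>R \<xi>))\<^sup>2) * echar (- (\<xi> \<bullet> u))))"
  proof (rule integral_mono)
    fix \<xi>
    show "(\<Psi> (a *\<^sub>R \<xi>))\<^sup>2 / 2 \<le> Re (complex_of_real ((\<Psi> (a *\<^sub>R \<xi>))\<^sup>2) * echar (- (\<xi> \<bullet> u)))"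
    proof (cases "norm (a *\<^sub>R \<xi>) \<le> 1")
      case True
      have "norm \<xi> \<le> \<delta> / R" using True a R \<delta> by (simp add: a_def field_simps)
      then have "norm \<xi> * norm u \<le> \<delta> / R * R" using u R \<delta> by (intro mult_mono) auto
      then have "\<bar>\<xi> \<bullet> u\<bar> \<le> 1 / 6" using Cauchy_Schwarz_ineq2[of \<xi> u] \<delta> R by simp
      then have "\<bar>2 * pi * (\<xi> \<bullet> u)\<bar> \<le> pi / 3" by (simp add: abs_mult)
      then have "cos (pi / 3) \<le> cos \<bar>2 * pi * (\<xi> \<bullet> u)\<bar>" by (intro cos_monotone_0_pi_le) auto
      then have "1 / 2 \<le> cos (2 * pi * (\<xi> \<bullet> u))" by (simp add: cos_60)
      then have "(\<Psi> (a *\<^sub>R \<xi>))\<^sup>2 * (1 / 2) \<le> (\<Psi> (a *\<^sub>R \<xi>))\<^sup>2 * cos (2 * pi * (\<xi> \<bullet> u))"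
        by (rule mult_left_mono) simp
      then show ?thesis by (simp add: Re_echar)
    next
      case False
      then show ?thesis using bumplike_outside[OF \<Psi>, of "a *\<^sub>R \<xi>"] by simp
    qed
  qed (use sqa integrable_Re[OF int] in auto)
  also have "\<dots> = Re (fourier (\<lambda>\<xi>. complex_of_real ((\<Psi> (a *\<^sub>R \<xi>))\<^sup>2)) u)"
    unfolding fourier_echar by (rule integral_Re[OF int])
  also have "\<dots> \<le> cmod (fourier (\<lambda>\<xi>. complex_of_real ((\<Psi> (a *\<^sub>R \<xi>))\<^sup>2)) u)"
    by (rule complex_Re_le_cmod)
  finally show ?thesis by (simp add: a_def)
qed

text \<open>Evenness makes the twice transformed window equal to itself instead of its reflection;
  the positive square integral makes the lower bound \<open>\<kappa>\<close> positive.\<close>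

lemma bumplike_even_nontrivial:
  obtains \<Psi> :: "'a::euclidean_space \<Rightarrow> real"
  where "bumplike \<Psi>" "\<And>x. \<Psi> (- x) = \<Psi> x" "0 < (LINT x|lborel. (\<Psi> x)\<^sup>2)"
proof -
  define \<Psi> :: "'a \<Rightarrow> real" where "\<Psi> x = flat 1 (1 - x \<bullet> x)" for x
  have \<Psi>: "bumplike \<Psi>" unfolding \<Psi>_def by (rule bumplike_flat)
  note sq = integrable_bumplike_square[OF \<Psi>]
  \<comment> \<open>On the ball of radius 1/2 one has \<open>1/2 \<le> 1 - x \<bullet> x\<close>,
    whence the value \<open>exp (- 2)\<close>.\<close>
  have le: "(exp (- 2))\<^sup>2 * indicator (ball 0 (1/2)) x \<le> (\<Psi> x)\<^sup>2" for x
  proof (cases "x \<in> ball 0 (1/2)")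
    case True
    then have "(norm x)\<^sup>2 \<le> (1/2)\<^sup>2" by (intro power_mono) auto
    then have s: "1/2 \<le> 1 - x \<bullet> x" by (simp add: power2_norm_eq_inner[symmetric] power2_eq_square)
    then have "1 / (1 - x \<bullet> x) \<le> 2" by (simp add: field_simps)
    then have "exp (- 2) \<le> \<Psi> x" using s by (simp add: \<Psi>_def flat_def)
    then show ?thesis using True by (simp add: power_mono)
  qed simp
  have "0 < (exp (- 2))\<^sup>2 * measure lborel (ball (0::'a) (1/2))"
    using content_ball_pos[of "1/2" "0::'a"] by simp
  also have "\<dots> = (LINT x|lborel. (exp (- 2))\<^sup>2 * indicator (ball (0::'a) (1/2)) x)" by simp
  also have "\<dots> \<le> (LINT x|lborel. (\<Psi> x)\<^sup>2)"
    using emeasure_lborel_ball_finite[of "0::'a" "1/2"]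
    by (intro integral_mono sq le integrable_mult_right integrable_real_indicator) auto
  finally show ?thesis using that \<Psi> by (simp add: \<Psi>_def)
qed

section \<open>The estimate at a fixed scale\<close>

lemma multiplier_conv_dil_echar:
  "multiplier_conv_dil m f \<phi> t y =
     (LINT \<xi>|lborel. m \<xi> * (fourier f \<xi> * fourier \<phi> (t *\<^sub>R \<xi>)) * echar (y \<bullet> \<xi>))"
  unfolding multiplier_conv_dil_def echar_def by (simp add: mult.assoc)

lemma dil_integrable_fourier:
  fixes \<phi> :: "'a::euclidean_space \<Rightarrow> complex"
  assumes \<phi>: "integrable lborel \<phi>" and t: "0 < t"
  shows "integrable lborel (dil \<phi> t)" "fourier (dil \<phi> t) \<xi> = fourier \<phi> (t *\<^sub>R \<xi>)"
proof -
  have [measurable]: "\<phi> \<in> borel_measurable borel" using \<phi> borel_measurable_integrable by auto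
  show "integrable lborel (dil \<phi> t)"
    unfolding dil_def using integrable_lborel_affine_iff[of \<phi> "1 / t" 0] \<phi> t by auto
  have "t powr (- real DIM('a)) * (1 / \<bar>1 / t\<bar> ^ DIM('a)) = 1"
    using t by (simp add: powr_minus powr_realpow power_one_over)
  then have "complex_of_real (t powr (- real DIM('a))) * complex_of_real (1 / \<bar>1 / t\<bar> ^ DIM('a)) = 1"
    by (metis of_real_1 of_real_mult)
  moreover have "fourier (\<lambda>x. \<phi> ((1 / t) *\<^sub>R x)) \<xi> = complex_of_real (1 / \<bar>1 / t\<bar> ^ DIM('a)) * fourier \<phi> (t *\<^sub>R \<xi>)"
    using fourier_scale[of \<phi> "1 / t" \<xi>] t by simp
  ultimately show "fourier (dil \<phi> t) \<xi> = fourier \<phi> (t *\<^sub>R \<xi>)"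
    unfolding dil_def fourier_cmult by (simp only: mult.assoc[symmetric] mult_1_left)
qed

lemma fourier_conv_dil:
  assumes "integrable lborel f" "integrable lborel \<phi>" "0 < t"
  shows "integrable lborel (conv_dil f \<phi> t)" "fourier (conv_dil f \<phi> t) \<xi> = fourier f \<xi> * fourier \<phi> (t *\<^sub>R \<xi>)"
  using integrable_convolution(2)[OF assms(1) dil_integrable_fourier(1)[OF assms(2,3)]]
    fourier_convolution[OF assms(1) dil_integrable_fourier(1)[OF assms(2,3)]]
    dil_integrable_fourier(2)[OF assms(2,3)]
  by (simp_all add: conv_dil_def[abs_def])

text \<open>Peetre's inequality: the triangle inequality with a nonnegative product term added. It
  lets one weight serve both as \<open>W\<close> and as \<open>W'\<close> in
  \<open>local_multiplier_estimate\<close>.\<close>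

lemma one_plus_norm_powr_submult:
  fixes u v :: "'a::real_normed_vector"
  assumes "0 < R" "0 \<le> p"
  shows "(1 + norm v / R) powr p \<le> (1 + norm (u + v) / R) powr p * (1 + norm u / R) powr p"
proof -
  have "norm v \<le> norm (u + v) + norm u" using norm_triangle_ineq4[of "u + v" u] by simp
  then have "norm v / R \<le> norm (u + v) / R + norm u / R"
    using assms(1) by (simp add: divide_right_mono flip: add_divide_distrib)
  moreover have "0 \<le> norm (u + v) / R * (norm u / R)" using assms(1) by simp
  moreover have "(1 + norm (u + v) / R) * (1 + norm u / R)
      = 1 + norm (u + v) / R + norm u / R + norm (u + v) / R * (norm u / R)" by algebra
  ultimately have "1 + norm v / R \<le> (1 + norm (u + v) / R) * (1 + norm u / R)"
    by linarith
  then have "(1 + norm v / R) powr p \<le> ((1 + norm (u + v) / R) * (1 + norm u / R)) powr p"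
    using assms by (intro powr_mono2) auto
  then show ?thesis by (simp add: powr_mult)
qed

text \<open>Rescaling by \<open>a = R / \<delta>\<close> contributes \<open>a ^ DIM('a)\<close> from
  the measure and \<open>1 / a ^ (2 * DIM('a))\<close> from the squared transform; the weight
  becomes a power of \<open>1 + norm w / \<delta>\<close>, at most
  \<open>(1 + norm w) / \<delta>\<close> because \<open>\<delta> \<le> 1\<close>.\<close>

lemma nn_integral_fourier_window_weighted:
  fixes \<Psi> :: "'a::euclidean_space \<Rightarrow> real"
  assumes \<Psi>: "bumplike \<Psi>" and "0 < R" "0 < \<delta>" "\<delta> \<le> 1" "0 \<le> \<tau>"
  shows "(\<integral>\<^sup>+u. ennreal ((cmod (fourier (\<lambda>\<xi>. complex_of_real (\<Psi> ((R / \<delta>) *\<^sub>R \<xi>))) u))\<^sup>2 * (1 + norm u / R) powr \<tau>) \<partial>lborel)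
    \<le> ennreal ((\<delta> / R) ^ DIM('a) * \<delta> powr (- \<tau>)) *
      (\<integral>\<^sup>+u. ennreal ((cmod (fourier (\<lambda>\<xi>. complex_of_real (\<Psi> \<xi>)) u))\<^sup>2 * (1 + norm u) powr \<tau>) \<partial>lborel)"
proof -
  define a where "a = R / \<delta>"
  have a: "0 < a" using assms by (simp add: a_def)
  have [measurable]: "\<Psi> \<in> borel_measurable borel" by (rule borel_measurable_bumplike[OF \<Psi>])
  let ?\<Phi> = "fourier (\<lambda>\<xi>. complex_of_real (\<Psi> \<xi>))"
  have \<Phi>a: "fourier (\<lambda>\<xi>. complex_of_real (\<Psi> (a *\<^sub>R \<xi>))) u = complex_of_real (1 / a ^ DIM('a)) * ?\<Phi> ((1 / a) *\<^sub>R u)" for u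
    using fourier_scale[of "\<lambda>\<xi>. complex_of_real (\<Psi> \<xi>)" a u] a by simp
  have "(\<integral>\<^sup>+u. ennreal ((cmod (fourier (\<lambda>\<xi>. complex_of_real (\<Psi> (a *\<^sub>R \<xi>))) u))\<^sup>2 * (1 + norm u / R) powr \<tau>) \<partial>lborel)
    = ennreal (\<bar>a\<bar> ^ DIM('a)) * (\<integral>\<^sup>+w. ennreal ((cmod (fourier (\<lambda>\<xi>. complex_of_real (\<Psi> (a *\<^sub>R \<xi>))) (0 + a *\<^sub>R w)))\<^sup>2
        * (1 + norm (0 + a *\<^sub>R w) / R) powr \<tau>) \<partial>lborel)"
    using a by (intro nn_integral_lborel_affine[where f = "\<lambda>u. ennreal ((cmod (fourier (\<lambda>\<xi>. complex_of_real (\<Psi> (a *\<^sub>R \<xi>))) u))\<^sup>2 * (1 + norm u / R) powr \<tau>)"]) auto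
  also have "\<dots> \<le> ennreal (a ^ DIM('a)) * (\<integral>\<^sup>+w. ennreal ((1 / a ^ DIM('a))\<^sup>2 * \<delta> powr (- \<tau>)) *
       ennreal ((cmod (?\<Phi> w))\<^sup>2 * (1 + norm w) powr \<tau>) \<partial>lborel)"
  proof -
    have "(cmod (fourier (\<lambda>\<xi>. complex_of_real (\<Psi> (a *\<^sub>R \<xi>))) (a *\<^sub>R w)))\<^sup>2 * (1 + norm (a *\<^sub>R w) / R) powr \<tau>
      \<le> ((1 / a ^ DIM('a))\<^sup>2 * \<delta> powr (- \<tau>)) * ((cmod (?\<Phi> w))\<^sup>2 * (1 + norm w) powr \<tau>)" for w
    proof -
      have "norm (a *\<^sub>R w) / R = norm w / \<delta>" using assms by (simp add: a_def)
      moreover have "1 + norm w / \<delta> \<le> (1 + norm w) * (1 / \<delta>)"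
        using assms by (simp add: field_simps)
      ultimately have "(1 + norm (a *\<^sub>R w) / R) powr \<tau> \<le> ((1 + norm w) * (1 / \<delta>)) powr \<tau>"
        using assms by (intro powr_mono2) auto
      also have "\<dots> = (1 + norm w) powr \<tau> * \<delta> powr (- \<tau>)"
        using assms by (subst powr_mult) (simp add: powr_minus powr_divide divide_inverse inverse_powr)
      finally have "(1 / a ^ DIM('a))\<^sup>2 * (cmod (?\<Phi> w))\<^sup>2 * (1 + norm (a *\<^sub>R w) / R) powr \<tau>
         \<le> (1 / a ^ DIM('a))\<^sup>2 * (cmod (?\<Phi> w))\<^sup>2 * ((1 + norm w) powr \<tau> * \<delta> powr (- \<tau>))"
        by (rule mult_left_mono) simp
      moreover have "(cmod (fourier (\<lambda>\<xi>. complex_of_real (\<Psi> (a *\<^sub>R \<xi>))) (a *\<^sub>R w)))\<^sup>2 = (1 / a ^ DIM('a))\<^sup>2 * (cmod (?\<Phi> w))\<^sup>2"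
        unfolding \<Phi>a using a by (simp add: norm_mult norm_divide norm_power power_mult_distrib power_divide)
      ultimately show ?thesis by (simp add: mult_ac)
    qed
    then show ?thesis using a
      by (intro mult_mono nn_integral_mono) (auto simp: ennreal_leI simp flip: ennreal_mult)
  qed
  also have "\<dots> = ennreal (a ^ DIM('a)) * (ennreal ((1 / a ^ DIM('a))\<^sup>2 * \<delta> powr (- \<tau>)) *
      (\<integral>\<^sup>+w. ennreal ((cmod (?\<Phi> w))\<^sup>2 * (1 + norm w) powr \<tau>) \<partial>lborel))"
    by (subst nn_integral_cmult) auto
  also have "\<dots> = ennreal (a ^ DIM('a) * ((1 / a ^ DIM('a))\<^sup>2 * \<delta> powr (- \<tau>))) *
      (\<integral>\<^sup>+w. ennreal ((cmod (?\<Phi> w))\<^sup>2 * (1 + norm w) powr \<tau>) \<partial>lborel)"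
    using a by (simp add: ennreal_mult mult.assoc)
  also have "a ^ DIM('a) * ((1 / a ^ DIM('a))\<^sup>2 * \<delta> powr (- \<tau>)) = (\<delta> / R) ^ DIM('a) * \<delta> powr (- \<tau>)"
    using a assms by (simp add: a_def power2_eq_square power_divide)
  finally show ?thesis by (simp add: a_def)
qed

text \<open>An instance of \<open>local_multiplier_estimate\<close> with weight
  \<open>(1 + norm z / R) powr (2 * \<sigma>)\<close> and \<open>S = cball 0 R\<close>. The point is
  that \<open>C\<close> is chosen before \<open>f\<close>, \<open>t\<close> and
  \<open>x\<close>.\<close>

lemma estimate_at_scale:
  fixes \<alpha> \<beta> \<sigma> c1 c2 :: real and m \<phi> :: "'a::euclidean_space \<Rightarrow> complex"
  assumes c12: "0 < c1" "c1 \<le> c2" and \<sigma>: "0 \<le> \<sigma>" and m[measurable]: "m \<in> borel_measurable borel"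
    and \<phi>: "integrable lborel \<phi>" "\<And>\<xi>. fourier \<phi> \<xi> \<noteq> 0 \<Longrightarrow>
        (if \<alpha> \<ge> 0 then 1 \<le> norm \<xi> \<and> norm \<xi> \<le> 2 else 1/2 \<le> norm \<xi> \<and> norm \<xi> \<le> 1)"
    and hyp: "\<And>\<theta>. \<theta> \<in> {0, \<sigma>} \<Longrightarrow> \<exists>C. \<forall>(c::'a) r \<Psi>. subdyadic c1 c2 \<alpha> c r \<and> normalised_bump N \<Psi> \<longrightarrow>
        hsob_finite \<theta> (\<lambda>\<xi>. m \<xi> * complex_of_real (adapted_bump \<Psi> c r \<xi>)) \<and>
        infdist 0 (ball c r) powr (\<beta> + (1 - \<alpha>) * \<theta>) * measure lborel (ball c r) powr (- 1 / 2)
          * hsob_norm \<theta> (\<lambda>\<xi>. m \<xi> * complex_of_real (adapted_bump \<Psi> c r \<xi>)) \<le> C"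
  obtains C where "C > 0" and "\<And>f t R x. integrable lborel f \<Longrightarrow> 0 < t \<Longrightarrow> t powr \<alpha> \<le> 1 \<Longrightarrow> R = t powr (1 - \<alpha>) \<Longrightarrow>
      (\<integral>\<^sup>+y. indicator (cball x R) y * ennreal ((cmod (multiplier_conv_dil m f \<phi> t y))\<^sup>2) \<partial>lborel)
      \<le> ennreal (C * t powr (2 * \<beta>)) * (\<integral>\<^sup>+y. ennreal ((cmod (conv_dil f \<phi> t y))\<^sup>2 * (1 + norm (x - y) / R) powr (- 2 * \<sigma>)) \<partial>lborel)"
proof -
  define q where "q = 2 powr \<bar>1 - \<alpha>\<bar>"
  have q: "1 \<le> q" unfolding q_def by (rule ge_one_powr_ge_zero) auto
  \<comment> \<open>The first bound keeps the transform of the squared window away from 0, the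
    second places the window inside the doubled ball.\<close>
  define \<delta> where "\<delta> = min (1 / 6) (c2 / (2 * q))"
  have \<delta>: "0 < \<delta>" "\<delta> \<le> 1 / 6" "\<delta> \<le> c2 / (2 * q)" using c12 q by (auto simp: \<delta>_def)
  obtain \<Psi> :: "'a \<Rightarrow> real" where \<Psi>: "bumplike \<Psi>" "\<And>x. \<Psi> (- x) = \<Psi> x" "0 < (LINT x|lborel. (\<Psi> x)\<^sup>2)"
    by (rule bumplike_even_nontrivial) blast
  obtain K where K: "K > 0" and local_bound: "\<And>t R \<xi>0 \<zeta> b. 0 < t \<Longrightarrow> R = t powr (1 - \<alpha>) \<Longrightarrow> 1 / (2 * t) \<le> norm \<xi>0 \<Longrightarrow> norm \<xi>0 \<le> 2 / t \<Longrightarrow>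
       1 \<le> norm \<xi>0 powr \<alpha> \<Longrightarrow> norm (\<xi>0 + \<zeta>) \<le> \<delta> / R \<Longrightarrow> b = (\<lambda>\<xi>. complex_of_real (\<Psi> ((R / \<delta>) *\<^sub>R \<xi>))) \<Longrightarrow>
       integrable lborel (\<lambda>\<xi>. m \<xi> * b (\<xi> + \<zeta>)) \<and>
       (\<integral>\<^sup>+z. ennreal ((cmod (fourier (\<lambda>\<xi>. m \<xi> * b (\<xi> + \<zeta>)) z))\<^sup>2 * (1 + norm z / R) powr (2 * \<sigma>)) \<partial>lborel)
         \<le> ennreal (K * t powr (2 * \<beta>) / R ^ DIM('a))"
    using window_local_bound[OF c12 \<sigma> m hyp \<Psi>(1) \<delta>(1) \<delta>(3)[unfolded q_def]] by blast
  define I where "I = (LINT x|lborel. (\<Psi> x)\<^sup>2) / 2"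
  have I: "I > 0" using \<Psi>(3) by (simp add: I_def)
  define J where "J = (\<integral>\<^sup>+u. ennreal ((cmod (fourier (\<lambda>\<xi>. complex_of_real (\<Psi> \<xi>)) u))\<^sup>2 * (1 + norm u) powr (2 * \<sigma>)) \<partial>lborel)"
  have "J < \<infinity>" unfolding J_def by (rule nn_integral_fourier_bumplike_weighted[OF \<Psi>(1)]) (use \<sigma> in simp)
  then obtain j where j: "J = ennreal j" "0 \<le> j" by (cases J) auto
  \<comment> \<open>\<open>K\<close> comes from the local bound, \<open>j\<close> from the transform
    of the bump, and the denominator from \<open>\<kappa>\<^sup>2\<close>; the summand 1 makes
    \<open>C\<close> positive.\<close>
  define C where "C = K * \<delta> powr (- 2 * \<sigma>) * j / (I\<^sup>2 * \<delta> ^ DIM('a)) + 1"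
  have C0: "0 \<le> K * \<delta> powr (- 2 * \<sigma>) * j / (I\<^sup>2 * \<delta> ^ DIM('a))" using K j \<delta> by simp
  show ?thesis
  proof (rule that[of C])
    show "C > 0" using C0 by (simp add: C_def)
    fix f :: "'a \<Rightarrow> complex" and t R :: real and x :: 'a
    assume f: "integrable lborel f" and t: "0 < t" "t powr \<alpha> \<le> 1" and R_def: "R = t powr (1 - \<alpha>)"
    have R: "R > 0" using t by (simp add: R_def)
    define F where "F = conv_dil f \<phi> t"
    have F: "integrable lborel F" and F_hat: "fourier F \<xi> = fourier f \<xi> * fourier \<phi> (t *\<^sub>R \<xi>)" for \<xi>
      unfolding F_def using fourier_conv_dil[OF f \<phi>(1) t(1)] by auto
    have [measurable]: "F \<in> borel_measurable borel" using F borel_measurable_integrable by auto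
    have G: "multiplier_conv_dil m f \<phi> t y = (LINT \<xi>|lborel. m \<xi> * fourier F \<xi> * echar (y \<bullet> \<xi>))" for y
      unfolding multiplier_conv_dil_echar F_hat ..
    have annulus: "1 / (2 * t) \<le> norm \<xi>" "norm \<xi> \<le> 2 / t" "1 \<le> norm \<xi> powr \<alpha>" if "fourier F \<xi> \<noteq> 0" for \<xi>
    proof -
      have *: "if \<alpha> \<ge> 0 then 1 \<le> t * norm \<xi> \<and> t * norm \<xi> \<le> 2 else 1/2 \<le> t * norm \<xi> \<and> t * norm \<xi> \<le> 1"
        using \<phi>(2)[of "t *\<^sub>R \<xi>"] that t unfolding F_hat norm_scaleR by (simp split: if_splits)
      then have **: "1/2 \<le> t * norm \<xi>" "t * norm \<xi> \<le> 2" by (auto split: if_splits)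
      then show "1 / (2 * t) \<le> norm \<xi>" "norm \<xi> \<le> 2 / t" using t by (auto simp: field_simps)
      \<comment> \<open>On the support of \<open>fourier \<phi>\<close> the norm is at least 1 or at
        most 1 according to the sign of \<open>\<alpha>\<close>, so this power is at least 1;
        \<open>t powr \<alpha> \<le> 1\<close> then transfers the bound to
        \<open>norm \<xi>\<close>, which is the condition on the distance of a subdyadic
        ball.\<close>
      have "1 \<le> (t * norm \<xi>) powr \<alpha>"
      proof (cases "\<alpha> \<ge> 0")
        case True
        then show ?thesis using * by (intro ge_one_powr_ge_zero) auto
      next
        case False
        then show ?thesis using * ** powr_mono2'[of \<alpha> "t * norm \<xi>" 1] by auto
      qed
      also have "\<dots> = t powr \<alpha> * norm \<xi> powr \<alpha>" using t by (simp add: powr_mult)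
      also have "\<dots> \<le> 1 * norm \<xi> powr \<alpha>" using t by (intro mult_right_mono) auto
      finally show "1 \<le> norm \<xi> powr \<alpha>" by simp
    qed
    let ?L = "\<integral>\<^sup>+u. indicator (cball 0 R) u * ennreal ((cmod (LINT \<xi>|lborel. m \<xi> * fourier F \<xi> * echar ((x + u) \<bullet> \<xi>)))\<^sup>2) \<partial>lborel"
    let ?E = "\<integral>\<^sup>+v. ennreal ((cmod (F (x + v)))\<^sup>2 / (1 + norm v / R) powr (2 * \<sigma>)) \<partial>lborel"
    have G_meas[measurable]: "(\<lambda>y. LINT \<xi>|lborel. m \<xi> * fourier F \<xi> * echar (y \<bullet> \<xi>)) \<in> borel_measurable borel"
    proof -
      have "(\<lambda>y. fourier (\<lambda>\<xi>. m \<xi> * fourier F \<xi>) (- y)) \<in> borel_measurable borel" by measurable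
      then show ?thesis unfolding fourier_echar[of "\<lambda>\<xi>. m \<xi> * fourier F \<xi>"] by (simp add: inner_commute)
    qed
    have L: "(\<integral>\<^sup>+y. indicator (cball x R) y * ennreal ((cmod (multiplier_conv_dil m f \<phi> t y))\<^sup>2) \<partial>lborel) = ?L"
    proof -
      have ind: "indicator (cball x R) (x + u) = (indicator (cball 0 R) u :: ennreal)" for u
        by (simp add: indicator_def dist_norm)
      define g where "g y = (LINT \<xi>|lborel. m \<xi> * fourier F \<xi> * echar (y \<bullet> \<xi>))" for y
      have [measurable]: "g \<in> borel_measurable borel" unfolding g_def by (rule G_meas)
      have [measurable]: "cball x R \<in> sets borel" by simp
      have "(\<lambda>y. indicator (cball x R) y * ennreal ((cmod (g y))\<^sup>2)) \<in> borel_measurable borel"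
        by measurable
      from nn_integral_lborel_shift(1)[OF this, of x] ind
      show ?thesis unfolding G g_def[symmetric] by simp
    qed
    have E: "(\<integral>\<^sup>+y. ennreal ((cmod (conv_dil f \<phi> t y))\<^sup>2 * (1 + norm (x - y) / R) powr (- 2 * \<sigma>)) \<partial>lborel) = ?E"
      using nn_integral_lborel_shift(1)[of "\<lambda>y. ennreal ((cmod (F y))\<^sup>2 * (1 + norm (x - y) / R) powr (- 2 * \<sigma>))" x]
      by (simp add: F_def[symmetric] powr_minus divide_inverse)
    have "?L \<le> ennreal (C * t powr (2 * \<beta>)) * ?E"
    proof (cases "integrable lborel (\<lambda>\<xi>. m \<xi> * fourier F \<xi>)")
      case False
      \<comment> \<open>The Bochner integral defining \<open>T\<^sub>m F\<close> then takes the junk value 0.\<close>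
      have "(LINT \<xi>|lborel. m \<xi> * fourier F \<xi> * echar (y \<bullet> \<xi>)) = 0" for y
      proof (rule not_integrable_integral_eq)
        show "\<not> integrable lborel (\<lambda>\<xi>. m \<xi> * fourier F \<xi> * echar (y \<bullet> \<xi>))"
        proof
          assume "integrable lborel (\<lambda>\<xi>. m \<xi> * fourier F \<xi> * echar (y \<bullet> \<xi>))"
          then have "integrable lborel (\<lambda>\<xi>. m \<xi> * fourier F \<xi> * echar (y \<bullet> \<xi>) * echar (- (y \<bullet> \<xi>)))"
            by (rule integrable_mult_echar) simp
          with False show False by (simp add: mult.assoc flip: echar_add)
        qed
      qed
      then show ?thesis by simp
    next
      case True
      define b where "b = (\<lambda>\<xi>. complex_of_real (\<Psi> ((R / \<delta>) *\<^sub>R \<xi>)))"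
      have Rd: "R / \<delta> > 0" using R \<delta> by simp
      have \<Psi>c: "integrable lborel (\<lambda>\<xi>. complex_of_real (\<Psi> \<xi>))"
        using integrable_bumplike[OF \<Psi>(1)] by (rule integrable_of_real)
      have [measurable]: "\<Psi> \<in> borel_measurable borel" by (rule borel_measurable_bumplike[OF \<Psi>(1)])
      have b: "integrable lborel b"
        unfolding b_def using integrable_lborel_affine_iff[of "\<lambda>\<xi>. complex_of_real (\<Psi> \<xi>)" "R / \<delta>" 0] \<Psi>c R \<delta>(1) by simp
      obtain B where B: "\<And>x. \<bar>\<Psi> x\<bar> \<le> B" using bumplike_bounded[OF \<Psi>(1)] by blast
      have bB: "cmod (b \<xi>) \<le> B" for \<xi> using B by (simp add: b_def)
      have \<Phi>: "integrable lborel (fourier b)"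
      proof -
        have "fourier b = (\<lambda>u. complex_of_real (1 / \<bar>R / \<delta>\<bar> ^ DIM('a)) * fourier (\<lambda>\<xi>. complex_of_real (\<Psi> \<xi>)) (0 + (1 / (R / \<delta>)) *\<^sub>R u))"
          unfolding b_def using fourier_scale[of "\<lambda>\<xi>. complex_of_real (\<Psi> \<xi>)" "R / \<delta>"] R \<delta>(1) by (simp add: fun_eq_iff)
        moreover have "integrable lborel (\<lambda>u. fourier (\<lambda>\<xi>. complex_of_real (\<Psi> \<xi>)) (0 + (1 / (R / \<delta>)) *\<^sub>R u))"
          using R \<delta>(1) integrable_fourier_bumplike[OF \<Psi>(1)]
          by (subst integrable_lborel_affine_iff) auto
        ultimately show ?thesis by simp
      qed
      have b_cont: "continuous_on UNIV b"
        unfolding b_def by (intro continuous_intros continuous_on_compose2[OF continuous_on_bumplike[OF \<Psi>(1), of UNIV]]) auto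
      \<comment> \<open>Inversion yields \<open>b (- \<xi>)\<close>, and the bump is even.\<close>
      have b_hat: "fourier (fourier b) \<xi> = b \<xi>" for \<xi>
        using fourier_inversion[OF b b_cont bB \<Phi>, of "- \<xi>"] \<Psi>(2)[of "(R / \<delta>) *\<^sub>R \<xi>"] by (simp add: b_def)
      define \<kappa> where "\<kappa> = I * (\<delta> / R) ^ DIM('a)"
      have \<kappa>: "0 < \<kappa>" using I \<delta> R by (simp add: \<kappa>_def)
      have X: "ennreal (\<kappa>\<^sup>2) * ?L \<le> ennreal (K * t powr (2 * \<beta>) / R ^ DIM('a))
          * (\<integral>\<^sup>+u. ennreal ((cmod (fourier b u))\<^sup>2 * (1 + norm u / R) powr (2 * \<sigma>)) \<partial>lborel) * ?E"
      proof (rule local_multiplier_estimate[OF F m True b bB \<Phi> norm_fourier_le b_hat])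
        show "(1 + norm v / R) powr (2 * \<sigma>) \<le> (1 + norm (u + v) / R) powr (2 * \<sigma>) * (1 + norm u / R) powr (2 * \<sigma>)" for u v :: 'a
          using R \<sigma> by (intro one_plus_norm_powr_submult) auto
        show "0 < (1 + norm z / R) powr (2 * \<sigma>)" for z :: 'a
        proof -
          have "0 < 1 + norm z / R" using R by (intro add_pos_nonneg) auto
          then show ?thesis by simp
        qed
        show "\<kappa> \<le> cmod (fourier (\<lambda>\<xi>. (b \<xi>)\<^sup>2) u)" if "u \<in> cball 0 R" for u
          using fourier_square_window_lower[OF \<Psi>(1) \<delta>(1,2) R] that by (simp add: \<kappa>_def I_def b_def)
        fix \<zeta> :: 'a
        show "(\<forall>\<xi>. fourier F \<xi> * b (\<xi> + \<zeta>) = 0) \<or> integrable lborel (\<lambda>\<xi>. m \<xi> * b (\<xi> + \<zeta>)) \<and>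
           (\<integral>\<^sup>+z. ennreal ((cmod (fourier (\<lambda>\<xi>. m \<xi> * b (\<xi> + \<zeta>)) z))\<^sup>2 * (1 + norm z / R) powr (2 * \<sigma>)) \<partial>lborel)
             \<le> ennreal (K * t powr (2 * \<beta>) / R ^ DIM('a))"
        proof (cases "\<forall>\<xi>. fourier F \<xi> * b (\<xi> + \<zeta>) = 0")
          case False
          then obtain \<xi>0 where \<xi>0: "fourier F \<xi>0 \<noteq> 0" "b (\<xi>0 + \<zeta>) \<noteq> 0" by auto
          have "norm ((R / \<delta>) *\<^sub>R (\<xi>0 + \<zeta>)) < 1"
            using \<xi>0(2) bumplike_outside[OF \<Psi>(1), of "(R / \<delta>) *\<^sub>R (\<xi>0 + \<zeta>)"] by (force simp: b_def not_less)
          then have "norm (\<xi>0 + \<zeta>) \<le> \<delta> / R"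
            unfolding norm_scaleR using R \<delta> by (simp add: field_simps)
          then show ?thesis using local_bound[OF t(1) R_def annulus[OF \<xi>0(1)] _ b_def] by blast
        qed simp
      qed (use \<kappa> in auto)
      have P: "(\<integral>\<^sup>+u. ennreal ((cmod (fourier b u))\<^sup>2 * (1 + norm u / R) powr (2 * \<sigma>)) \<partial>lborel)
          \<le> ennreal ((\<delta> / R) ^ DIM('a) * \<delta> powr (- 2 * \<sigma>) * j)"
      proof -
        have "\<delta> \<le> 1" "0 \<le> 2 * \<sigma>" using \<delta> \<sigma> by auto
        note nn_integral_fourier_window_weighted[OF \<Psi>(1) R \<delta>(1) this, folded J_def b_def]
        also have "ennreal ((\<delta> / R) ^ DIM('a) * \<delta> powr (- (2 * \<sigma>))) * J
            = ennreal ((\<delta> / R) ^ DIM('a) * \<delta> powr (- (2 * \<sigma>)) * j)"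
          using R \<delta> by (simp only: j(1)) (intro ennreal_mult[symmetric] mult_nonneg_nonneg j, auto)
        finally show ?thesis by simp
      qed
      have "?L = ennreal (1 / \<kappa>\<^sup>2) * (ennreal (\<kappa>\<^sup>2) * ?L)"
        using \<kappa> by (simp add: mult.assoc[symmetric] flip: ennreal_mult)
      also have "\<dots> \<le> ennreal (1 / \<kappa>\<^sup>2) * (ennreal (K * t powr (2 * \<beta>) / R ^ DIM('a)) * ennreal ((\<delta> / R) ^ DIM('a) * \<delta> powr (- 2 * \<sigma>) * j) * ?E)"
        by (intro mult_left_mono order_trans[OF X] mult_right_mono P) auto
      also have "\<dots> = ennreal (1 / \<kappa>\<^sup>2 * (K * t powr (2 * \<beta>) / R ^ DIM('a) * ((\<delta> / R) ^ DIM('a) * \<delta> powr (- 2 * \<sigma>) * j))) * ?E"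
      proof -
        have "ennreal a * (ennreal b * ennreal c * e) = ennreal (a * (b * c)) * e"
          if "0 \<le> a" "0 \<le> b" "0 \<le> c" for a b c e
          using that by (simp add: ennreal_mult mult.assoc)
        then show ?thesis using K R \<delta>(1) j(2) by simp
      qed
      also have "\<dots> \<le> ennreal (C * t powr (2 * \<beta>)) * ?E"
      proof (intro mult_right_mono ennreal_leI)
        \<comment> \<open>\<open>1 / \<kappa>\<^sup>2\<close> contributes
          \<open>R ^ (2 * DIM('a))\<close>, which cancels the two denominators
          \<open>R ^ DIM('a)\<close>.\<close>
        have "1 / \<kappa>\<^sup>2 * (K * t powr (2 * \<beta>) / R ^ DIM('a) * ((\<delta> / R) ^ DIM('a) * \<delta> powr (- 2 * \<sigma>) * j))
          = K * \<delta> powr (- 2 * \<sigma>) * j / (I\<^sup>2 * \<delta> ^ DIM('a)) * t powr (2 * \<beta>)"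
          using R \<delta> I by (simp add: \<kappa>_def power_mult_distrib power_divide power2_eq_square field_simps)
        also have "\<dots> \<le> C * t powr (2 * \<beta>)"
          by (intro mult_right_mono) (auto simp: C_def)
        finally show "1 / \<kappa>\<^sup>2 * (K * t powr (2 * \<beta>) / R ^ DIM('a) * ((\<delta> / R) ^ DIM('a) * \<delta> powr (- 2 * \<sigma>) * j)) \<le> C * t powr (2 * \<beta>)" .
      qed simp
      finally show ?thesis .
    qed
    then show "(\<integral>\<^sup>+y. indicator (cball x R) y * ennreal ((cmod (multiplier_conv_dil m f \<phi> t y))\<^sup>2) \<partial>lborel)
      \<le> ennreal (C * t powr (2 * \<beta>)) * (\<integral>\<^sup>+y. ennreal ((cmod (conv_dil f \<phi> t y))\<^sup>2 * (1 + norm (x - y) / R) powr (- 2 * \<sigma>)) \<partial>lborel)"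
      unfolding L E .
  qed
qed

section \<open>Integration over the scales\<close>

lemma measurable_conv_dil [measurable (raw)]:
  fixes f \<phi> :: "'a::euclidean_space \<Rightarrow> complex"
  assumes [measurable]: "f \<in> borel_measurable borel" "\<phi> \<in> borel_measurable borel"
    "s \<in> borel_measurable N" "y \<in> N \<rightarrow>\<^sub>M borel"
  shows "(\<lambda>p. conv_dil f \<phi> (s p) (y p)) \<in> borel_measurable N"
proof -
  \<comment> \<open>A plain integral is a Fourier transform at frequency 0, so the rule for
    parametrised Fourier integrals applies.\<close>
  have "(\<lambda>p. fourier (\<lambda>z. f z * dil \<phi> (s p) (y p - z)) 0) \<in> borel_measurable N"
    unfolding dil_def by measurable
  then show ?thesis by (simp add: fourier_echar conv_dil_def)
qed

lemma measurable_multiplier_conv_dil [measurable (raw)]: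
  fixes m f \<phi> :: "'a::euclidean_space \<Rightarrow> complex"
  assumes [measurable]: "m \<in> borel_measurable borel" "f \<in> borel_measurable borel" "\<phi> \<in> borel_measurable borel"
    "s \<in> borel_measurable N" "y \<in> N \<rightarrow>\<^sub>M borel"
  shows "(\<lambda>p. multiplier_conv_dil m f \<phi> (s p) (y p)) \<in> borel_measurable N"
proof -
  have "(\<lambda>p. fourier (\<lambda>\<xi>. m \<xi> * (fourier f \<xi> * fourier \<phi> (s p *\<^sub>R \<xi>))) (- y p)) \<in> borel_measurable N"
    by measurable
  then show ?thesis
    unfolding multiplier_conv_dil_echar fourier_echar[of "\<lambda>\<xi>. m \<xi> * (fourier f \<xi> * fourier \<phi> (_ *\<^sub>R \<xi>))"]
    by (simp add: inner_commute)
qed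

lemma borel_measurable_pair_lborel:
  "borel_measurable (lborel \<Otimes>\<^sub>M lborel) = borel_measurable (borel \<Otimes>\<^sub>M borel)"
  by (intro measurable_cong_sets sets_pair_measure_cong) auto

lemma nn_integral_cmult2:
  "g \<in> borel_measurable M \<Longrightarrow> (\<integral>\<^sup>+y. a * (b * g y) \<partial>M) = a * (b * (\<integral>\<^sup>+y. g y \<partial>M))"
  by (simp add: nn_integral_cmult)

text \<open>Tonelli with \<open>t\<close> outermost, so that the inner integral, over the section of
  the cone at height \<open>t\<close>, is the left-hand side of the fixed-scale estimate.\<close>

lemma g_sq_iterated:
  fixes F :: "real \<Rightarrow> 'a::euclidean_space \<Rightarrow> complex"
  assumes F[measurable]: "(\<lambda>p. F (snd p) (fst p)) \<in> borel_measurable (borel \<Otimes>\<^sub>M borel)"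
  shows "g_sq \<alpha> \<beta> F x = (\<integral>\<^sup>+t. indicator {t. 0 < t \<and> t powr \<alpha> \<le> 1} t *
     (ennreal (t powr (- ((1 - \<alpha>) * real DIM('a) + 2 * \<beta>)) / t) *
      (\<integral>\<^sup>+y. indicator (cball x (t powr (1 - \<alpha>))) y * ennreal ((cmod (F t y))\<^sup>2) \<partial>lborel)) \<partial>lborel)"
proof -
  have [measurable]: "F t \<in> borel_measurable borel" for t
    using measurable_compose[OF measurable_Pair2' F, of t] by simp
  have [measurable]: "cball x r \<in> sets borel" for r by simp
  have "g_sq \<alpha> \<beta> F x = (\<integral>\<^sup>+p. (case p of (y, t) \<Rightarrow>
      indicator {(y, t). t > 0 \<and> t powr \<alpha> \<le> 1 \<and> norm (y - x) \<le> t powr (1 - \<alpha>)} (y, t) *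
      ennreal ((cmod (F t y))\<^sup>2 * t powr (- ((1 - \<alpha>) * real DIM('a) + 2 * \<beta>)) / t)) \<partial>(lborel \<Otimes>\<^sub>M lborel))"
    unfolding g_sq_def lborel_prod ..
  also have "\<dots> = (\<integral>\<^sup>+t. \<integral>\<^sup>+y. indicator {(y, t). t > 0 \<and> t powr \<alpha> \<le> 1 \<and> norm (y - x) \<le> t powr (1 - \<alpha>)} (y, t) *
      ennreal ((cmod (F t y))\<^sup>2 * t powr (- ((1 - \<alpha>) * real DIM('a) + 2 * \<beta>)) / t) \<partial>lborel \<partial>lborel)"
    by (subst lborel_pair.nn_integral_snd[symmetric])
       (simp_all add: case_prod_beta' borel_measurable_pair_lborel)
  also have "\<dots> = (\<integral>\<^sup>+t. \<integral>\<^sup>+y. indicator {t. 0 < t \<and> t powr \<alpha> \<le> 1} t *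
     (ennreal (t powr (- ((1 - \<alpha>) * real DIM('a) + 2 * \<beta>)) / t) *
      (indicator (cball x (t powr (1 - \<alpha>))) y * ennreal ((cmod (F t y))\<^sup>2))) \<partial>lborel \<partial>lborel)"
  proof (intro nn_integral_cong)
    fix t :: real and y :: 'a
    let ?w = "t powr (- ((1 - \<alpha>) * real DIM('a) + 2 * \<beta>))"
    have weight: "ennreal ((cmod (F t y))\<^sup>2 * ?w / t) = ennreal (?w / t) * ennreal ((cmod (F t y))\<^sup>2)" if "0 < t"
      using that by (subst ennreal_mult[symmetric]) (auto simp: mult.commute)
    have ball: "y \<in> cball x (t powr (1 - \<alpha>)) \<longleftrightarrow> norm (y - x) \<le> t powr (1 - \<alpha>)"
      unfolding mem_cball dist_norm norm_minus_commute[of x y] ..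
    show "indicator {(y, t). t > 0 \<and> t powr \<alpha> \<le> 1 \<and> norm (y - x) \<le> t powr (1 - \<alpha>)} (y, t) *
      ennreal ((cmod (F t y))\<^sup>2 * ?w / t)
      = indicator {t. 0 < t \<and> t powr \<alpha> \<le> 1} t *
     (ennreal (?w / t) * (indicator (cball x (t powr (1 - \<alpha>))) y * ennreal ((cmod (F t y))\<^sup>2)))"
    proof (cases "0 < t \<and> t powr \<alpha> \<le> 1 \<and> norm (y - x) \<le> t powr (1 - \<alpha>)")
      case True
      then show ?thesis unfolding indicator_def ball weight[OF conjunct1[OF True]] by simp
    next
      case False
      then show ?thesis unfolding indicator_def ball by auto
    qed
  qed
  also have "\<dots> = (\<integral>\<^sup>+t. indicator {t. 0 < t \<and> t powr \<alpha> \<le> 1} t *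
     (ennreal (t powr (- ((1 - \<alpha>) * real DIM('a) + 2 * \<beta>)) / t) *
      (\<integral>\<^sup>+y. indicator (cball x (t powr (1 - \<alpha>))) y * ennreal ((cmod (F t y))\<^sup>2) \<partial>lborel)) \<partial>lborel)"
    by (rule nn_integral_cong, rule nn_integral_cmult2) measurable
  finally show ?thesis .
qed

lemma g_star_sq_iterated:
  fixes F :: "real \<Rightarrow> 'a::euclidean_space \<Rightarrow> complex"
  assumes F[measurable]: "(\<lambda>p. F (snd p) (fst p)) \<in> borel_measurable (borel \<Otimes>\<^sub>M borel)"
  shows "g_star_sq \<alpha> \<beta> \<mu> F x = (\<integral>\<^sup>+t. indicator {t. 0 < t \<and> t powr \<alpha> \<le> 1} t *
     (ennreal (t powr (- ((1 - \<alpha>) * real DIM('a) + 2 * \<beta>)) / t) *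
      (\<integral>\<^sup>+y. ennreal ((cmod (F t y))\<^sup>2 * (1 + norm (x - y) / t powr (1 - \<alpha>)) powr (- real DIM('a) * \<mu>)) \<partial>lborel)) \<partial>lborel)"
proof -
  have [measurable]: "F t \<in> borel_measurable borel" for t
    using measurable_compose[OF measurable_Pair2' F, of t] by simp
  have "g_star_sq \<alpha> \<beta> \<mu> F x = (\<integral>\<^sup>+p. (case p of (y, t) \<Rightarrow>
      indicator {(y, t). t > 0 \<and> t powr \<alpha> \<le> 1} (y, t) *
      ennreal ((cmod (F t y))\<^sup>2 * (1 + norm (x - y) / t powr (1 - \<alpha>)) powr (- real DIM('a) * \<mu>)
               * t powr (- ((1 - \<alpha>) * real DIM('a) + 2 * \<beta>)) / t)) \<partial>(lborel \<Otimes>\<^sub>M lborel))"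
    unfolding g_star_sq_def lborel_prod ..
  also have "\<dots> = (\<integral>\<^sup>+t. \<integral>\<^sup>+y. indicator {(y :: 'a, t). t > 0 \<and> t powr \<alpha> \<le> 1} (y, t) *
      ennreal ((cmod (F t y))\<^sup>2 * (1 + norm (x - y) / t powr (1 - \<alpha>)) powr (- real DIM('a) * \<mu>)
               * t powr (- ((1 - \<alpha>) * real DIM('a) + 2 * \<beta>)) / t) \<partial>lborel \<partial>lborel)"
    by (subst lborel_pair.nn_integral_snd[symmetric])
       (simp_all add: case_prod_beta' borel_measurable_pair_lborel)
  also have "\<dots> = (\<integral>\<^sup>+t. \<integral>\<^sup>+y. indicator {t. 0 < t \<and> t powr \<alpha> \<le> 1} t *
     (ennreal (t powr (- ((1 - \<alpha>) * real DIM('a) + 2 * \<beta>)) / t) *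
      ennreal ((cmod (F t y))\<^sup>2 * (1 + norm (x - y) / t powr (1 - \<alpha>)) powr (- real DIM('a) * \<mu>))) \<partial>lborel \<partial>lborel)"
  proof (intro nn_integral_cong)
    fix t :: real and y :: 'a
    let ?e = "(cmod (F t y))\<^sup>2 * (1 + norm (x - y) / t powr (1 - \<alpha>)) powr (- real DIM('a) * \<mu>)"
    have "ennreal (?e * t powr (- ((1 - \<alpha>) * real DIM('a) + 2 * \<beta>)) / t)
        = ennreal (t powr (- ((1 - \<alpha>) * real DIM('a) + 2 * \<beta>)) / t) * ennreal ?e" if "0 < t"
      using that by (subst ennreal_mult[symmetric]) (auto simp: mult.commute)
    then show "indicator {(y :: 'a, t). t > 0 \<and> t powr \<alpha> \<le> 1} (y, t) *
      ennreal (?e * t powr (- ((1 - \<alpha>) * real DIM('a) + 2 * \<beta>)) / t)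
      = indicator {t. 0 < t \<and> t powr \<alpha> \<le> 1} t *
     (ennreal (t powr (- ((1 - \<alpha>) * real DIM('a) + 2 * \<beta>)) / t) * ennreal ?e)"
      by (simp add: indicator_def)
  qed
  also have "\<dots> = (\<integral>\<^sup>+t. indicator {t. 0 < t \<and> t powr \<alpha> \<le> 1} t *
     (ennreal (t powr (- ((1 - \<alpha>) * real DIM('a) + 2 * \<beta>)) / t) *
      (\<integral>\<^sup>+y. ennreal ((cmod (F t y))\<^sup>2 * (1 + norm (x - y) / t powr (1 - \<alpha>)) powr (- real DIM('a) * \<mu>)) \<partial>lborel)) \<partial>lborel)"
    by (rule nn_integral_cong, rule nn_integral_cmult2) measurable
  finally show ?thesis .
qed

theorem theorem1:
  fixes \<alpha> \<beta> \<sigma> c1 c2 :: real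
    and N :: nat
    and m :: "'a::euclidean_space \<Rightarrow> complex"
    and \<phi> :: "'a \<Rightarrow> complex"
  assumes N: "N > DIM('a)"
    and c12: "0 < c1" "c1 \<le> c2"
    and comparable: "\<exists>\<kappa>>0. \<forall>(c::'a) r. subdyadic c1 c2 \<alpha> c r \<longrightarrow>
                        infdist 0 (ball c (2 * r)) \<ge> \<kappa> * infdist 0 (ball c r)"
    and phi_schwartz: "schwartz \<phi>"
    and phi_supp: "\<forall>\<xi>. fourier \<phi> \<xi> \<noteq> 0 \<longrightarrow>
                     (if \<alpha> \<ge> 0 then 1 \<le> norm \<xi> \<and> norm \<xi> \<le> 2 else 1/2 \<le> norm \<xi> \<and> norm \<xi> \<le> 1)"
    and phi_calderon: "\<forall>\<xi>. \<xi> \<noteq> 0 \<longrightarrow>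
                     (LINT t:{0<..}|lborel. fourier \<phi> (t *\<^sub>R \<xi>) / complex_of_real t) = 1"
    and m_meas: "m \<in> borel_measurable lborel"
    and sigma: "\<sigma> > real DIM('a) / 2"
    and hyp: "\<forall>\<theta>. 0 \<le> \<theta> \<and> \<theta> \<le> \<sigma> \<longrightarrow>
               (\<exists>C. \<forall>(c::'a) r \<Psi>. subdyadic c1 c2 \<alpha> c r \<and> normalised_bump N \<Psi> \<longrightarrow>
                  hsob_finite \<theta> (\<lambda>\<xi>. m \<xi> * complex_of_real (adapted_bump \<Psi> c r \<xi>)) \<and>
                  infdist 0 (ball c r) powr (\<beta> + (1 - \<alpha>) * \<theta>)
                    * measure lborel (ball c r) powr (- 1 / 2)
                    * hsob_norm \<theta> (\<lambda>\<xi>. m \<xi> * complex_of_real (adapted_bump \<Psi> c r \<xi>)) \<le> C)"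
  shows "\<exists>C. \<forall>f x. schwartz f \<longrightarrow>
           g_sq \<alpha> \<beta> (multiplier_conv_dil m f \<phi>) x
             \<le> ennreal C * g_star_sq \<alpha> 0 (2 * \<sigma> / real DIM('a)) (conv_dil f \<phi>) x"
proof -
  have \<sigma>: "0 \<le> \<sigma>" using sigma by (smt (verit) divide_nonneg_nonneg of_nat_0_le_iff)
  have m[measurable]: "m \<in> borel_measurable borel" using m_meas by simp
  have \<phi>: "integrable lborel \<phi>" by (rule integrable_schwartz[OF phi_schwartz])
  have [measurable]: "\<phi> \<in> borel_measurable borel" using \<phi> borel_measurable_integrable by auto
  obtain C where C: "C > 0" and est: "\<And>f t R x. integrable lborel f \<Longrightarrow> 0 < t \<Longrightarrow> t powr \<alpha> \<le> 1 \<Longrightarrow> R = t powr (1 - \<alpha>) \<Longrightarrow>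
      (\<integral>\<^sup>+y. indicator (cball x R) y * ennreal ((cmod (multiplier_conv_dil m f \<phi> t y))\<^sup>2) \<partial>lborel)
      \<le> ennreal (C * t powr (2 * \<beta>)) * (\<integral>\<^sup>+y. ennreal ((cmod (conv_dil f \<phi> t y))\<^sup>2 * (1 + norm (x - y) / R) powr (- 2 * \<sigma>)) \<partial>lborel)"
    by (rule estimate_at_scale[OF c12 \<sigma> m \<phi>, of \<alpha> N \<beta>]) (use phi_supp hyp \<sigma> in auto)
  have "g_sq \<alpha> \<beta> (multiplier_conv_dil m f \<phi>) x
      \<le> ennreal C * g_star_sq \<alpha> 0 (2 * \<sigma> / real DIM('a)) (conv_dil f \<phi>) x" if "schwartz f" for f x
  proof -
    have f: "integrable lborel f" by (rule integrable_schwartz[OF that])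
    have [measurable]: "f \<in> borel_measurable borel" using f borel_measurable_integrable by auto
    let ?E = "\<lambda>t. \<integral>\<^sup>+y. ennreal ((cmod (conv_dil f \<phi> t y))\<^sup>2 * (1 + norm (x - y) / t powr (1 - \<alpha>)) powr (- 2 * \<sigma>)) \<partial>lborel"
    let ?I = "\<lambda>t. indicator {t. 0 < t \<and> t powr \<alpha> \<le> 1} t *
       (ennreal (t powr (- ((1 - \<alpha>) * real DIM('a) + 2 * 0)) / t) * ?E t)"
    have "g_sq \<alpha> \<beta> (multiplier_conv_dil m f \<phi>) x \<le> (\<integral>\<^sup>+t. ennreal C * ?I t \<partial>lborel)"
    proof (subst g_sq_iterated, measurable, rule nn_integral_mono)
      fix t :: real
      let ?w = "ennreal (t powr (- ((1 - \<alpha>) * real DIM('a) + 2 * \<beta>)) / t)"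
      let ?G = "\<integral>\<^sup>+y. indicator (cball x (t powr (1 - \<alpha>))) y * ennreal ((cmod (multiplier_conv_dil m f \<phi> t y))\<^sup>2) \<partial>lborel"
      show "indicator {t. 0 < t \<and> t powr \<alpha> \<le> 1} t * (?w * ?G) \<le> ennreal C * ?I t"
      proof (cases "0 < t \<and> t powr \<alpha> \<le> 1")
        case True
        have assoc: "ennreal a * (ennreal b * e) = ennreal (a * b) * e" if "0 \<le> a" "0 \<le> b" for a b e
          using that by (simp add: ennreal_mult mult.assoc)
        have "?w * ?G \<le> ?w * (ennreal (C * t powr (2 * \<beta>)) * ?E t)"
          using True by (intro mult_left_mono est[OF f]) auto
        also have "\<dots> = ennreal (t powr (- ((1 - \<alpha>) * real DIM('a) + 2 * \<beta>)) / t * (C * t powr (2 * \<beta>))) * ?E t"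
          by (rule assoc) (use True C in auto)
        \<comment> \<open>The gain \<open>t powr (2 * \<beta>)\<close> of the fixed-scale estimate
          is exactly the quotient of the weights of orders 0 and \<open>\<beta>\<close>.\<close>
        also have "t powr (- ((1 - \<alpha>) * real DIM('a) + 2 * \<beta>)) / t * (C * t powr (2 * \<beta>))
           = C * (t powr (- ((1 - \<alpha>) * real DIM('a) + 2 * 0)) / t)"
        proof -
          have "t powr (- ((1 - \<alpha>) * real DIM('a) + 2 * \<beta>)) * t powr (2 * \<beta>) = t powr (- ((1 - \<alpha>) * real DIM('a) + 2 * 0))"
            unfolding powr_add[symmetric] by (rule arg_cong[where f = "(powr) t"]) simp
          then show ?thesis by (simp add: mult_ac)
        qed
        also have "ennreal (C * (t powr (- ((1 - \<alpha>) * real DIM('a) + 2 * 0)) / t)) * ?E t = ennreal C * ?I t"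
          using True by (subst assoc[symmetric]) (use True C in auto)
        finally show ?thesis using True by simp
      qed simp
    qed
    also have "\<dots> = ennreal C * (\<integral>\<^sup>+t. ?I t \<partial>lborel)"
    proof (rule nn_integral_cmult)
      show "?I \<in> borel_measurable lborel" by measurable
    qed
    \<comment> \<open>The exponents agree because \<open>DIM('a)\<close> times
      \<open>2 * \<sigma> / DIM('a)\<close> is \<open>2 * \<sigma>\<close>.\<close>
    also have "(\<integral>\<^sup>+t. ?I t \<partial>lborel) = g_star_sq \<alpha> 0 (2 * \<sigma> / real DIM('a)) (conv_dil f \<phi>) x"
      by (subst g_star_sq_iterated) simp_all
    finally show ?thesis .
  qed
  then show ?thesis by blast
qed

end
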